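(* The set of central values $$\{L(\tfrac12,\eta)\ \mid\ p \text{ prime},\ \eta \text{ a non-trivial primitive Dirichlet character of } \mathbf{F}_p[X]\}$$ is dense in $\mathbf{C}$.
   Context: Let $\mathbf{F}_q$ be a finite field with $q$ elements. A Dirichlet character modulo a (non-zero) polynomial $g\in\mathbf{F}_q[X]$ is a map $\eta:\mathbf{F}_q[X]\to\mathbf{C}$ with $\eta(f)=0$ if $f$ and $g$ are not coprime and $\eta(f)=\underline{\eta}(f \bmod g)$ otherwise, where $\underline{\eta}:(\mathbf{F}_q[X]/g\mathbf{F}_q[X])^{\times}\to\mathbf{C}^{\times}$ is a group homomorphism. It is non-trivial if $\underline{\eta}\ne 1$, and primitive if it cannot be defined modulo a proper divisor of $g$. The associated $L$-function is defined by the Euler product $L(s,\eta)=\prod_{\pi}(1-\eta(\pi)|\pi|^{-s})^{-1}$ over monic irreducible polynomials $\pi\in\mathbf{F}_q[X]$, with $|\pi|=q^{\deg \pi}$ (for $\mathrm{Re}(s)$ large). For $\eta$ non-trivial and primitive modulo $g$, it is a polynomial in $q^{-s}$ of degree at most $\deg(g)-1$, which defines $L(s,\eta)$ for all $s\in\mathbf{C}$. In the theorem, $q=p$ ranges over all primes and $\eta$ over non-trivial primitive characters modulo arbitrary $g\in\mathbf{F}_p[X]$. *)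

theory Defs
  imports
    "HOL-Analysis.Analysis"
    "HOL-Algebra.Algebra"
    "HOL-Computational_Algebra.Computational_Algebra"
    "HOL-Number_Theory.Residues"
begin

hide_const (open) Divisibility.prime

text \<open>
  Everything is stated for a finite field \<open>R\<close> given as a ring structure, so that the prime
  \<open>p\<close> of \<^term>\<open>residue_ring (int p)\<close> can be quantified over inside a formula.
  An element of \<^term>\<open>carrier (poly_ring R)\<close> is its list of coefficients, leading
  coefficient first, with \<open>[]\<close> for zero; hence a nonzero \<open>f\<close> has leading coefficient
  \<open>hd f\<close> and degree \<open>length f - 1\<close>.
\<close>

definition coprime_poly :: "('a, 'b) ring_scheme \<Rightarrow> 'a list \<Rightarrow> 'a list \<Rightarrow> bool" where
  "coprime_poly R f g \<longleftrightarrow>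
     (\<forall>d\<in>carrier (poly_ring R).
        d divides\<^bsub>poly_ring R\<^esub> f \<and> d divides\<^bsub>poly_ring R\<^esub> g \<longrightarrow> d \<in> Units (poly_ring R))"

definition residue_units :: "('a, 'b) ring_scheme \<Rightarrow> 'a list \<Rightarrow> 'a list set monoid" where
  "residue_units R g = units_of (poly_ring R Quot (PIdl\<^bsub>poly_ring R\<^esub> g))"

definition residue_class :: "('a, 'b) ring_scheme \<Rightarrow> 'a list \<Rightarrow> 'a list \<Rightarrow> 'a list set" where
  "residue_class R g f = (PIdl\<^bsub>poly_ring R\<^esub> g) +>\<^bsub>poly_ring R\<^esub> f"

definition complex_units :: "complex monoid" where
  "complex_units = \<lparr>carrier = UNIV - {0}, mult = (*), one = 1\<rparr>"

text \<open>The character \<open>\<eta>\<close> arises from the homomorphism \<open>\<psi>\<close> on the units modulo \<open>g\<close>.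
  Values of \<open>\<eta>\<close> outside the polynomial ring are irrelevant and unconstrained.\<close>

definition arises_from ::
  "('a, 'b) ring_scheme \<Rightarrow> 'a list \<Rightarrow> ('a list \<Rightarrow> complex) \<Rightarrow> ('a list set \<Rightarrow> complex) \<Rightarrow> bool" where
  "arises_from R g \<eta> \<psi> \<longleftrightarrow>
     \<psi> \<in> hom (residue_units R g) complex_units \<and>
     (\<forall>f\<in>carrier (poly_ring R).
        \<eta> f = (if coprime_poly R f g then \<psi> (residue_class R g f) else 0))"

definition dirichlet_character ::
  "('a, 'b) ring_scheme \<Rightarrow> 'a list \<Rightarrow> ('a list \<Rightarrow> complex) \<Rightarrow> bool" where
  "dirichlet_character R g \<eta> \<longleftrightarrow>
     g \<in> carrier (poly_ring R) \<and> g \<noteq> \<zero>\<^bsub>poly_ring R\<^esub> \<and> (\<exists>\<psi>. arises_from R g \<eta> \<psi>)"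

definition nontrivial_character ::
  "('a, 'b) ring_scheme \<Rightarrow> 'a list \<Rightarrow> ('a list \<Rightarrow> complex) \<Rightarrow> bool" where
  "nontrivial_character R g \<eta> \<longleftrightarrow>
     (\<exists>\<psi>. arises_from R g \<eta> \<psi> \<and> (\<exists>u\<in>carrier (residue_units R g). \<psi> u \<noteq> 1))"

text \<open>As usual, being definable modulo a divisor \<open>h\<close> of \<open>g\<close> means that the homomorphism on
  the units modulo \<open>g\<close> factors through the units modulo \<open>h\<close>, so \<open>\<eta>\<close> is compared with a
  character modulo \<open>h\<close> only at polynomials coprime to \<open>g\<close>.\<close>

definition definable_modulo ::
  "('a, 'b) ring_scheme \<Rightarrow> 'a list \<Rightarrow> ('a list \<Rightarrow> complex) \<Rightarrow> 'a list \<Rightarrow> bool" where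
  "definable_modulo R g \<eta> h \<longleftrightarrow>
     (\<exists>\<psi> \<in> hom (residue_units R h) complex_units.
        \<forall>f\<in>carrier (poly_ring R). coprime_poly R f g \<longrightarrow> \<eta> f = \<psi> (residue_class R h f))"

definition primitive_character ::
  "('a, 'b) ring_scheme \<Rightarrow> 'a list \<Rightarrow> ('a list \<Rightarrow> complex) \<Rightarrow> bool" where
  "primitive_character R g \<eta> \<longleftrightarrow>
     \<not> (\<exists>h\<in>carrier (poly_ring R). properfactor (poly_ring R) h g \<and> definable_modulo R g \<eta> h)"

definition monic_irreducibles :: "('a, 'b) ring_scheme \<Rightarrow> 'a list set" where
  "monic_irreducibles R =
     {\<pi> \<in> carrier (poly_ring R). pirreducible\<^bsub>R\<^esub> (carrier R) \<pi> \<and> hd \<pi> = \<one>\<^bsub>R\<^esub>}"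

definition poly_abs :: "('a, 'b) ring_scheme \<Rightarrow> 'a list \<Rightarrow> nat" where
  "poly_abs R f = order R ^ (length f - 1)"

text \<open>The infinite product over the monic irreducibles is unordered: the limit of the partial
  products along the directed set of finite subsets.\<close>

definition has_euler_product ::
  "('a, 'b) ring_scheme \<Rightarrow> ('a list \<Rightarrow> complex) \<Rightarrow> complex \<Rightarrow> complex \<Rightarrow> bool" where
  "has_euler_product R \<eta> s l \<longleftrightarrow>
     ((\<lambda>F. \<Prod>\<pi>\<in>F. inverse (1 - \<eta> \<pi> * of_nat (poly_abs R \<pi>) powr (- s))) \<longlongrightarrow> l)
       (finite_subsets_at_top (monic_irreducibles R))"

text \<open>\<open>L(s, \<eta>)\<close> is the value at \<open>q\<^sup>-\<^sup>s\<close> of the polynomial that represents the Euler product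
  when the real part of \<open>s\<close> is large. The polynomial is unique by \<open>L_polynomial_unique\<close> below;
  it exists for non-trivial primitive characters, and only for these is \<open>L_function\<close> used.\<close>

definition is_L_polynomial ::
  "('a, 'b) ring_scheme \<Rightarrow> ('a list \<Rightarrow> complex) \<Rightarrow> complex poly \<Rightarrow> bool" where
  "is_L_polynomial R \<eta> P \<longleftrightarrow>
     (\<exists>\<sigma>::real. \<forall>s. Re s > \<sigma> \<longrightarrow> has_euler_product R \<eta> s (poly P (of_nat (order R) powr (- s))))"

definition L_function ::
  "('a, 'b) ring_scheme \<Rightarrow> ('a list \<Rightarrow> complex) \<Rightarrow> complex \<Rightarrow> complex" where
  "L_function R \<eta> s = poly (THE P. is_L_polynomial R \<eta> P) (of_nat (order R) powr (- s))"

lemma L_polynomial_unique: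
  assumes q: "order R > 1" and P: "is_L_polynomial R \<eta> P" and Q: "is_L_polynomial R \<eta> Q"
  shows "P = Q"
proof (rule ccontr)
  assume "P \<noteq> Q"
  then have fin: "finite {x. poly (P - Q) x = 0}"
    by (intro poly_roots_finite) simp
  obtain a where a: "\<And>s. Re s > a \<Longrightarrow> has_euler_product R \<eta> s (poly P (of_nat (order R) powr (- s)))"
    using P unfolding is_L_polynomial_def by blast
  obtain b where b: "\<And>s. Re s > b \<Longrightarrow> has_euler_product R \<eta> s (poly Q (of_nat (order R) powr (- s)))"
    using Q unfolding is_L_polynomial_def by blast
  define h where "h t = (of_nat (order R) powr (- complex_of_real t))" for t
  have h: "h t = complex_of_real (real (order R) powr (- t))" for t
    using q powr_of_real[of "real (order R)" "- t"] by (simp add: h_def)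
  have "h ` {max a b <..} \<subseteq> {x. poly (P - Q) x = 0}"
  proof clarsimp
    fix t assume "a < t" "b < t"
    then have "has_euler_product R \<eta> t (poly P (h t))" "has_euler_product R \<eta> t (poly Q (h t))"
      using a[of t] b[of t] by (auto simp: h_def)
    then show "poly P (h t) = poly Q (h t)"
      unfolding has_euler_product_def
      by (rule tendsto_unique[rotated]) simp
  qed
  moreover have "inj_on h {max a b <..}"
    using q by (auto simp: inj_on_def h powr_inj)
  ultimately show False
    using fin finite_subset finite_imageD infinite_Ioi by blast
qed

end

theory Submission
  imports
    Defs
    "HOL-Number_Theory.Number_Theory"
    "HOL-Real_Asymp.Real_Asymp"
    "Jordan_Normal_Form.Schur_Decomposition"
begin

text \<open>
  Fix a prime \<open>p \<equiv> 2, 5 (mod 9)\<close>, so that \<open>p\<close> is a primitive root modulo every power of \<open>3\<close>, and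
  put \<open>D = 3\<^sup>a < p\<close>. Writing \<open>y\<^sub>D(f)\<close> for the \<open>D\<close>-th power sum of the reciprocal roots of \<open>f\<close>, which
  depends only on \<open>f\<close> modulo \<open>X\<^bsup>D+1\<^esup>\<close>, consider the primitive character \<open>f \<mapsto> e(y\<^sub>D(f) / p)\<close> modulo
  \<open>X\<^bsup>D+1\<^esup>\<close>. Its \<open>L\<close>-function is \<open>1 - u\<close> times a polynomial \<open>P\<^sub>a(u)\<close> of degree \<open>D - 1\<close> with a functional
  equation. On polynomials of degree \<open>k\<close> every common multiple \<open>E\<close> of the numbers \<open>p\<^sup>d - 1\<close>, \<open>d \<le> k\<close>, is
  a period of the power sums in the exponent, and for \<open>k < 2 \<cdot> 3\<^bsup>a-1\<^esup>\<close> none of these numbers is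
  divisible by \<open>3\<^sup>a\<close>, so that \<open>E\<close> may be taken to be exactly divisible by \<open>D / 3\<close>; hence \<open>D\<close> and \<open>D / 3\<close> differ modulo \<open>E\<close> by a unit \<open>t\<close>, and raising
  the roots to the power \<open>t\<close> shows that the first two thirds of the coefficients of \<open>P\<^sub>a\<close> are those of
  \<open>P\<^bsub>a-1\<^esub>\<close>. The functional equation gives the rest:
  \<open>P\<^sub>a(u) = (1 + (p u\<^sup>2)\<^bsup>D/3\<^esup>) P\<^bsub>a-1\<^esub>(u)\<close>. Translating the roots by \<open>s\<close> replaces \<open>P\<^sub>a(u)\<close> by \<open>P\<^sub>a(z u)\<close>, where
  \<open>z = e(- s\<^sup>D / p)\<close> is an arbitrary \<open>p\<close>-th root of unity, because cubing is bijective modulo \<open>p\<close>.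
  The central values are therefore \<open>1 - p\<^bsup>-1/2\<^esup>\<close> times the products of \<open>1 + z ^ (2 \<cdot> 3\<^sup>i)\<close> over \<open>i < a\<close>; as
  \<open>p\<close> grows these approximate all values of the products of \<open>1 + cis (3\<^sup>j \<theta>)\<close> over \<open>j < a\<close>, which are dense in
  the plane. That there are infinitely many such \<open>p\<close> follows from the \<open>L\<close>-series of the characters
  modulo \<open>9\<close> near \<open>1\<close>.
\<close>

section \<open>Density of the trinomial products\<close>

text \<open>The ratio 3 is what closes the recursion. The functional equation pairs the indices k
  and D - 1 - k, so the first two thirds of the coefficients determine the last third, and the
  partner of an index in the last third lies below D / 3, where the previous level and its own
  functional equation take over. That p is a primitive root modulo 3^a is what keeps 3^a out of p^d
  - 1 in exactly the range of degrees needed for those two thirds. The coefficients of P_a are sums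
  over polynomials with constant coefficient 1 and degree at most k. Sums over degree exactly k are
  differences of two consecutive ones, whence the factor 1 - u. Transforming roots would naturally
  call for a splitting field over the prime field. Instead the coefficients are lifted to integers,
  the roots are taken in the complex numbers, and the transformed integer polynomial is reduced
  modulo p again. That this permutes the polynomials modulo p is checked on power sums, which
  determine the coefficients as long as the degree is below p; this is one reason for D < p.\<close>

definition trinomial_product :: "nat \<Rightarrow> real \<Rightarrow> complex" where
  "trinomial_product a \<theta> = (\<Prod>i<a. 1 + cis (3 ^ i * \<theta>))"

lemma one_plus_cis: "1 + cis x = complex_of_real (2 * cos (x / 2)) * cis (x / 2)"
proof -
  have "1 + cos x = 2 * cos (x/2) * cos (x/2)" "sin x = 2 * cos (x/2) * sin (x/2)"
    using cos_double_cos[of "x/2"] sin_double[of "x/2"] by (simp_all add: power2_eq_square)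
  then show ?thesis by (simp add: complex_eq_iff)
qed

text \<open>The phases of the half-angle forms add up geometrically, and the modulus, with a sign,
  is left to the cosines. Argument and modulus can then be adjusted almost independently.\<close>

lemma trinomial_product_polar:
  "trinomial_product a \<theta> =
     complex_of_real (\<Prod>i<a. 2 * cos (3 ^ i * \<theta> / 2)) * cis (\<theta> * (3 ^ a - 1) / 4)"
proof (induction a)
  case (Suc a)
  have "cis (\<theta> * (3 ^ a - 1) / 4) * cis (3 ^ a * \<theta> / 2) = cis (\<theta> * (3 ^ Suc a - 1) / 4)"
    unfolding cis_mult by (rule arg_cong[of _ _ cis]) (simp add: field_simps)
  note cis_eq = this
  have "trinomial_product (Suc a) \<theta> = trinomial_product a \<theta> * (1 + cis (3 ^ a * \<theta>))"
    by (simp add: trinomial_product_def)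
  also have "\<dots> = complex_of_real ((\<Prod>i<a. 2 * cos (3 ^ i * \<theta> / 2)) * (2 * cos (3 ^ a * \<theta> / 2))) *
      (cis (\<theta> * (3 ^ a - 1) / 4) * cis (3 ^ a * \<theta> / 2))"
    unfolding Suc one_plus_cis of_real_mult by (simp only: mult_ac)
  finally show ?case unfolding cis_eq prod.lessThan_Suc .
qed (simp add: trinomial_product_def)

lemma cos_2pi_int_add: "cos (2 * pi * of_int n + x) = cos x"
  by (simp add: cos_add sin_int_2pin cos_int_2pin)

lemma cis_dist_le: "cmod (cis (x + y) - cis x) \<le> \<bar>y\<bar>"
proof -
  have "cis (x + y) - cis x = cis x * (cis y - 1)" by (simp add: cis_mult[symmetric] algebra_simps)
  moreover have "cmod (cis y - 1) \<le> \<bar>y\<bar>"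
  proof -
    have "cis y - 1 = - (1 + cis (y + pi))" by (simp add: cis_mult[symmetric])
    also have "cmod \<dots> = 2 * \<bar>cos (y / 2 + pi / 2)\<bar>"
      by (simp only: norm_minus_cancel one_plus_cis norm_mult norm_of_real norm_cis abs_mult add_divide_distrib)
    also have "cos (y / 2 + pi / 2) = - sin (y / 2)" by (simp add: cos_add)
    finally show ?thesis using abs_sin_x_le_abs_x[of "y / 2"] by simp
  qed
  ultimately show ?thesis by (simp add: norm_mult)
qed

text \<open>The angle is built in scales. A leading part 8 * pi * k / 3 ^ b sets the argument; a
  long block of factors of size at least 1.4 makes the modulus large; the last factor is close to 0,
  and a tiny change \<open>\<delta>\<close> of the angle tunes it until the modulus is right, almost
  without moving the argument.\<close>

lemma trinomial_product_dense:
  assumes "\<epsilon> > 0"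
  shows "\<exists>a \<theta>. cmod (trinomial_product a \<theta> - v) < \<epsilon>"
proof -
  define \<rho> \<phi> where "\<rho> = cmod v" and "\<phi> = Arg v"
  have v: "v = of_real \<rho> * cis \<phi>"
    by (simp add: \<rho>_def \<phi>_def rcis_cmod_Arg[of v, unfolded rcis_def])
  have \<rho>: "\<rho> \<ge> 0" by (simp add: \<rho>_def)
  define e where "e = min 1 (\<epsilon> / (16 * (\<rho> + 1)))"
  have e: "e > 0" "e \<le> 1" "e \<le> \<epsilon> / (16 * (\<rho> + 1))" using assms \<rho> by (auto simp: e_def)
  have "(\<lambda>n. (1/3::real) ^ n) \<longlonglongrightarrow> 0" by (rule LIMSEQ_realpow_zero) auto
  then have ev3: "eventually (\<lambda>n. (1/3::real) ^ n < r) sequentially" if "r > 0" for r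
    using that by (rule order_tendstoD)
  obtain b where b: "(1/3::real) ^ b < e / 8"
    using ev3[of "e / 8"] e eventually_sequentially by auto
  \<comment> \<open>Up to small terms the final argument will be 3 * pi / 4 - 2 * pi * k / 3 ^ b, so
    \<open>\<psi>\<close> is the rounding error in approximating \<open>\<phi>\<close>.\<close>
  define k where "k = \<lfloor>(3 * pi / 4 - \<phi>) * 3 ^ b / (2 * pi)\<rfloor>"
  define \<psi> where "\<psi> = 3 * pi / 4 - \<phi> - 2 * pi * k / 3 ^ b"
  have \<psi>: "0 \<le> \<psi>" "\<psi> \<le> e"
  proof -
    have 1: "k \<le> (3 * pi / 4 - \<phi>) * 3 ^ b / (2 * pi)" "(3 * pi / 4 - \<phi>) * 3 ^ b / (2 * pi) \<le> k + 1"
      unfolding k_def by linarith+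
    have "2 * pi * k \<le> (3 * pi / 4 - \<phi>) * 3 ^ b" "(3 * pi / 4 - \<phi>) * 3 ^ b \<le> 2 * pi * (k + 1)"
      using 1 by (simp_all add: field_simps)
    then have "2 * pi * k / 3 ^ b \<le> (3 * pi / 4 - \<phi>)" "(3 * pi / 4 - \<phi>) \<le> 2 * pi * (k + 1) / 3 ^ b"
      by (simp_all add: field_simps)
    moreover have "2 * pi * (k + 1) / 3 ^ b = 2 * pi * k / 3 ^ b + 2 * pi * (1/3) ^ b"
      by (simp add: field_simps)
    moreover have "2 * pi * (1/3) ^ b \<le> 8 * (1/3::real) ^ b"
      using pi_less_4 by (intro mult_right_mono) auto
    ultimately show "0 \<le> \<psi>" "\<psi> \<le> e" using b unfolding \<psi>_def by linarith+
  qed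
  define P where "P \<eta> = (\<Prod>i<b. \<bar>2 * cos (3 ^ i * (8 * pi * k / 3 ^ b + \<eta>) / 2)\<bar>)" for \<eta> :: real
  have "P 0 > 0"
    unfolding P_def
  proof (rule prod_pos)
    fix i assume "i \<in> {..<b}"
    \<comment> \<open>A zero would equate the even number 8 * k * 3 ^ i with an odd multiple of 3 ^
      b.\<close>
    have "cos (3 ^ i * (8 * pi * k / 3 ^ b + 0) / 2) \<noteq> 0"
    proof
      assume "cos (3 ^ i * (8 * pi * k / 3 ^ b + 0) / 2) = 0"
      then obtain n where n: "odd n" "3 ^ i * (8 * pi * k / 3 ^ b + 0) / 2 = of_int n * (pi / 2)"
        by (auto simp: cos_zero_iff_int)
      then have "real_of_int (8 * k * 3 ^ i) = real_of_int (n * 3 ^ b)" by (simp add: field_simps)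
      then have "8 * k * 3 ^ i = n * 3 ^ b" by linarith
      then have "even (n * 3 ^ b)" by (metis dvd_mult2 even_numeral mult.commute dvd_triv_left even_mult_iff)
      with n show False by simp
    qed
    then show "0 < \<bar>2 * cos (3 ^ i * (8 * pi * k / 3 ^ b + 0) / 2)\<bar>" by simp
  qed
  moreover have "isCont P 0" unfolding P_def by (intro continuous_intros) auto
  ultimately have "eventually (\<lambda>\<eta>. P \<eta> > P 0 / 2) (at 0)"
    by (intro order_tendstoD) (auto simp: isCont_def)
  then obtain \<eta>0 where \<eta>0: "\<eta>0 > 0" "\<And>\<eta>. \<bar>\<eta>\<bar> < \<eta>0 \<Longrightarrow> P \<eta> > P 0 / 2"
    using \<open>P 0 > 0\<close> unfolding eventually_at by (metis diff_0_right dist_real_def UNIV_I half_gt_zero_iff field_sum_of_halves less_add_same_cancel1)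
  \<comment> \<open>The size of the last factor at the end points e and -e; \<open>J\<close> is
    chosen so large that even after this shrinking the modulus is at least
    \<open>\<rho>\<close>.\<close>
  define s where "s = 2 * sin (e / 2)"
  have s: "s > 0" unfolding s_def using e pi_gt3 by (simp add: sin_gt_zero)
  define c where "c = P 0 / 2 * s"
  have c: "c > 0" using s \<open>P 0 > 0\<close> by (simp add: c_def)
  obtain N where N: "\<rho> / c < (1.4::real) ^ N" using real_arch_pow[of "1.4" "\<rho> / c"] by auto
  have "(1.4::real) ^ J \<ge> \<rho> / c" if "J \<ge> N" for J
    using N power_increasing[OF that, of "1.4::real"] by linarith
  then have "eventually (\<lambda>J. (1.4::real) ^ J \<ge> \<rho> / c) sequentially" unfolding eventually_sequentially by blast
  moreover have "eventually (\<lambda>J. (1/3::real) ^ J < \<eta>0 / 8) sequentially"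
    "eventually (\<lambda>J. (1/3::real) ^ J < e / 8) sequentially"
    using ev3[of "\<eta>0/8"] ev3[of "e/8"] \<eta>0(1) e by simp_all
  ultimately have "eventually (\<lambda>J. (1.4::real) ^ J \<ge> \<rho> / c \<and> (1/3::real) ^ J < \<eta>0 / 8 \<and> (1/3::real) ^ J < e / 8) sequentially"
    by eventually_elim auto
  then obtain J where J: "(1.4::real) ^ J \<ge> \<rho> / c" "(1/3::real) ^ J < \<eta>0 / 8" "(1/3::real) ^ J < e / 8"
    by (auto simp: eventually_sequentially)
  have "(1/3::real) ^ (b + J) \<le> (1/3::real) ^ J" by (intro power_decreasing) auto
  then have J': "(1/3::real) ^ (b + J) < \<eta>0 / 8" "(1/3::real) ^ (b + J) < e / 8" using J by linarith+
  \<comment> \<open>The leading part adds multiples of 2 * pi to the half-angles of index at least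
    \<open>b\<close> and a multiple of 2 * pi / 3 ^ b to the total argument. The tail makes the
    half-angle of index b + J equal to pi / 2 + \<delta> / 2 modulo 2 * pi.\<close>
  define \<theta> where "\<theta> \<delta> = 8 * pi * k / 3 ^ b + (pi + \<delta>) / 3 ^ (b + J)" for \<delta> :: real
  define G where "G \<delta> = (\<Prod>i<b + J. 2 * cos (3 ^ i * \<theta> \<delta> / 2))" for \<delta>
  have G: "\<bar>G \<delta>\<bar> > P 0 / 2 * 1.4 ^ J" if \<delta>: "\<bar>\<delta>\<bar> \<le> 1" for \<delta>
  proof -
    have "\<bar>G \<delta>\<bar> = (\<Prod>i<b. \<bar>2 * cos (3 ^ i * \<theta> \<delta> / 2)\<bar>) * (\<Prod>i=b..<b+J. \<bar>2 * cos (3 ^ i * \<theta> \<delta> / 2)\<bar>)"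
      unfolding G_def abs_prod by (simp add: prod.atLeastLessThan_concat[symmetric] lessThan_atLeast0)
    also have "(\<Prod>i<b. \<bar>2 * cos (3 ^ i * \<theta> \<delta> / 2)\<bar>) = P ((pi + \<delta>) / 3 ^ (b + J))"
      unfolding P_def \<theta>_def ..
    finally have abs_eq: "\<bar>G \<delta>\<bar> = P ((pi + \<delta>) / 3 ^ (b + J)) * (\<Prod>i=b..<b+J. \<bar>2 * cos (3 ^ i * \<theta> \<delta> / 2)\<bar>)" .
    \<comment> \<open>Counted from the end, these half-angles are (pi + \<delta>) / (2 * 3 ^ j) with
      j \<ge> 1, hence at most pi / 4, and each factor is at least sqrt 2.\<close>
    have "(\<Prod>i=b..<b+J. \<bar>2 * cos (3 ^ i * \<theta> \<delta> / 2)\<bar>) \<ge> (\<Prod>i=b..<b+J. 1.4)"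
    proof (rule prod_mono, safe)
      fix i assume i: "i \<in> {b..<b+J}"
      define j where "j = b + J - i"
      have j: "j \<ge> 1" "b + J = i + j" using i by (auto simp: j_def)
      have "3 ^ i * \<theta> \<delta> / 2 = 2 * pi * of_int (2 * k * 3 ^ (i - b)) + (pi + \<delta>) / (2 * 3 ^ j)"
      proof -
        have "(3::real) ^ i = 3 ^ (i - b) * 3 ^ b" using i by (simp flip: power_add)
        then show ?thesis unfolding \<theta>_def j(2) by (simp add: field_simps power_add)
      qed
      then have "cos (3 ^ i * \<theta> \<delta> / 2) = cos ((pi + \<delta>) / (2 * 3 ^ j))"
        by (simp only: cos_2pi_int_add)
      moreover have "cos ((pi + \<delta>) / (2 * 3 ^ j)) \<ge> cos (pi / 4)"
      proof (rule cos_monotone_0_pi_le)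
        have "(3::real) ^ 1 \<le> 3 ^ j" using j by (intro power_increasing) auto
        then have "(pi + \<delta>) / (2 * 3 ^ j) \<le> (pi + \<delta>) / (2 * 3)"
          using \<delta> pi_gt3 by (intro divide_left_mono) auto
        also have "\<dots> \<le> pi / 4" using \<delta> pi_gt3 by (simp add: abs_le_iff)
        finally show "(pi + \<delta>) / (2 * 3 ^ j) \<le> pi / 4" .
      qed (use \<delta> pi_gt3 in auto)
      moreover have "cos (pi / 4) \<ge> 0.7"
        using real_le_rsqrt[of "1.4" 2] by (simp add: cos_45 power2_eq_square)
      ultimately show "1.4 \<le> \<bar>2 * cos (3 ^ i * \<theta> \<delta> / 2)\<bar>" by linarith
    qed auto
    then have "(\<Prod>i=b..<b+J. \<bar>2 * cos (3 ^ i * \<theta> \<delta> / 2)\<bar>) \<ge> 1.4 ^ J" by simp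
    moreover have "P ((pi + \<delta>) / 3 ^ (b + J)) > P 0 / 2"
    proof (rule \<eta>0)
      have "\<bar>(pi + \<delta>) / 3 ^ (b + J)\<bar> = \<bar>pi + \<delta>\<bar> * (1/3) ^ (b + J)" by (simp add: field_simps abs_divide)
      also have "\<dots> \<le> 8 * (1/3) ^ (b + J)" using \<delta> pi_less_4 pi_gt3 by (intro mult_right_mono) auto
      also have "\<dots> < \<eta>0" using J' by simp
      finally show "\<bar>(pi + \<delta>) / 3 ^ (b + J)\<bar> < \<eta>0" .
    qed
    ultimately have "P ((pi + \<delta>) / 3 ^ (b + J)) * (\<Prod>i=b..<b+J. \<bar>2 * cos (3 ^ i * \<theta> \<delta> / 2)\<bar>) > P 0 / 2 * 1.4 ^ J"
      using \<open>P 0 > 0\<close> by (intro mult_less_le_imp_less) auto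
    then show ?thesis using abs_eq by simp
  qed
  define R where "R \<delta> = (\<Prod>i<Suc (b + J). 2 * cos (3 ^ i * \<theta> \<delta> / 2))" for \<delta>
  have R: "R \<delta> = - (2 * sin (\<delta> / 2)) * G \<delta>" for \<delta>
  proof -
    have "3 ^ (b + J) * \<theta> \<delta> / 2 = 2 * pi * of_int (2 * k * 3 ^ J) + (pi / 2 + \<delta> / 2)"
      unfolding \<theta>_def by (simp add: field_simps power_add)
    then have "cos (3 ^ (b + J) * \<theta> \<delta> / 2) = cos (pi / 2 + \<delta> / 2)"
      by (simp only: cos_2pi_int_add)
    also have "\<dots> = - sin (\<delta> / 2)" by (simp add: cos_add)
    finally show ?thesis unfolding R_def G_def by simp
  qed
  have cont_G: "continuous_on A G" for A
    unfolding G_def \<theta>_def by (intro continuous_intros) auto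
  have cont_R: "continuous_on A R" for A
    unfolding R_def \<theta>_def by (intro continuous_intros) auto
  have pos: "P 0 / 2 * 1.4 ^ J > 0" using \<open>P 0 > 0\<close> by simp
  have big: "s * \<bar>G \<delta>\<bar> \<ge> \<rho>" if "\<bar>\<delta>\<bar> \<le> 1" for \<delta>
  proof -
    have "\<rho> \<le> c * 1.4 ^ J" using J c by (simp add: field_simps)
    also have "\<dots> = s * (P 0 / 2 * 1.4 ^ J)" by (simp add: c_def)
    also have "\<dots> \<le> s * \<bar>G \<delta>\<bar>" using s G[OF that] by (intro mult_left_mono) auto
    finally show ?thesis .
  qed
  \<comment> \<open>\<open>G\<close> has no zero on [-1, 1] and so keeps its sign, while the last
    factor changes sign at 0: \<open>R\<close> is nonpositive at one end and at least
    \<open>\<rho>\<close> at the other. Hitting the signed value \<open>\<rho>\<close> avoids an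
    extra half turn in the argument.\<close>
  have "\<exists>\<delta>. -e \<le> \<delta> \<and> \<delta> \<le> e \<and> R \<delta> = \<rho>"
  proof (cases "G e > 0")
    case True
    have "G (-e) > 0"
    proof (rule ccontr)
      assume "\<not> G (-e) > 0"
      then have "\<exists>x. -e \<le> x \<and> x \<le> e \<and> G x = 0"
        using True e by (intro IVT' cont_G) auto
      then obtain x where "-e \<le> x" "x \<le> e" "G x = 0" by blast
      then show False using G[of x] pos e by (auto simp: abs_le_iff)
    qed
    then have "R (-e) \<ge> \<rho>" "R e \<le> 0" using big[of "-e"] e s True unfolding R s_def by auto
    then show ?thesis using \<rho> e by (intro IVT2' cont_R) auto
  next
    case False
    have "G (-e) < 0"
    proof (rule ccontr)
      assume "\<not> G (-e) < 0"
      then have "\<exists>x. -e \<le> x \<and> x \<le> e \<and> G x = 0"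
        using False e by (intro IVT2' cont_G) auto
      then obtain x where "-e \<le> x" "x \<le> e" "G x = 0" by blast
      then show False using G[of x] pos e by (auto simp: abs_le_iff)
    qed
    moreover have "G e < 0" using False G[of e] pos e by auto
    ultimately have "R e \<ge> \<rho>" "R (-e) \<le> 0" using big[of "e"] e s unfolding R s_def
      by (auto simp: mult_le_0_iff)
    then show ?thesis using \<rho> e by (intro IVT' cont_R) auto
  qed
  then obtain \<delta> where "-e \<le> \<delta>" "\<delta> \<le> e" and R_eq: "R \<delta> = \<rho>" by blast
  then have \<delta>: "\<bar>\<delta>\<bar> \<le> e" by (simp add: abs_le_iff)
  define E where "E = \<psi> + 3 / 4 * \<delta> - (pi + \<delta>) / 4 * (1/3) ^ (b + J)"
  have "\<theta> \<delta> * (3 ^ Suc (b + J) - 1) / 4 = 2 * pi * of_int (3 * k * 3 ^ J) + (\<phi> + E)"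
    unfolding \<theta>_def E_def \<psi>_def by (simp add: field_simps power_add)
  then have cis: "cis (\<theta> \<delta> * (3 ^ Suc (b + J) - 1) / 4) = cis (\<phi> + E)"
    using cis_multiple_2pi[of "of_int (3 * k * 3 ^ J)"]
    by (simp only: cis_mult[symmetric, of "2 * pi * _"] Ints_of_int) simp
  have "\<bar>(pi + \<delta>) / 4 * (1/3) ^ (b + J)\<bar> \<le> 8 * (1/3) ^ (b + J)"
    unfolding abs_mult using pi_less_4 pi_gt3 \<delta> e by (intro mult_mono) auto
  then have "\<bar>E\<bar> \<le> 4 * e" using \<psi> \<delta> J'(2) unfolding E_def by linarith
  have "trinomial_product (Suc (b + J)) (\<theta> \<delta>) = of_real \<rho> * cis (\<phi> + E)"
    unfolding trinomial_product_polar R_def[symmetric] R_eq cis ..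
  then have "cmod (trinomial_product (Suc (b + J)) (\<theta> \<delta>) - v) = \<rho> * cmod (cis (\<phi> + E) - cis \<phi>)"
    unfolding v using \<rho> by (simp flip: norm_mult right_diff_distrib add: norm_mult)
  also have "\<dots> \<le> \<rho> * (4 * e)" using cis_dist_le[of \<phi> E] \<open>\<bar>E\<bar> \<le> 4 * e\<close> \<rho> by (intro mult_left_mono) auto
  also have "\<dots> \<le> (\<rho> + 1) * (4 * e)" using e by simp
  also have "\<dots> < \<epsilon>" using e assms \<rho> by (simp add: field_simps)
  finally show ?thesis by blast
qed

section \<open>Primes generating the units modulo 9\<close>

text \<open>The discrete logarithm to base 2, a generator of the units modulo 9. The generators are
  the residues 2 and 5, with logarithms 1 and 5.\<close>

definition dlog9 :: "nat \<Rightarrow> nat" where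
  "dlog9 n = (let r = n mod 9 in
     if r = 2 then 1 else if r = 4 then 2 else if r = 8 then 3 else if r = 7 then 4 else if r = 5 then 5 else 0)"

definition char9 :: "nat \<Rightarrow> nat \<Rightarrow> complex" where
  "char9 j n = (if 3 dvd n then 0 else cis (pi / 3) ^ (j * dlog9 n))"

lemma cis_pi_third_power_6: "cis (pi / 3) ^ 6 = 1"
  by (subst Complex.DeMoivre) simp

lemma cis_pi_third_power_mod: "cis (pi / 3) ^ (j * m) = cis (pi / 3) ^ (j * n)" if "m mod 6 = n mod 6"
proof -
  have *: "cis (pi / 3) ^ (j * m) = cis (pi / 3) ^ (j * (m mod 6))" for m
  proof -
    have "j * m = 6 * (j * (m div 6)) + j * (m mod 6)"
      using mult_div_mod_eq[of 6 m] by (simp flip: distrib_left add: mult.left_commute[of 6 j])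
    then have "cis (pi / 3) ^ (j * m) = (cis (pi / 3) ^ 6) ^ (j * (m div 6)) * cis (pi / 3) ^ (j * (m mod 6))"
      by (simp only: power_add power_mult)
    then show ?thesis by (simp add: cis_pi_third_power_6)
  qed
  show ?thesis using *[of m] *[of n] that by simp
qed

lemma mod_9_cases: "n mod 9 \<in> {0, 1, 2, 3, 4, 5, 6, 7, 8 :: nat}"
proof -
  have "n mod 9 < 9" by simp
  then show ?thesis by auto
qed

lemma three_dvd_iff_mod_9: "3 dvd n \<longleftrightarrow> n mod 9 \<in> {0, 3, 6 :: nat}"
proof -
  define r where "r = n mod 9"
  have "n mod 3 = r mod 3" by (simp add: r_def mod_mod_cancel)
  moreover have "r \<in> {0, 1, 2, 3, 4, 5, 6, 7, 8}" unfolding r_def by (rule mod_9_cases)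
  ultimately show ?thesis unfolding dvd_eq_mod_eq_0 r_def[symmetric] by auto
qed

lemma mod_3_eq_1_iff_mod_9: "n mod 3 = 1 \<longleftrightarrow> n mod 9 \<in> {1, 4, 7 :: nat}"
proof -
  define r where "r = n mod 9"
  have "n mod 3 = r mod 3" by (simp add: r_def mod_mod_cancel)
  moreover have "r \<in> {0, 1, 2, 3, 4, 5, 6, 7, 8}" unfolding r_def by (rule mod_9_cases)
  ultimately show ?thesis unfolding r_def[symmetric] by auto
qed

lemma dlog9_mult:
  assumes "\<not> 3 dvd m" "\<not> 3 dvd n"
  shows "dlog9 (m * n) mod 6 = (dlog9 m + dlog9 n) mod 6"
proof -
  have *: "dlog9 n = dlog9 (n mod 9)" for n by (simp add: dlog9_def)
  have "\<forall>a\<in>{1,2,4,5,7,8}. \<forall>b\<in>{1,2,4,5,7,8}. dlog9 ((a * b) mod 9) mod 6 = (dlog9 a + dlog9 b) mod 6"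
    by (simp add: dlog9_def)
  moreover have "m mod 9 \<in> {1, 2, 4, 5, 7, 8}" "n mod 9 \<in> {1, 2, 4, 5, 7, 8}"
    using mod_9_cases[of m] mod_9_cases[of n] assms three_dvd_iff_mod_9[of m] three_dvd_iff_mod_9[of n] by auto
  ultimately have "dlog9 ((m mod 9 * (n mod 9)) mod 9) mod 6 = (dlog9 (m mod 9) + dlog9 (n mod 9)) mod 6" by blast
  then show ?thesis using *[of m] *[of n] *[of "m * n"] by (simp add: mod_mult_eq)
qed

lemma char9_mult: "char9 j (m * n) = char9 j m * char9 j n"
proof (cases "3 dvd m \<or> 3 dvd n")
  case False
  moreover have "prime (3::nat)" by simp
  ultimately have "\<not> 3 dvd m * n" by (simp add: prime_dvd_mult_iff)
  then show ?thesis using False cis_pi_third_power_mod[OF dlog9_mult[of m n], of j]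
    by (auto simp: char9_def power_add[symmetric] distrib_left)
qed (auto simp: char9_def)

lemma norm_char9_le: "cmod (char9 j n) \<le> 1"
  by (simp add: char9_def norm_power)

lemma char9_mod: "char9 j (9 * k + r) = char9 j r"
  unfolding char9_def dlog9_def three_dvd_iff_mod_9 by simp

text \<open>One step of a sieve: the multiples of \<open>q\<close> in \<open>N\<close> are exactly
  \<open>q\<close> times \<open>N\<close>, so by multiplicativity they contribute \<open>t q\<close>
  times the whole sum.\<close>

lemma infsum_coprime_prime:
  fixes t :: "nat \<Rightarrow> complex"
  assumes mult: "\<And>m n. t (m * n) = t m * t n" and sum: "t summable_on UNIV"
    and N: "\<And>n. q * n \<in> N \<longleftrightarrow> n \<in> N" and q: "q > 0"
  shows "infsum t {n\<in>N. \<not> q dvd n} = (1 - t q) * infsum t N"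
proof -
  have sm: "t summable_on M" for M by (rule summable_on_subset_banach[OF sum]) simp
  have "{n\<in>N. q dvd n} = (\<lambda>n. q * n) ` N" using N by (auto elim!: dvdE)
  moreover have "inj_on (\<lambda>n. q * n) N" using q by (auto simp: inj_on_def)
  ultimately have "infsum t {n\<in>N. q dvd n} = infsum (\<lambda>n. t q * t n) N"
    by (simp add: infsum_reindex o_def mult)
  also have "\<dots> = t q * infsum t N" by (rule infsum_cmult_right) (use sm in auto)
  finally have "infsum t {n\<in>N. q dvd n} = t q * infsum t N" .
  moreover have "infsum t ({n\<in>N. q dvd n} \<union> {n\<in>N. \<not> q dvd n}) = infsum t {n\<in>N. q dvd n} + infsum t {n\<in>N. \<not> q dvd n}"
    by (rule infsum_Un_disjoint) (auto intro: sm)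
  moreover have "{n\<in>N. q dvd n} \<union> {n\<in>N. \<not> q dvd n} = N" by auto
  ultimately show ?thesis by (simp add: algebra_simps)
qed

lemma infsum_coprime_primes:
  fixes t :: "nat \<Rightarrow> complex"
  assumes mult: "\<And>m n. t (m * n) = t m * t n" and sum: "t summable_on UNIV"
    and "finite T" "\<And>q. q \<in> T \<Longrightarrow> prime q"
  shows "infsum t {n. n > 0 \<and> (\<forall>q\<in>T. \<not> q dvd n)} = (\<Prod>q\<in>T. 1 - t q) * infsum t {n. n > 0}"
  using assms(3,4)
proof (induction T)
  case (insert q T)
  let ?N = "{n. n > 0 \<and> (\<forall>q\<in>T. \<not> q dvd n)}"
  have q: "prime q" using insert by auto
  have "infsum t {n\<in>?N. \<not> q dvd n} = (1 - t q) * infsum t ?N"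
  proof (rule infsum_coprime_prime[OF mult sum])
    show "q > 0" using q by (simp add: prime_gt_0_nat)
    fix n
    have "r dvd q * n \<longleftrightarrow> r dvd n" if "r \<in> T" for r
    proof -
      have "prime r" "r \<noteq> q" using insert that by auto
      then have "\<not> r dvd q" using q primes_dvd_imp_eq by blast
      then show ?thesis using \<open>prime r\<close> by (simp add: prime_dvd_mult_iff)
    qed
    then show "q * n \<in> ?N \<longleftrightarrow> n \<in> ?N" using \<open>q > 0\<close> by auto
  qed
  moreover have "{n\<in>?N. \<not> q dvd n} = {n. n > 0 \<and> (\<forall>r\<in>insert q T. \<not> r dvd n)}" by auto
  ultimately show ?case using insert by simp
qed simp

text \<open>No prime has both properties, so every \<open>n\<close> in \<open>N\<close> factors
  uniquely as an element of \<open>U\<close> times an element of \<open>V\<close>.\<close>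

lemma infsum_mult_split:
  fixes t :: "nat \<Rightarrow> complex" and P Q :: "nat \<Rightarrow> bool"
  assumes mult: "\<And>m n. t (m * n) = t m * t n" and sum: "t summable_on UNIV"
    and PQ: "\<And>q. \<not> (P q \<and> Q q)"
  defines "U \<equiv> {n. n > 0 \<and> (\<forall>q. prime q \<longrightarrow> q dvd n \<longrightarrow> P q)}"
    and "V \<equiv> {n. n > 0 \<and> (\<forall>q. prime q \<longrightarrow> q dvd n \<longrightarrow> Q q)}"
    and "N \<equiv> {n. n > 0 \<and> (\<forall>q. prime q \<longrightarrow> q dvd n \<longrightarrow> P q \<or> Q q)}"
  shows "infsum t N = infsum t U * infsum t V"
proof -
  have sm: "t summable_on M" for M by (rule summable_on_subset_banach[OF sum]) simp
  have cop: "coprime u v" if "u \<in> U" "v \<in> V" for u v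
  proof (rule ccontr)
    assume "\<not> coprime u v"
    then have "gcd u v \<noteq> 1" unfolding coprime_iff_gcd_eq_1 .
    then obtain q where q: "prime q" "q dvd gcd u v" using prime_factor_nat by blast
    then have "q dvd u" "q dvd v" by simp_all
    with that q(1) PQ[of q] show False unfolding U_def V_def by blast
  qed
  have inj: "inj_on (\<lambda>(u, v). u * v) (U \<times> V)"
  proof (rule inj_onI, clarify)
    fix u v u' v' assume h: "u \<in> U" "v \<in> V" "u' \<in> U" "v' \<in> V" "u * v = u' * v'"
    have "u dvd u' * v'" "u' dvd u * v" "v dvd u' * v'" "v' dvd u * v" 
      using dvd_triv_left[of u v] dvd_triv_right[of v u] dvd_triv_left[of u' v'] dvd_triv_right[of v' u'] h(5) by simp_all
    moreover have "coprime u v'" "coprime u' v" "coprime v u'" "coprime v' u"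
      using cop[OF h(1,4)] cop[OF h(3,2)] cop[OF h(3,2), THEN coprime_commute[THEN iffD1]]
        cop[OF h(1,4), THEN coprime_commute[THEN iffD1]] by blast+
    ultimately have "u dvd u'" "u' dvd u" "v dvd v'" "v' dvd v"
      by (simp_all add: coprime_dvd_mult_left_iff coprime_dvd_mult_right_iff)
    then show "u = u' \<and> v = v'" by (intro conjI dvd_antisym)
  qed
  have img: "(\<lambda>(u, v). u * v) ` (U \<times> V) = N"
  proof safe
    fix u v assume "u \<in> U" "v \<in> V"
    then show "u * v \<in> N" unfolding U_def V_def N_def by (auto simp: prime_dvd_mult_iff)
  next
    fix n assume "n \<in> N"
    then show "n \<in> (\<lambda>(u, v). u * v) ` (U \<times> V)"
    proof (induction n rule: less_induct)
      case (less n)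
      show ?case
      proof (cases "n = 1")
        case True
        have "1 \<in> U" "1 \<in> V" by (auto simp: U_def V_def)
        with True show ?thesis by (intro image_eqI[of _ _ "(1, 1)"]) simp_all
      next
        case False
        then obtain q where q: "prime q" "q dvd n" using prime_factor_nat by blast
        then obtain m where m: "n = q * m" by (auto elim: dvdE)
        have "m < n" "m \<in> N" using less(2) q m prime_gt_1_nat[OF q(1)] unfolding N_def by auto
        then obtain u v where uv: "u \<in> U" "v \<in> V" "m = u * v" using less.IH[of m] by (auto elim!: imageE)
        show ?thesis
        proof (cases "P q")
          case True
          then have "q * u \<in> U" using uv q prime_gt_0_nat[OF q(1)] unfolding U_def
            by (simp add: prime_dvd_mult_iff) (use primes_dvd_imp_eq in blast)
          with uv m show ?thesis by (intro image_eqI[of _ _ "(q * u, v)"]) simp_all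
        next
          case False
          then have "Q q" using less(2) q unfolding N_def by auto
          then have "q * v \<in> V" using uv q prime_gt_0_nat[OF q(1)] unfolding V_def
            by (simp add: prime_dvd_mult_iff) (use primes_dvd_imp_eq in blast)
          with uv m show ?thesis by (intro image_eqI[of _ _ "(u, q * v)"]) simp_all
        qed
      qed
    qed
  qed
  have eq: "(\<lambda>(u, v). t u * t v) = t \<circ> (\<lambda>(u, v). u * v)" by (auto simp: mult)
  have "infsum t N = infsum (\<lambda>(u, v). t u * t v) (U \<times> V)"
    unfolding eq img[symmetric] by (rule infsum_reindex[OF inj])
  also have "\<dots> = infsum (\<lambda>u. infsum (\<lambda>v. t u * t v) V) U"
  proof (rule infsum_Sigma'_banach[symmetric])
    show "(\<lambda>(u, v). t u * t v) summable_on U \<times> V"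
      unfolding eq using sm summable_on_reindex[OF inj, of t] img by simp
  qed
  also have "\<dots> = infsum (\<lambda>u. t u * infsum t V) U"
    by (intro infsum_cong infsum_cmult_right) (use sm in auto)
  also have "\<dots> = infsum t U * infsum t V" by (rule infsum_cmult_left) (use sm in auto)
  finally show ?thesis .
qed

definition dterm9 :: "nat \<Rightarrow> real \<Rightarrow> nat \<Rightarrow> complex" where
  "dterm9 j \<sigma> n = char9 j n * of_real (real n powr - \<sigma>)"

lemma dterm9_mult: "dterm9 j \<sigma> (m * n) = dterm9 j \<sigma> m * dterm9 j \<sigma> n"
  by (simp add: dterm9_def char9_mult powr_mult)

lemma dterm9_norm_le: "cmod (dterm9 j \<sigma> n) \<le> real n powr - \<sigma>"
  using mult_right_mono[OF norm_char9_le, of "real n powr - \<sigma>" j n] by (simp add: dterm9_def norm_mult)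

context
  fixes \<sigma> :: real
  assumes \<sigma>: "1 < \<sigma>" "\<sigma> \<le> 2"
begin

lemma dterm9_norm_summable: "summable (\<lambda>n. norm (dterm9 j \<sigma> n))"
  by (rule summable_comparison_test'[of "\<lambda>n. real n powr - \<sigma>" 0])
    (use \<sigma> dterm9_norm_le in \<open>auto simp: summable_real_powr_iff\<close>)

lemma dterm9_summable_on: "dterm9 j \<sigma> summable_on M"
  using norm_summable_imp_summable_on[OF dterm9_norm_summable] summable_on_subset_banach by blast

lemma infsum_dterm9: "infsum (dterm9 j \<sigma>) {n. n > 0} = (suminf (dterm9 j \<sigma>))"
proof -
  have "(dterm9 j \<sigma> has_sum (suminf (dterm9 j \<sigma>))) UNIV"
    by (rule norm_summable_imp_has_sum[OF dterm9_norm_summable])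
      (use dterm9_norm_summable summable_norm_cancel in blast)
  then have "infsum (dterm9 j \<sigma>) UNIV = (suminf (dterm9 j \<sigma>))" by (rule infsumI)
  moreover have "infsum (dterm9 j \<sigma>) {n. n > 0} = infsum (dterm9 j \<sigma>) UNIV"
    by (rule infsum_cong_neutral) (auto simp: dterm9_def)
  ultimately show ?thesis by simp
qed

lemma dterm9_block_sums:
  "(\<lambda>k. \<Sum>r\<in>{1,2,4,5,7,8}. char9 j r * of_real (real (9 * k + r) powr - \<sigma>)) sums (suminf (dterm9 j \<sigma>))"
proof -
  have "dterm9 j \<sigma> sums (suminf (dterm9 j \<sigma>))"
    using dterm9_norm_summable summable_norm_cancel summable_sums by blast
  then have "(\<lambda>k. sum (dterm9 j \<sigma>) {k * 9..<k * 9 + 9}) sums (suminf (dterm9 j \<sigma>))" by (rule sums_group) simp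
  moreover have "sum (dterm9 j \<sigma>) {k * 9..<k * 9 + 9} =
    (\<Sum>r\<in>{1,2,4,5,7,8}. char9 j r * of_real (real (9 * k + r) powr - \<sigma>))" for k
  proof -
    have "sum (dterm9 j \<sigma>) {k * 9..<k * 9 + 9} = (\<Sum>r<9. dterm9 j \<sigma> (9 * k + r))"
      using sum.shift_bounds_nat_ivl[of "dterm9 j \<sigma>" 0 "k * 9" 9] by (simp add: lessThan_atLeast0 add.commute mult.commute)
    also have "\<dots> = (\<Sum>r\<in>{1,2,4,5,7,8}. dterm9 j \<sigma> (9 * k + r))"
    proof (rule sum.mono_neutral_right)
      show "\<forall>r\<in>{..<9} - {1,2,4,5,7,8}. dterm9 j \<sigma> (9 * k + r) = 0"
      proof
        fix r :: nat assume "r \<in> {..<9} - {1,2,4,5,7,8}"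
        then have "r = 0 \<or> r = 3 \<or> r = 6" by auto
        then show "dterm9 j \<sigma> (9 * k + r) = 0" by (auto simp: dterm9_def char9_mod) (simp_all add: char9_def)
      qed
    qed auto
    also have "\<dots> = (\<Sum>r\<in>{1,2,4,5,7,8}. char9 j r * of_real (real (9 * k + r) powr - \<sigma>))"
      unfolding dterm9_def char9_mod ..
    finally show ?thesis .
  qed
  ultimately show ?thesis by simp
qed

text \<open>The coefficients of one period cancel, so the value at the start of the next block may
  be subtracted from all terms of a block; what is left is dominated by a telescoping series. The
  bound is the number of units modulo 9 and is uniform in \<open>\<sigma>\<close>.\<close>

lemma dterm9_series_bounded:
  assumes j: "(\<Sum>r\<in>{1,2,4,5,7,8}. char9 j r) = 0"
  shows "cmod (suminf (dterm9 j \<sigma>)) \<le> 6"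
proof -
  define d where "d k = real (9 * k + 1) powr - \<sigma>" for k
  have "(\<lambda>n. real (9 * n + 1) powr - \<sigma>) \<longlonglongrightarrow> 0" using \<sigma> by real_asymp
  then have "d \<longlonglongrightarrow> 0" by (simp add: d_def[abs_def])
  then have "(\<lambda>k. d k - d (Suc k)) sums (d 0 - 0)" by (rule telescope_sums')
  then have d: "(\<lambda>k. 6 * (d k - d (Suc k))) sums 6" using sums_mult[of _ _ 6] by (fastforce simp: d_def)
  have "norm (\<Sum>r\<in>{1,2,4,5,7,8}. char9 j r * of_real (real (9 * k + r) powr - \<sigma>)) \<le> 6 * (d k - d (Suc k))" for k
  proof -
    have "(\<Sum>r\<in>{1,2,4,5,7,8}. char9 j r * of_real (real (9 * k + r) powr - \<sigma>)) =
      (\<Sum>r\<in>{1,2,4,5,7,8}. char9 j r * of_real (real (9 * k + r) powr - \<sigma> - d (Suc k)))"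
      using j by (simp add: right_diff_distrib sum_subtractf flip: sum_distrib_right)
    also have "norm \<dots> \<le> (\<Sum>r\<in>{1,2,4,5,7,8::nat}. d k - d (Suc k))"
    proof (rule sum_norm_le)
      fix r :: nat assume r: "r \<in> {1,2,4,5,7,8}"
      have "real (9 * k + r) powr - \<sigma> \<le> d k" "real (9 * k + r) powr - \<sigma> \<ge> d (Suc k)"
        unfolding d_def using r \<sigma> by (auto intro!: powr_mono2')
      then have "\<bar>real (9 * k + r) powr - \<sigma> - d (Suc k)\<bar> \<le> d k - d (Suc k)" by simp
      then have "cmod (char9 j r) * \<bar>real (9 * k + r) powr - \<sigma> - d (Suc k)\<bar> \<le> 1 * (d k - d (Suc k))"
        by (intro mult_mono norm_char9_le) auto
      then show "norm (char9 j r * of_real (real (9 * k + r) powr - \<sigma> - d (Suc k))) \<le> d k - d (Suc k)"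
        by (simp only: norm_mult norm_of_real) simp
    qed
    also have "\<dots> = 6 * (d k - d (Suc k))" by simp
    finally show ?thesis .
  qed
  then have "norm (suminf (\<lambda>k. \<Sum>r\<in>{1,2,4,5,7,8}. char9 j r * of_real (real (9 * k + r) powr - \<sigma>))) \<le>
      suminf (\<lambda>k. 6 * (d k - d (Suc k)))"
    by (rule norm_suminf_le[OF _ sums_summable[OF d]])
  then show ?thesis unfolding sums_unique[OF d, symmetric] sums_unique[OF dterm9_block_sums[of j], symmetric] .
qed

text \<open>The imaginary part suffices: the residues 2 and 4 enter with positive sign, 5 and 7 with
  negative sign, 1 and 8 not at all. Each block of nine is therefore nonnegative, and the first
  block alone gives the bound. This positivity stands in for a nonvanishing theorem at 1.\<close>

lemma dterm9_series_lower: "cmod (suminf (dterm9 1 \<sigma>)) \<ge> 1 / 20"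
proof -
  define s where "s = sin (pi / 3)"
  have s: "s \<ge> 1 / 2" unfolding s_def sin_60 using real_le_rsqrt[of 1 3] by simp
  have sn: "sin (2 * pi / 3) = s" "sin (4 * pi / 3) = - s" "sin (5 * pi / 3) = - s"
  proof -
    have "sin (2 * pi / 3) = sin (pi - pi / 3)" "sin (4 * pi / 3) = sin (pi / 3 + pi)" "sin (5 * pi / 3) = sin (2 * pi - pi / 3)"
      by (rule arg_cong[of _ _ sin]; simp)+
    then show "sin (2 * pi / 3) = s" "sin (4 * pi / 3) = - s" "sin (5 * pi / 3) = - s"
      unfolding s_def by (simp_all only: sin_pi_minus sin_periodic_pi sin_2pi_minus)
  qed
  define g where "g k = s * (real (9 * k + 2) powr - \<sigma> + real (9 * k + 4) powr - \<sigma>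
      - real (9 * k + 5) powr - \<sigma> - real (9 * k + 7) powr - \<sigma>)" for k
  have "Im (\<Sum>r\<in>{1,2,4,5,7,8}. char9 1 r * of_real (real (9 * k + r) powr - \<sigma>)) = g k" for k
    using sn by (simp add: char9_def dlog9_def Complex.DeMoivre g_def algebra_simps s_def[symmetric] cos_60 del: sin_60 sin_120)
  then have g: "g sums Im (suminf (dterm9 1 \<sigma>))"
    using sums_Im[OF dterm9_block_sums[of 1]] by simp
  have g0: "g k \<ge> s * (real (9 * k + 2) powr - \<sigma> - real (9 * k + 5) powr - \<sigma>)" for k
    unfolding g_def using s \<sigma> by (intro mult_left_mono) (auto intro!: powr_mono2')
  have g1: "g k \<ge> 0" for k
    using s \<sigma> by (intro order.trans[OF _ g0[of k]] mult_nonneg_nonneg) (auto intro!: powr_mono2')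
  have "g 0 \<le> Im (suminf (dterm9 1 \<sigma>))"
    using sum_le_suminf[OF sums_summable[OF g], of "{0}"] g1 sums_unique[OF g] by simp
  moreover have "g 0 \<ge> 1 / 20"
  proof -
    have "2 powr - \<sigma> \<ge> 2 powr (- 2)" using \<sigma> by (intro powr_mono) auto
    then have 2: "2 powr - \<sigma> \<ge> 1 / 4" by (simp add: powr_minus)
    have "(5::real) powr - \<sigma> = 2 powr - \<sigma> * (5/2) powr - \<sigma>" by (simp flip: powr_mult)
    also have "\<dots> \<le> 2 powr - \<sigma> * (5/2) powr - 1" using \<sigma> by (intro mult_left_mono powr_mono) auto
    finally have "(5::real) powr - \<sigma> \<le> 2 powr - \<sigma> * (2 / 5)" by (simp add: powr_minus)
    then have "2 powr - \<sigma> - 5 powr - \<sigma> \<ge> 3 / 20" using 2 by linarith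
    then have "s * (2 powr - \<sigma> - 5 powr - \<sigma>) \<ge> 1 / 2 * (3 / 20)" using s by (intro mult_mono) auto
    then show ?thesis using g0[of 0] by simp
  qed
  ultimately show ?thesis using abs_Im_le_cmod[of "suminf (dterm9 1 \<sigma>)"] by linarith
qed

end

text \<open>Let \<open>\<chi>\<close> be the character of order \<open>6\<close> modulo \<open>9\<close>. If \<open>T\<close>, the set of these primes and \<open>3\<close>, were
  finite, every \<open>n\<close> prime to \<open>T\<close> would be a product \<open>u v\<close> with the primes in \<open>u\<close> congruent to \<open>1\<close> modulo \<open>3\<close>
  and those in \<open>v\<close> congruent to \<open>8\<close> modulo \<open>9\<close>. As \<open>1 = \<chi>\<^sup>3\<close>, \<open>\<chi> = \<chi>\<^sup>4\<close> at \<open>u\<close> and \<open>1 = \<chi>\<^sup>4\<close>, \<open>\<chi> = \<chi>\<^sup>3\<close>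
  at \<open>v\<close>, the Dirichlet series over these \<open>n\<close> satisfy \<open>F\<^sub>1 F\<^sub>\<chi> = F\<^sub>4 F\<^sub>3\<close>, where \<open>F\<^sub>1\<close> belongs to the trivial
  character and \<open>F\<^sub>j\<close> to \<open>\<chi>\<^sup>j\<close>. At \<open>1\<close> the right side is bounded, \<open>F\<^sub>1\<close> is not, and \<open>F\<^sub>\<chi>\<close> stays away from \<open>0\<close>.\<close>

lemma infinite_primes_generating_mod_9:
  "infinite {p :: nat. prime p \<and> (p mod 9 = 2 \<or> p mod 9 = 5)}"
proof
  assume fin: "finite {p :: nat. prime p \<and> (p mod 9 = 2 \<or> p mod 9 = 5)}"
  define T where "T = insert 3 {p :: nat. prime p \<and> (p mod 9 = 2 \<or> p mod 9 = 5)}"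
  have T: "finite T" "\<And>q. q \<in> T \<Longrightarrow> prime q" using fin by (auto simp: T_def)
  define m where "m = card T"
  let ?P = "\<lambda>q::nat. q mod 3 = 1" and ?Q = "\<lambda>q::nat. q mod 9 = 8"
  let ?U = "{n. n > 0 \<and> (\<forall>q. prime q \<longrightarrow> q dvd n \<longrightarrow> ?P q)}"
  let ?V = "{n. n > 0 \<and> (\<forall>q. prime q \<longrightarrow> q dvd n \<longrightarrow> ?Q q)}"
  let ?N = "{n. n > 0 \<and> (\<forall>q. prime q \<longrightarrow> q dvd n \<longrightarrow> ?P q \<or> ?Q q)}"
  have N: "?N = {n. n > 0 \<and> (\<forall>q\<in>T. \<not> q dvd n)}"
  proof -
    have "?P q \<or> ?Q q \<longleftrightarrow> q \<notin> T" if "prime q" for q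
    proof -
      have "3 dvd q \<longleftrightarrow> q = 3" using that primes_dvd_imp_eq[of 3 q] by auto
      then have "q = 3 \<or> q mod 9 \<in> {1, 2, 4, 5, 7, 8}"
        using mod_9_cases[of q] three_dvd_iff_mod_9[of q] by auto
      then show ?thesis unfolding T_def mod_3_eq_1_iff_mod_9 using that by auto
    qed
    then show ?thesis using T(2) by blast
  qed
  \<comment> \<open>The residues 1, 4, 7 have even logarithms, and the residues 1 and 8 obtained
    next for \<open>?V\<close> have logarithms divisible by 3; this is what makes powers of the
    character coincide there.\<close>
  have U: "n mod 3 = 1" if "n \<in> ?U" for n
    using that
  proof (induction n rule: prime_divisors_induct)
    case (factor q n)
    have "n \<in> ?U" "q mod 3 = 1" using factor by auto
    then have "n mod 3 = 1" using factor.IH by simp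
    then show ?case using \<open>q mod 3 = 1\<close> mod_mult_eq[of q 3 n] by simp
  qed auto
  have V: "n mod 9 = 1 \<or> n mod 9 = 8" if "n \<in> ?V" for n
    using that
  proof (induction n rule: prime_divisors_induct)
    case (factor q n)
    have "n \<in> ?V" "q mod 9 = 8" using factor by auto
    then have "n mod 9 = 1 \<or> n mod 9 = 8" using factor.IH by simp
    moreover have "(q * n) mod 9 = ((q mod 9) * (n mod 9)) mod 9" by (simp add: mod_simps)
    ultimately show ?case using \<open>q mod 9 = 8\<close> by auto
  qed auto
  have chU: "char9 0 n = char9 3 n" "char9 1 n = char9 4 n" if "n \<in> ?U" for n
  proof -
    have "n mod 9 \<in> {1, 4, 7}" using U[OF that] by (simp only: mod_3_eq_1_iff_mod_9)
    then have l: "dlog9 n \<in> {0, 2, 4}" by (auto simp: dlog9_def)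
    have "cis (pi / 3) ^ 12 = 1" using cis_pi_third_power_mod[of 12 0 1] by simp
    moreover have "cis (pi / 3) ^ 8 = cis (pi / 3) ^ 2" "cis (pi / 3) ^ 16 = cis (pi / 3) ^ 4"
      using cis_pi_third_power_mod[of 8 2 1] cis_pi_third_power_mod[of 16 4 1] by simp_all
    ultimately show "char9 0 n = char9 3 n" "char9 1 n = char9 4 n"
      using l cis_pi_third_power_6 by (auto simp: char9_def)
  qed
  have chV: "char9 0 n = char9 4 n" "char9 1 n = char9 3 n" if "n \<in> ?V" for n
  proof -
    have l: "dlog9 n \<in> {0, 3}" using V[OF that] by (auto simp: dlog9_def)
    have "cis (pi / 3) ^ 12 = 1" "cis (pi / 3) ^ 9 = cis (pi / 3) ^ 3"
      using cis_pi_third_power_mod[of 12 0 1] cis_pi_third_power_mod[of 9 3 1] by simp_all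
    then show "char9 0 n = char9 4 n" "char9 1 n = char9 3 n" using l by (auto simp: char9_def)
  qed
  \<comment> \<open>Here 720 = 6 * 6 * 20 comes from the two upper bounds and the lower bound 1 /
    20, and each of the four sieve factors \<open>W\<close> costs at most 2 ^ m.\<close>
  have bound: "cmod (suminf (dterm9 0 \<sigma>)) \<le> 720 * 2 ^ m * 2 ^ m * 2 ^ m * 2 ^ m" if \<sigma>: "1 < \<sigma>" "\<sigma> \<le> 2" for \<sigma>
  proof -
    define S A B C where "S j = (suminf (dterm9 j \<sigma>))" and "A j = infsum (dterm9 j \<sigma>) ?N"
      and "B j = infsum (dterm9 j \<sigma>) ?U" and "C j = infsum (dterm9 j \<sigma>) ?V" for j
    define W where "W j = (\<Prod>q\<in>T. 1 - dterm9 j \<sigma> q)" for j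
    note [simp] = dterm9_summable_on[OF \<sigma>]
    have A: "A j = W j * S j" for j
      unfolding A_def W_def S_def N infsum_dterm9[OF \<sigma>, symmetric]
      by (rule infsum_coprime_primes) (simp_all add: T dterm9_mult)
    have A': "A j = B j * C j" for j
      unfolding A_def B_def C_def
    proof (rule infsum_mult_split)
      fix q :: nat
      show "\<not> (q mod 3 = 1 \<and> q mod 9 = 8)" using mod_3_eq_1_iff_mod_9[of q] by auto
    qed (simp_all add: dterm9_mult)
    have BC: "B 0 = B 3" "B 1 = B 4" "C 0 = C 4" "C 1 = C 3"
      unfolding B_def C_def dterm9_def using chU chV by (auto intro!: infsum_cong)
    have prod_eq: "W 0 * S 0 * (W 1 * S 1) = W 3 * S 3 * (W 4 * S 4)"
      unfolding A[symmetric] A' BC by simp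
    then have eq: "cmod (W 0) * cmod (S 0) * (cmod (W 1) * cmod (S 1)) = cmod (W 3) * cmod (S 3) * (cmod (W 4) * cmod (S 4))"
    proof -
      have "cmod (W 0 * S 0 * (W 1 * S 1)) = cmod (W 3 * S 3 * (W 4 * S 4))" by (rule arg_cong[OF prod_eq])
      then show ?thesis by (simp only: norm_mult)
    qed
    have W: "cmod (W j) \<ge> (1 / 2) ^ m" "cmod (W j) \<le> 2 ^ m" for j
    proof -
      have t: "cmod (dterm9 j \<sigma> q) \<le> 1 / 2" if "q \<in> T" for q
      proof -
        have "q \<ge> 2" using T(2)[OF that] prime_ge_2_nat by blast
        then have "real q powr - \<sigma> \<le> 2 powr - \<sigma>" using \<sigma> by (intro powr_mono2') auto
        also have "\<dots> \<le> 2 powr - 1" using \<sigma> by (intro powr_mono) auto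
        finally show ?thesis using dterm9_norm_le[of j \<sigma> q] by (simp add: powr_minus)
      qed
      have t': "1 / 2 \<le> cmod (1 - dterm9 j \<sigma> q)" "cmod (1 - dterm9 j \<sigma> q) \<le> 2" if "q \<in> T" for q
      proof -
        have "cmod 1 - cmod (dterm9 j \<sigma> q) \<le> cmod (1 - dterm9 j \<sigma> q)" by (rule norm_triangle_ineq2)
        then show "1 / 2 \<le> cmod (1 - dterm9 j \<sigma> q)" using t[OF that] by (simp only: norm_one)
        have "cmod (1 - dterm9 j \<sigma> q) \<le> cmod 1 + cmod (dterm9 j \<sigma> q)" by (rule norm_triangle_ineq4)
        then show "cmod (1 - dterm9 j \<sigma> q) \<le> 2" using t[OF that] by (simp only: norm_one)
      qed
      have W': "cmod (W j) = (\<Prod>q\<in>T. cmod (1 - dterm9 j \<sigma> q))" unfolding W_def by (rule prod_norm[symmetric])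
      have "(\<Prod>q\<in>T. 1 / 2) \<le> (\<Prod>q\<in>T. cmod (1 - dterm9 j \<sigma> q))" by (rule prod_mono) (use t' in simp)
      then show "cmod (W j) \<ge> (1 / 2) ^ m" unfolding W' m_def prod_constant .
      have "(\<Prod>q\<in>T. cmod (1 - dterm9 j \<sigma> q)) \<le> (\<Prod>q\<in>T. 2)" by (rule prod_mono) (simp add: t')
      then show "cmod (W j) \<le> 2 ^ m" unfolding W' m_def prod_constant .
    qed
    have x2: "cis (pi / 3) ^ 2 = cis (pi / 3) - 1"
    proof -
      have "cis (pi / 3) = Complex (1 / 2) (sqrt 3 / 2)" by (simp add: complex_eq_iff cos_60 sin_60)
      then show ?thesis by (simp add: complex_eq_iff power2_eq_square cos_60 sin_60)
    qed
    have x3: "cis (pi / 3) ^ 3 = - 1" by (subst Complex.DeMoivre) simp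
    have pw: "cis (pi / 3) ^ n = cis (pi / 3) ^ (n mod 6)" for n
      using cis_pi_third_power_mod[of n "n mod 6" 1] by simp
    have x4: "cis (pi / 3) ^ 4 = - cis (pi / 3)"
      using x3 power_add[of "cis (pi / 3)" 3 1] by simp
    have c3: "(\<Sum>r\<in>{1,2,4,5,7,8}. char9 3 r) = 0"
      by (simp add: char9_def dlog9_def pw[of 6] pw[of 9] pw[of 12] pw[of 15] x3)
    have c4: "(\<Sum>r\<in>{1,2,4,5,7,8}. char9 4 r) = 0"
      by (simp add: char9_def dlog9_def pw[of 8] pw[of 12] pw[of 16] pw[of 20] x2 x4)
    have S: "cmod (S 3) \<le> 6" "cmod (S 4) \<le> 6" "cmod (S 1) \<ge> 1 / 20"
      unfolding S_def using dterm9_series_bounded[OF \<sigma>] c3 c4 dterm9_series_lower[OF \<sigma>] by auto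
    have "(1 / 2) ^ m * cmod (S 0) * ((1 / 2) ^ m * (1 / 20)) \<le> cmod (W 0) * cmod (S 0) * (cmod (W 1) * cmod (S 1))"
      using W S by (intro mult_mono) auto
    also have "\<dots> \<le> 2 ^ m * 6 * (2 ^ m * 6)"
      unfolding eq using W S by (intro mult_mono) auto
    finally have "cmod (S 0) \<le> 720 * 2 ^ m * 2 ^ m * 2 ^ m * 2 ^ m" by (simp add: field_simps)
    then show ?thesis by (simp add: S_def)
  qed
  define K where "K = (720 * 2 ^ m * 2 ^ m * 2 ^ m * 2 ^ m :: real)"
  define r where "r \<sigma> n = (if 3 dvd n then 0 else real n powr - \<sigma>)" for \<sigma> n
  have partial: "sum (r \<sigma>) {..<N} \<le> K" if \<sigma>: "1 < \<sigma>" "\<sigma> \<le> 2" for \<sigma> N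
  proof -
    have eq: "dterm9 0 \<sigma> = (\<lambda>n. of_real (r \<sigma> n))" by (auto simp: dterm9_def char9_def r_def)
    have "norm (dterm9 0 \<sigma> n) = r \<sigma> n" for n by (simp add: eq r_def)
    then have sr: "summable (r \<sigma>)" using dterm9_norm_summable[OF \<sigma>, of 0] by simp
    have "sum (r \<sigma>) {..<N} \<le> suminf (r \<sigma>)" by (rule sum_le_suminf[OF sr]) (auto simp: r_def)
    also have "\<dots> \<le> cmod (of_real (suminf (r \<sigma>)))" by simp
    also have "complex_of_real (suminf (r \<sigma>)) = suminf (dterm9 0 \<sigma>)"
      unfolding eq by (rule suminf_of_real[OF sr])
    also have "cmod \<dots> \<le> K" unfolding K_def by (rule bound[OF \<sigma>])
    finally show ?thesis .
  qed
  \<comment> \<open>The bound is uniform in \<open>\<sigma>\<close>, so it survives the limit in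
    each finite partial sum, where continuity is immediate.\<close>
  have partial1: "sum (r 1) {..<N} \<le> K" for N
  proof (rule tendsto_upperbound)
    have "((\<lambda>\<sigma>. r \<sigma> n) \<longlongrightarrow> r 1 n) (at_right 1)" for n
    proof -
      have "((\<lambda>\<sigma>. real n powr - \<sigma>) \<longlongrightarrow> real n powr - 1) (at_right 1)" if "n > 0"
        using that by (intro tendsto_intros) auto
      then show ?thesis unfolding r_def by (cases "3 dvd n") (auto intro: gr0I)
    qed
    then show "((\<lambda>\<sigma>. sum (r \<sigma>) {..<N}) \<longlongrightarrow> sum (r 1) {..<N}) (at_right 1)" by (rule tendsto_sum)
    show "eventually (\<lambda>\<sigma>. sum (r \<sigma>) {..<N} \<le> K) (at_right 1)"
      using partial by (auto simp: eventually_at_right_field intro!: exI[of _ 2])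
  qed simp
  \<comment> \<open>Keeping only the terms of index 3 * k + 1 \<le> 3 * (k + 1) bounds the harmonic
    series, a contradiction.\<close>
  have "(\<Sum>k<N. real (k + 1) powr - 1) \<le> 3 * K" for N
  proof -
    have "(\<Sum>k<N. real (k + 1) powr - 1) \<le> (\<Sum>k<N. 3 * r 1 (3 * k + 1))"
    proof (rule sum_mono)
      fix k :: nat
      have "\<not> 3 dvd 3 * k + 1" by presburger
      then show "real (k + 1) powr - 1 \<le> 3 * r 1 (3 * k + 1)" by (simp add: r_def powr_minus field_simps)
    qed
    also have "\<dots> = 3 * sum (r 1) ((\<lambda>k. 3 * k + 1) ` {..<N})"
      by (subst sum.reindex) (auto simp: inj_on_def sum_distrib_left)
    also have "sum (r 1) ((\<lambda>k. 3 * k + 1) ` {..<N}) \<le> sum (r 1) {..<3 * N}"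
      by (rule sum_mono2) (auto simp: r_def)
    finally show ?thesis using partial1[of "3 * N"] by linarith
  qed
  then have "summable (\<lambda>k. real (k + 1) powr - 1)"
    by (intro summableI_nonneg_bounded[of _ "3 * K"]) auto
  then have "summable (\<lambda>k. real k powr - 1)" using summable_iff_shift[of "\<lambda>k. real k powr - 1" 1] by simp
  then show False unfolding summable_real_powr_iff by simp
qed

section \<open>Power sums of reciprocal roots modulo a prime\<close>

text \<open>Modulo \<open>p\<close>, \<open>pw p G n\<close> is the \<open>n\<close>-th coefficient of \<open>- X G' / G\<close>; the power \<open>p - 2\<close> inverts the
  constant coefficient.\<close>

fun pw :: "nat \<Rightarrow> int fps \<Rightarrow> nat \<Rightarrow> int" where
  "pw p G n = - ((fps_nth G 0) ^ (p - 2)) *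
     (int n * fps_nth G n + (\<Sum>i\<in>{1..<n}. fps_nth G i * pw p G (n - i)))"

declare pw.simps [simp del]

lemma pw_0 [simp]: "pw p G 0 = 0"
  by (subst pw.simps) simp

text \<open>Congruences of power series modulo \<open>p\<close> are written as divisibility by
  \<open>fps_const (int p)\<close>, so that all identities can be manipulated over the
  integers.\<close>

lemma fps_const_dvd_iff: "fps_const c dvd F \<longleftrightarrow> (\<forall>n. c dvd fps_nth F n)" for c :: int
proof
  assume "\<forall>n. c dvd fps_nth F n"
  then have "F = fps_const c * Abs_fps (\<lambda>n. fps_nth F n div c)" by (intro fps_ext) simp
  then show "fps_const c dvd F" by (rule dvdI)
qed (auto elim!: dvdE)

lemma int_inverse_mod_prime:
  assumes p: "prime p" and c: "\<not> int p dvd c"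
  shows "[c * c ^ (p - 2) = 1] (mod int p)"
proof -
  have p0: "int p > 0" using prime_gt_0_nat[OF p] by simp
  define a where "a = nat (c mod int p)"
  have a: "int a = c mod int p" using p0 by (simp add: a_def)
  have "\<not> p dvd a"
  proof
    assume "p dvd a"
    then have "int p dvd c mod int p" unfolding a[symmetric] by simp
    then show False using c by (simp add: dvd_eq_mod_eq_0)
  qed
  then have "[a ^ (p - 1) = 1] (mod p)" using p by (rule fermat_theorem[rotated])
  then have "[int a ^ (p - 1) = 1] (mod int p)" using cong_int_iff[of "a ^ (p - 1)" 1 p] by simp
  moreover have "[int a ^ (p - 1) = c ^ (p - 1)] (mod int p)"
    unfolding a by (intro cong_pow) simp
  ultimately have "[c ^ (p - 1) = 1] (mod int p)" using cong_sym cong_trans by blast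
  moreover have "p - 1 = Suc (p - 2)" using prime_ge_2_nat[OF p] by simp
  ultimately show ?thesis by simp
qed

text \<open>The recursion is G Y + X G' = 0 solved coefficient by coefficient, Fermat's theorem
  supplying the inverse of the constant coefficient.\<close>

lemma pw_spec:
  assumes p: "prime p" and G: "\<not> int p dvd fps_nth G 0"
  shows "fps_const (int p) dvd G * Abs_fps (pw p G) + fps_X * fps_deriv G"
  unfolding fps_const_dvd_iff
proof
  fix n
  define S where "S = int n * fps_nth G n + (\<Sum>i\<in>{1..<n}. fps_nth G i * pw p G (n - i))"
  show "int p dvd fps_nth (G * Abs_fps (pw p G) + fps_X * fps_deriv G) n"
  proof (cases "n = 0")
    case False
    have "{0..n} = insert 0 (insert n {1..<n})" using False by auto
    then have "fps_nth (G * Abs_fps (pw p G)) n = fps_nth G 0 * pw p G n + (\<Sum>i\<in>{1..<n}. fps_nth G i * pw p G (n - i))"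
      using False by (simp add: fps_mult_nth)
    then have "fps_nth (G * Abs_fps (pw p G) + fps_X * fps_deriv G) n = fps_nth G 0 * pw p G n + S"
      using False by (simp add: S_def)
    also have "pw p G n = - (fps_nth G 0 ^ (p - 2)) * S" by (simp add: pw.simps[of p G n] S_def)
    also have "fps_nth G 0 * (- (fps_nth G 0 ^ (p - 2)) * S) + S = - (fps_nth G 0 ^ Suc (p - 2) - 1) * S"
      by (simp add: algebra_simps)
    also have "Suc (p - 2) = p - 1" using prime_ge_2_nat[OF p] by simp
    also have "int p dvd - (fps_nth G 0 ^ (p - 1) - 1) * S"
    proof -
      have "p - 1 = Suc (p - 2)" using prime_ge_2_nat[OF p] by simp
      then have "[fps_nth G 0 ^ (p - 1) = 1] (mod int p)"
        using int_inverse_mod_prime[OF p G] by (simp only: power_Suc)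
      then have "int p dvd fps_nth G 0 ^ (p - 1) - 1" by (simp add: cong_iff_dvd_diff)
      then have "int p dvd - (fps_nth G 0 ^ (p - 1) - 1)" by (simp only: dvd_minus_iff)
      then show ?thesis by (rule dvd_mult2)
    qed
    finally show ?thesis .
  qed simp
qed

lemma fps_const_dvd_cancel:
  assumes p: "prime p" and G: "\<not> int p dvd fps_nth G 0" and dvd: "fps_const (int p) dvd G * Z"
  shows "fps_const (int p) dvd Z"
  unfolding fps_const_dvd_iff
proof
  fix n
  show "int p dvd fps_nth Z n"
  proof (induction n rule: less_induct)
    case (less n)
    have "int p dvd (\<Sum>i=0..n. fps_nth G i * fps_nth Z (n - i))"
      using dvd by (simp add: fps_const_dvd_iff fps_mult_nth)
    also have "{0..n} = insert 0 {1..n}" by auto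
    finally have "int p dvd fps_nth G 0 * fps_nth Z n + (\<Sum>i=1..n. fps_nth G i * fps_nth Z (n - i))" by simp
    moreover have "int p dvd (\<Sum>i=1..n. fps_nth G i * fps_nth Z (n - i))"
      by (intro dvd_sum dvd_mult less.IH) auto
    ultimately have "int p dvd fps_nth G 0 * fps_nth Z n" using dvd_add_left_iff by blast
    moreover have "prime (int p)" using p by simp
    ultimately show ?case using G by (simp add: prime_dvd_mult_iff)
  qed
qed

lemma fps_const_dvd_deriv: "fps_const c dvd F \<Longrightarrow> fps_const c dvd fps_deriv F" for c :: int
  by (auto simp: fps_const_dvd_iff)

text \<open>Logarithmic derivatives are additive: combining the defining relations of the three
  series leaves F G times the defect, and F G cancels modulo \<open>p\<close>.\<close>

lemma pw_mult:
  assumes p: "prime p" and F: "\<not> int p dvd fps_nth F 0" and G: "\<not> int p dvd fps_nth G 0"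
  shows "int p dvd pw p (F * G) n - (pw p F n + pw p G n)"
proof -
  let ?Y = "\<lambda>F. Abs_fps (pw p F)" and ?E = "\<lambda>F. F * Abs_fps (pw p F) + fps_X * fps_deriv F"
  have "prime (int p)" using p by simp
  then have FG: "\<not> int p dvd fps_nth (F * G) 0" using F G by (simp add: prime_dvd_mult_iff)
  have "fps_const (int p) dvd ?E (F * G) - ?E F * G - F * ?E G"
    by (intro dvd_diff dvd_mult dvd_mult2 pw_spec p F G FG)
  also have "?E (F * G) - ?E F * G - F * ?E G = F * G * (?Y (F * G) - (?Y F + ?Y G))"
    by (simp add: algebra_simps)
  finally have "fps_const (int p) dvd ?Y (F * G) - (?Y F + ?Y G)"
    by (rule fps_const_dvd_cancel[OF p FG])
  then show ?thesis by (simp add: fps_const_dvd_iff)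
qed

lemma pw_cong:
  assumes p: "prime p" and G: "\<not> int p dvd fps_nth G 0" and FG: "fps_const (int p) dvd F - G"
  shows "int p dvd pw p F n - pw p G n"
proof -
  let ?Y = "\<lambda>F. Abs_fps (pw p F)" and ?E = "\<lambda>F. F * Abs_fps (pw p F) + fps_X * fps_deriv F"
  have "int p dvd fps_nth F 0 - fps_nth G 0" using FG by (auto simp: fps_const_dvd_iff dest: spec[of _ 0])
  then have F: "\<not> int p dvd fps_nth F 0" using G by (metis dvd_diff_commute dvd_diff_right_iff dvd_diff_left_iff)
  have "fps_const (int p) dvd ?E F - ?E G - (F - G) * ?Y F - fps_X * fps_deriv (F - G)"
    by (intro dvd_diff dvd_mult2 dvd_mult[of _ "fps_deriv (F - G)"] pw_spec p F G FG fps_const_dvd_deriv)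
  also have "?E F - ?E G - (F - G) * ?Y F - fps_X * fps_deriv (F - G) = G * (?Y F - ?Y G)"
    by (simp add: algebra_simps)
  finally have "fps_const (int p) dvd ?Y F - ?Y G"
    by (rule fps_const_dvd_cancel[OF p G])
  then show ?thesis by (simp add: fps_const_dvd_iff)
qed

lemma pw_local:
  assumes "\<And>i. i \<le> n \<Longrightarrow> fps_nth F i = fps_nth G i"
  shows "pw p F n = pw p G n"
  using assms
proof (induction n rule: less_induct)
  case (less n)
  have "(\<Sum>i\<in>{1..<n}. fps_nth F i * pw p F (n - i)) = (\<Sum>i\<in>{1..<n}. fps_nth G i * pw p G (n - i))"
  proof (rule sum.cong)
    fix i assume i: "i \<in> {1..<n}"
    then have "pw p F (n - i) = pw p G (n - i)" using less by auto
    then show "fps_nth F i * pw p F (n - i) = fps_nth G i * pw p G (n - i)" using i less.prems by auto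
  qed simp
  then show ?case using less.prems[of 0] less.prems[of n] by (simp add: pw.simps[of p _ n])
qed

text \<open>Newton's identity: the n-th coefficient enters the n-th power sum only through -n times
  itself. This linearity yields both the vanishing of the character sums and the recovery of
  coefficients from power sums.\<close>

lemma pw_update_last:
  assumes "\<And>i. i < n \<Longrightarrow> fps_nth F i = fps_nth G i" and "fps_nth G 0 = 1" and "n > 0"
  shows "pw p F n = pw p G n - int n * (fps_nth F n - fps_nth G n)"
proof -
  have "(\<Sum>i\<in>{1..<n}. fps_nth F i * pw p F (n - i)) = (\<Sum>i\<in>{1..<n}. fps_nth G i * pw p G (n - i))"
  proof (rule sum.cong)
    fix i assume i: "i \<in> {1..<n}"
    then have "pw p F (n - i) = pw p G (n - i)" using assms by (intro pw_local) auto
    then show "fps_nth F i * pw p F (n - i) = fps_nth G i * pw p G (n - i)" using i assms by auto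
  qed simp
  then show ?thesis using assms by (simp add: pw.simps[of p _ n] algebra_simps)
qed

lemma pw_const: "pw p (fps_const c) n = 0"
proof (induction n rule: less_induct)
  case (less n)
  have "(\<Sum>i\<in>{1..<n}. fps_nth (fps_const c) i * pw p (fps_const c) (n - i)) = 0"
    by (rule sum.neutral) auto
  then show ?case by (cases "n = 0") (simp_all add: pw.simps[of p _ n])
qed

text \<open>Products of two of the nonconstant terms start in degree 2 h + 2, so up to degree 2 h +
  1 the logarithmic derivative is linear in the coefficients.\<close>

lemma pw_one_plus_high:
  assumes G: "fps_nth G 0 = 1" "\<And>i. 1 \<le> i \<Longrightarrow> i \<le> h \<Longrightarrow> fps_nth G i = 0" and n: "n \<le> 2 * h + 1"
  shows "pw p G n = - int n * fps_nth G n"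
proof -
  have low: "pw p G n = 0" if "n \<le> h" for n
    using that pw_local[of n G "fps_const 1" p] G pw_const[of p 1 n] by (auto simp: Suc_le_eq)
  have "(\<Sum>i\<in>{1..<n}. fps_nth G i * pw p G (n - i)) = 0"
  proof (rule sum.neutral, rule ballI)
    fix i assume i: "i \<in> {1..<n}"
    show "fps_nth G i * pw p G (n - i) = 0"
    proof (cases "i \<le> h")
      case False
      then have "n - i \<le> h" using n by simp
      then show ?thesis by (simp add: low)
    qed (use i G in auto)
  qed
  then show ?thesis using G by (simp add: pw.simps[of p _ n])
qed

text \<open>With constant coefficient 1 the relation holds over the integers and not only modulo
  \<open>p\<close>; this makes a comparison with complex roots possible.\<close>

lemma pw_exact:
  assumes G: "fps_nth G 0 = 1"
  shows "G * Abs_fps (pw p G) = - (fps_X * fps_deriv G)"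
proof (rule fps_ext)
  fix n
  show "fps_nth (G * Abs_fps (pw p G)) n = fps_nth (- (fps_X * fps_deriv G)) n"
  proof (cases "n = 0")
    case False
    have "{0..n} = insert 0 (insert n {1..<n})" using False by auto
    then have "fps_nth (G * Abs_fps (pw p G)) n = pw p G n + (\<Sum>i\<in>{1..<n}. fps_nth G i * pw p G (n - i))"
      using False G by (simp add: fps_mult_nth)
    then show ?thesis using False G by (simp add: pw.simps[of p _ n])
  qed simp
qed

text \<open>Multiplying the defining relation by \<open>q\<close> shows that (X^E - 1) Y is
  congruent to a polynomial of degree at most E, whose coefficients beyond E vanish. In terms of
  roots: they are E-th roots of unity.\<close>

lemma pw_periodic:
  assumes p: "prime p" and G: "\<not> int p dvd poly.coeff g 0"
    and deg: "Polynomial.degree g + Polynomial.degree q \<le> E"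
    and dvd: "\<And>i. int p dvd poly.coeff (g * q - (Polynomial.monom 1 E - 1)) i" and n: "n > 0"
  shows "int p dvd pw p (fps_of_poly g) (n + E) - pw p (fps_of_poly g) n"
proof -
  let ?G = "fps_of_poly g" and ?Q = "fps_of_poly q"
  let ?Y = "Abs_fps (pw p ?G)"
  have 1: "fps_const (int p) dvd ?G * ?Q - (fps_X ^ E - 1)"
    unfolding fps_const_dvd_iff
  proof
    fix i
    have "fps_of_poly (g * q - (Polynomial.monom 1 E - 1)) = ?G * ?Q - (fps_X ^ E - 1)"
      by (simp add: fps_of_poly_diff fps_of_poly_mult fps_of_poly_monom)
    then show "int p dvd fps_nth (?G * ?Q - (fps_X ^ E - 1)) i"
      using dvd[of i] by (metis fps_of_poly_nth)
  qed
  have "fps_const (int p) dvd (?G * ?Y + fps_X * fps_deriv ?G) * ?Q - (?G * ?Q - (fps_X ^ E - 1)) * ?Y"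
    by (intro dvd_diff dvd_mult2 1 pw_spec p) (use G in simp)
  also have "(?G * ?Y + fps_X * fps_deriv ?G) * ?Q - (?G * ?Q - (fps_X ^ E - 1)) * ?Y
      = (fps_X ^ E - 1) * ?Y + fps_X * fps_deriv ?G * ?Q" by (simp add: algebra_simps)
  finally have "int p dvd fps_nth ((fps_X ^ E - 1) * ?Y + fps_X * fps_deriv ?G * ?Q) (n + E)"
    by (simp add: fps_const_dvd_iff)
  moreover have "fps_nth (fps_X * fps_deriv ?G * ?Q) (n + E) = 0"
  proof -
    have eq: "fps_X * fps_deriv ?G * ?Q = fps_of_poly (pCons 0 (pderiv g) * q)"
      by (simp add: fps_of_poly_mult fps_of_poly_pCons fps_of_poly_pderiv)
    have "Polynomial.degree (pCons 0 (pderiv g)) \<le> Polynomial.degree g"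
    proof (cases "pderiv g = 0")
      case False
      then have "Polynomial.degree g > 0" by (metis pderiv_eq_0_iff gr0I)
      then show ?thesis using False by (simp add: degree_pderiv)
    qed simp
    then have "Polynomial.degree (pCons 0 (pderiv g) * q) \<le> E"
      using degree_mult_le[of "pCons 0 (pderiv g)" q] deg by linarith
    then show ?thesis unfolding eq using n by (simp add: coeff_eq_0)
  qed
  moreover have "fps_nth ((fps_X ^ E - 1) * ?Y) (n + E) = pw p ?G n - pw p ?G (n + E)"
    by (simp add: left_diff_distrib fps_X_power_mult_nth)
  ultimately have "int p dvd pw p ?G n - pw p ?G (n + E)" by simp
  then show ?thesis by (simp add: dvd_diff_commute)
qed

text \<open>The factor \<open>1 - x X\<close> contributes the reciprocal root \<open>x\<close>.\<close>

definition root_fps :: "complex list \<Rightarrow> complex fps" where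
  "root_fps xs = (\<Prod>x\<leftarrow>xs. 1 - fps_const x * fps_X)"

lemma root_fps_Nil [simp]: "root_fps [] = 1"
  and root_fps_Cons [simp]: "root_fps (x # xs) = (1 - fps_const x * fps_X) * root_fps xs"
  by (simp_all add: root_fps_def)

lemma root_fps_log_deriv:
  "root_fps xs * Abs_fps (\<lambda>n. if n = 0 then 0 else \<Sum>x\<leftarrow>xs. x ^ n) = - (fps_X * fps_deriv (root_fps xs))"
proof (induction xs)
  case (Cons x xs)
  let ?S = "\<lambda>xs. Abs_fps (\<lambda>n. if n = 0 then 0 else \<Sum>x\<leftarrow>xs. x ^ n :: complex)"
  have "(1 - fps_const x * fps_X) * ?S [x] = fps_const x * fps_X"
  proof (rule fps_ext)
    fix n
    have "fps_nth ((1 - fps_const x * fps_X) * ?S [x]) n = fps_nth (?S [x]) n - x * fps_nth (fps_X * ?S [x]) n"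
      by (simp add: left_diff_distrib mult.assoc del: fps_X_mult_nth)
    then show "fps_nth ((1 - fps_const x * fps_X) * ?S [x]) n = fps_nth (fps_const x * fps_X) n"
      by (cases n; cases "n - 1") auto
  qed
  then have 1: "(1 - fps_const x * fps_X) * ?S [x] = - (fps_X * fps_deriv (1 - fps_const x * fps_X))"
    by simp
  have "?S (x # xs) = ?S [x] + ?S xs" by (intro fps_ext) simp
  then have "root_fps (x # xs) * ?S (x # xs)
      = ((1 - fps_const x * fps_X) * ?S [x]) * root_fps xs + (1 - fps_const x * fps_X) * (root_fps xs * ?S xs)"
    by (simp add: algebra_simps)
  moreover have "fps_deriv (1 - fps_const x * fps_X) = - fps_const x"
  proof -
    have "fps_deriv (1 - fps_const x * fps_X) = fps_const (- x)" by simp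
    then show ?thesis unfolding fps_const_neg .
  qed
  ultimately show ?case unfolding 1 Cons.IH root_fps_Cons fps_deriv_mult by (simp add: algebra_simps)
qed (intro fps_ext, simp)

text \<open>The bridge to complex roots: both sides solve the same logarithmic differential
  equation. Power sums of transformed roots can then be computed in the complex numbers and read off
  modulo \<open>p\<close>.\<close>

lemma pw_eq_sum_powers:
  assumes G: "fps_nth G 0 = 1" and xs: "\<And>n. of_int (fps_nth G n) = fps_nth (root_fps xs) n" and n: "n > 0"
  shows "of_int (pw p G n) = (\<Sum>x\<leftarrow>xs. x ^ n)"
proof -
  let ?S = "Abs_fps (\<lambda>n. if n = 0 then 0 else \<Sum>x\<leftarrow>xs. x ^ n)" and ?Y = "Abs_fps (\<lambda>n. of_int (pw p G n)) :: complex fps"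
  have "root_fps xs * ?Y = - (fps_X * fps_deriv (root_fps xs))"
  proof (rule fps_ext)
    fix n
    have "fps_nth (root_fps xs * ?Y) n = of_int (fps_nth (G * Abs_fps (pw p G)) n)"
      by (simp add: fps_mult_nth xs)
    also have "\<dots> = fps_nth (- (fps_X * fps_deriv (root_fps xs))) n"
      unfolding pw_exact[OF G] by (cases n) (simp_all add: xs[symmetric])
    finally show "fps_nth (root_fps xs * ?Y) n = fps_nth (- (fps_X * fps_deriv (root_fps xs))) n" .
  qed
  then have "root_fps xs * ?Y = root_fps xs * ?S" by (simp add: root_fps_log_deriv)
  moreover have "root_fps xs \<noteq> 0" using xs[of 0] G by auto
  ultimately have "?Y = ?S" by simp
  then have "fps_nth ?Y n = fps_nth ?S n" by simp
  then show ?thesis using n by simp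
qed

section \<open>Additive characters and exponential sums over coefficient lists\<close>

definition add_char :: "nat \<Rightarrow> int \<Rightarrow> complex" where
  "add_char p n = cis (2 * pi * of_int n / real p)"

lemma add_char_add: "add_char p (m + n) = add_char p m * add_char p n"
  by (simp add: add_char_def cis_mult algebra_simps add_divide_distrib)

lemma add_char_0 [simp]: "add_char p 0 = 1" by (simp add: add_char_def)

lemma add_char_nonzero [simp]: "add_char p n \<noteq> 0" by (simp add: add_char_def)

lemma norm_add_char [simp]: "cmod (add_char p n) = 1" by (simp add: add_char_def)

lemma cnj_add_char: "cnj (add_char p n) = add_char p (- n)"
  by (simp add: add_char_def cis_cnj)

lemma add_char_dvd: "int p dvd n \<Longrightarrow> add_char p n = 1"
proof (elim dvdE)
  fix k assume "n = int p * k"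
  then have "2 * pi * of_int n / real p = (if p = 0 then 0 else 2 * pi * of_int k)" by simp
  then show ?thesis using cis_multiple_2pi[of "of_int k"] by (simp add: add_char_def)
qed

lemma add_char_eqI: "int p dvd m - n \<Longrightarrow> add_char p m = add_char p n"
  using add_char_add[of p "m - n" n] add_char_dvd[of p "m - n"] by simp

lemma add_char_neq_1:
  assumes "p > 0" "\<not> int p dvd n"
  shows "add_char p n \<noteq> 1"
proof
  assume "add_char p n = 1"
  then have "cos (2 * pi * of_int n / real p) = 1" by (simp add: add_char_def complex_eq_iff)
  then obtain k where "2 * pi * of_int n / real p = of_int k * 2 * pi" by (auto simp: cos_one_2pi_int)
  then have "real_of_int n = real_of_int (k * int p)" using assms by (simp add: field_simps)
  then have "n = k * int p" by linarith
  with assms show False by simp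
qed

lemma add_char_power: "add_char p n ^ k = add_char p (int k * n)"
  by (induction k) (auto simp: add_char_add distrib_right)

lemma sum_add_char:
  assumes "p > 0"
  shows "(\<Sum>v\<in>{0..<int p}. add_char p (v * n)) = (if int p dvd n then of_nat p else 0)"
proof -
  have "bij_betw int {..<p} {0..<int p}" by (rule bij_betwI[of _ _ _ nat]) auto
  then have "(\<Sum>v\<in>{0..<int p}. add_char p (v * n)) = (\<Sum>v<p. add_char p (int v * n))"
    by (rule sum.reindex_bij_betw[symmetric])
  also have "\<dots> = (\<Sum>v<p. add_char p n ^ v)" by (simp add: add_char_power)
  also have "\<dots> = (if int p dvd n then of_nat p else 0)"
  proof (cases "int p dvd n")
    case False
    have "add_char p n ^ p = 1" unfolding add_char_power by (rule add_char_dvd) simp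
    then show ?thesis using False add_char_neq_1[OF assms False] by (simp add: sum_gp_strict)
  qed (simp add: add_char_dvd)
  finally show ?thesis .
qed

text \<open>The constant coefficient 1 is not stored and trailing zeros are allowed, so lists of
  length k encode the polynomials of degree at most k with constant coefficient 1.\<close>

definition list_fps :: "int list \<Rightarrow> int fps" where
  "list_fps es = Abs_fps (\<lambda>n. if n = 0 then 1 else if n \<le> length es then es ! (n - 1) else 0)"

lemma list_fps_nth:
  "fps_nth (list_fps es) n = (if n = 0 then 1 else if n \<le> length es then es ! (n - 1) else 0)"
  by (simp add: list_fps_def)

definition residue_lists :: "nat \<Rightarrow> nat \<Rightarrow> int list set" where
  "residue_lists p k = {es. length es = k \<and> set es \<subseteq> {0..<int p}}"

lemma finite_residue_lists [simp]: "finite (residue_lists p k)"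
  unfolding residue_lists_def using finite_lists_length_eq[of "{0..<int p}" k] by (simp add: conj_commute)

lemma residue_lists_0 [simp]: "residue_lists p 0 = {[]}"
  by (auto simp: residue_lists_def)

lemma residue_lists_length: "es \<in> residue_lists p k \<Longrightarrow> length es = k"
  by (simp add: residue_lists_def)

lemma sum_residue_lists_add:
  "sum f (residue_lists p (m + n)) = (\<Sum>lo\<in>residue_lists p m. \<Sum>hi\<in>residue_lists p n. f (lo @ hi))"
proof -
  have "bij_betw (\<lambda>(lo, hi). lo @ hi) (residue_lists p m \<times> residue_lists p n) (residue_lists p (m + n))"
  proof (rule bij_betwI[of _ _ _ "\<lambda>es. (take m es, drop m es)"])
    show "(\<lambda>es. (take m es, drop m es)) \<in> residue_lists p (m + n) \<rightarrow> residue_lists p m \<times> residue_lists p n"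
      by (auto simp: residue_lists_def subset_iff dest!: in_set_takeD in_set_dropD)
  qed (auto simp: residue_lists_def subset_iff)
  then have "sum f (residue_lists p (m + n)) = (\<Sum>(lo, hi)\<in>residue_lists p m \<times> residue_lists p n. f (lo @ hi))"
    by (subst sum.reindex_bij_betw[symmetric]) (auto intro!: sum.cong)
  then show ?thesis by (simp add: sum.cartesian_product)
qed

lemma sum_residue_lists_1: "sum f (residue_lists p 1) = (\<Sum>e\<in>{0..<int p}. f [e])"
proof -
  have "bij_betw (\<lambda>e. [e]) {0..<int p} (residue_lists p 1)"
    by (rule bij_betwI[of _ _ _ hd]) (auto simp: residue_lists_def length_Suc_conv)
  then show ?thesis by (rule sum.reindex_bij_betw[symmetric])
qed

text \<open>For the list \<open>es\<close> of coefficients of \<open>1 + e\<^sub>1 X + \<dots> + e\<^sub>k X\<^sup>k\<close>, \<^term>\<open>pw p (list_fps es) d\<close> is the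
  \<open>d\<close>-th power sum of the reciprocal roots.\<close>

definition power_char_sum :: "nat \<Rightarrow> nat \<Rightarrow> nat \<Rightarrow> complex" where
  "power_char_sum p d k = (\<Sum>es\<in>residue_lists p k. add_char p (pw p (list_fps es) d))"

text \<open>Summing over the d-th coefficient alone already gives 0, since the exponent is linear in
  it with factor -d, prime to \<open>p\<close>. The term \<open>C\<close>, blind to this
  coefficient, makes room for the lower power sums of the translated exponent.\<close>

lemma sum_add_char_pw_vanish:
  assumes p: "prime p" and d: "d > 0" "\<not> p dvd d" and k: "k \<ge> d"
    and C: "\<And>F G. (\<And>i. i < d \<Longrightarrow> fps_nth F i = fps_nth G i) \<Longrightarrow> C F = C G"
  shows "(\<Sum>es\<in>residue_lists p k. add_char p (pw p (list_fps es) d + C (list_fps es))) = 0"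
proof -
  let ?w = "\<lambda>es. add_char p (pw p (list_fps es) d + C (list_fps es))"
  have "sum ?w (residue_lists p k) = sum ?w (residue_lists p (((d - 1) + 1) + (k - d)))" using d k by simp
  also have "\<dots> = (\<Sum>lo\<in>residue_lists p (d - 1). \<Sum>e\<in>{0..<int p}. \<Sum>hi\<in>residue_lists p (k - d). ?w ((lo @ [e]) @ hi))"
    unfolding sum_residue_lists_add sum_residue_lists_1 ..
  also have "\<dots> = (\<Sum>lo\<in>residue_lists p (d - 1). \<Sum>e\<in>{0..<int p}. \<Sum>hi\<in>residue_lists p (k - d).
      ?w lo * add_char p (e * - int d))"
  proof (intro sum.cong refl)
    fix lo e hi assume lo: "lo \<in> residue_lists p (d - 1)"
    have len: "length lo = d - 1" using lo by (rule residue_lists_length)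
    have "pw p (list_fps ((lo @ [e]) @ hi)) d = pw p (list_fps lo) d -
        int d * (fps_nth (list_fps ((lo @ [e]) @ hi)) d - fps_nth (list_fps lo) d)"
      by (rule pw_update_last) (use len d in \<open>auto simp: list_fps_nth nth_append\<close>)
    also have "fps_nth (list_fps ((lo @ [e]) @ hi)) d = e" using len d by (auto simp: list_fps_nth nth_append)
    also have "fps_nth (list_fps lo) d = 0" using len d by (auto simp: list_fps_nth)
    finally have "pw p (list_fps ((lo @ [e]) @ hi)) d = pw p (list_fps lo) d + e * - int d"
      by (simp add: algebra_simps)
    moreover have "C (list_fps ((lo @ [e]) @ hi)) = C (list_fps lo)"
      by (rule C) (use len d in \<open>auto simp: list_fps_nth nth_append\<close>)
    ultimately have "pw p (list_fps ((lo @ [e]) @ hi)) d + C (list_fps ((lo @ [e]) @ hi)) =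
        (pw p (list_fps lo) d + C (list_fps lo)) + e * - int d"
      by linarith
    then show "?w ((lo @ [e]) @ hi) = ?w lo * add_char p (e * - int d)"
      by (simp only: add_char_add)
  qed
  also have "\<dots> = (\<Sum>lo\<in>residue_lists p (d - 1). of_nat (card (residue_lists p (k - d))) *
      (?w lo * (\<Sum>e\<in>{0..<int p}. add_char p (e * - int d))))"
    by (simp add: sum_distrib_left mult_ac)
  also have "(\<Sum>e\<in>{0..<int p}. add_char p (e * - int d)) = 0"
    using sum_add_char[of p "- int d"] p d prime_gt_0_nat by simp
  finally show ?thesis by simp
qed

lemma power_char_sum_vanish:
  assumes p: "prime p" and d: "d > 0" "\<not> p dvd d" and k: "k \<ge> d"
  shows "power_char_sum p d k = 0"
  using sum_add_char_pw_vanish[OF assms, of "\<lambda>_. 0"] by (simp add: power_char_sum_def)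

lemma sum_add_char_linear:
  assumes "p > 0"
  shows "(\<Sum>hi\<in>residue_lists p n. add_char p (\<Sum>j<n. hi ! j * c j)) =
    (if \<forall>j<n. int p dvd c j then of_nat p ^ n else 0)"
proof (induction n)
  case (Suc n)
  have "(\<Sum>hi\<in>residue_lists p (n + 1). add_char p (\<Sum>j<n + 1. hi ! j * c j)) =
    (\<Sum>lo\<in>residue_lists p n. \<Sum>e\<in>{0..<int p}. add_char p (\<Sum>j<n + 1. (lo @ [e]) ! j * c j))"
    unfolding sum_residue_lists_add sum_residue_lists_1 ..
  also have "\<dots> = (\<Sum>lo\<in>residue_lists p n. \<Sum>e\<in>{0..<int p}. add_char p (\<Sum>j<n. lo ! j * c j) * add_char p (e * c n))"
  proof (intro sum.cong refl)
    fix lo e assume "lo \<in> residue_lists p n"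
    then have "length lo = n" by (rule residue_lists_length)
    then have "(\<Sum>j<n + 1. (lo @ [e]) ! j * c j) = (\<Sum>j<n. lo ! j * c j) + e * c n"
      by (simp add: nth_append)
    then show "add_char p (\<Sum>j<n + 1. (lo @ [e]) ! j * c j) = add_char p (\<Sum>j<n. lo ! j * c j) * add_char p (e * c n)"
      by (simp add: add_char_add)
  qed
  also have "\<dots> = (\<Sum>lo\<in>residue_lists p n. add_char p (\<Sum>j<n. lo ! j * c j)) * (\<Sum>e\<in>{0..<int p}. add_char p (e * c n))"
    by (simp add: sum_product)
  also have "\<dots> = (if \<forall>j<Suc n. int p dvd c j then of_nat p ^ Suc n else 0)"
    unfolding Suc.IH sum_add_char[OF assms] by (auto simp: less_Suc_eq)
  finally show ?case by simp
qed simp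

section \<open>The functional equation by truncated inversion\<close>

definition list_fps_inverse :: "int list \<Rightarrow> int fps" where
  "list_fps_inverse es = fps_right_inverse (list_fps es) 1"

lemma list_fps_inverse: "list_fps es * list_fps_inverse es = 1"
  unfolding list_fps_inverse_def by (rule fps_right_inverse) (simp add: list_fps_nth)

text \<open>Inversion in the ring of polynomials modulo \<open>p\<close> and X^(h+1), where h is the
  length of the list. It is the involution behind the functional equation.\<close>

definition inverse_list :: "nat \<Rightarrow> int list \<Rightarrow> int list" where
  "inverse_list p es = map (\<lambda>i. fps_nth (list_fps_inverse es) (Suc i) mod int p) [0..<length es]"

lemma length_inverse_list [simp]: "length (inverse_list p es) = length es"
  by (simp add: inverse_list_def)

lemma inverse_list_in:
  assumes "p > 0" "es \<in> residue_lists p h" shows "inverse_list p es \<in> residue_lists p h"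
  using assms by (auto simp: residue_lists_def inverse_list_def)

lemma inverse_list_cong:
  assumes "i \<le> length es"
  shows "int p dvd fps_nth (list_fps (inverse_list p es)) i - fps_nth (list_fps_inverse es) i"
proof (cases i)
  case 0
  have "fps_nth (list_fps_inverse es) 0 = 1"
    using arg_cong[OF list_fps_inverse[of es], of "\<lambda>f. fps_nth f 0"] by (simp add: list_fps_nth)
  then show ?thesis by (simp add: 0 list_fps_nth)
next
  case (Suc j)
  have "fps_nth (list_fps (inverse_list p es)) i = fps_nth (list_fps_inverse es) i mod int p"
    using assms Suc by (simp add: list_fps_nth inverse_list_def)
  then show ?thesis by (simp add: mod_eq_dvd_iff[symmetric])
qed

lemma inverse_list_mult:
  assumes "i \<le> length es"
  shows "int p dvd fps_nth (list_fps es * list_fps (inverse_list p es)) i - fps_nth 1 i"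
proof -
  have "fps_nth (list_fps es * list_fps (inverse_list p es)) i - fps_nth 1 i =
      fps_nth (list_fps es * (list_fps (inverse_list p es) - list_fps_inverse es)) i"
    by (simp add: right_diff_distrib list_fps_inverse)
  also have "int p dvd \<dots>"
    unfolding fps_mult_nth by (intro dvd_sum dvd_mult) (use assms inverse_list_cong in auto)
  finally show ?thesis .
qed

lemma inverse_list_inverse_list:
  assumes "es \<in> residue_lists p h"
  shows "inverse_list p (inverse_list p es) = es"
proof (rule nth_equalityI)
  fix i assume i: "i < length (inverse_list p (inverse_list p es))"
  let ?g = "list_fps es" and ?g' = "list_fps (inverse_list p es)" and ?q' = "list_fps_inverse (inverse_list p es)"
  have "fps_nth ?g (Suc i) - fps_nth ?q' (Suc i) = fps_nth (?g * (?g' * ?q')) (Suc i) - fps_nth ?q' (Suc i)"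
    by (simp add: list_fps_inverse)
  also have "\<dots> = fps_nth (?q' * (?g * ?g' - 1)) (Suc i)" by (simp add: algebra_simps)
  also have "int p dvd \<dots>"
    unfolding fps_mult_nth[of ?q']
  proof (intro dvd_sum dvd_mult)
    fix j
    show "int p dvd fps_nth (?g * ?g' - 1) (Suc i - j)"
      using inverse_list_mult[of "Suc i - j" es p] i by (simp only: fps_sub_nth length_inverse_list)
  qed
  finally have "fps_nth ?q' (Suc i) mod int p = fps_nth ?g (Suc i) mod int p"
    by (simp add: mod_eq_dvd_iff dvd_diff_commute)
  also have "fps_nth ?g (Suc i) = es ! i" using i by (simp add: list_fps_nth)
  also have "es ! i mod int p = es ! i"
  proof -
    have "es ! i \<in> {0..<int p}" using assms i by (auto simp: residue_lists_def subset_iff)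
    then show ?thesis by simp
  qed
  finally show "inverse_list p (inverse_list p es) ! i = es ! i"
    using i by (simp add: inverse_list_def[of p "inverse_list p es"])
qed simp

lemma list_fps_degree: "length es < i \<Longrightarrow> fps_nth (list_fps es) i = 0"
  by (simp add: list_fps_nth)

text \<open>The product of a truncated polynomial and its truncated inverse is 1 up to degree h and
  has degree at most 2 h. Its power sum of index 2 h + 1 is linear in the coefficient there, hence
  0, so the two factors have opposite power sums.\<close>

lemma pw_inverse_list:
  assumes p: "prime p" and len: "length es = h"
  shows "int p dvd pw p (list_fps (inverse_list p es)) (2 * h + 1) + pw p (list_fps es) (2 * h + 1)"
proof -
  let ?d = "2 * h + 1" and ?F = "list_fps es * list_fps (inverse_list p es)"
  \<comment> \<open>The product is 1 up to degree h only modulo \<open>p\<close>; \<open>W\<close>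
    makes this exact, as \<open>pw_one_plus_high\<close> demands.\<close>
  define W where "W = Abs_fps (\<lambda>i. if i \<le> h then fps_nth 1 i else fps_nth ?F i)"
  have np: "\<not> int p dvd 1" using p by auto
  have "fps_const (int p) dvd ?F - W"
    unfolding fps_const_dvd_iff W_def using inverse_list_mult[of _ es p] len by auto
  then have "int p dvd pw p ?F ?d - pw p W ?d" by (intro pw_cong p) (use np in \<open>simp add: W_def\<close>)
  moreover have "pw p W ?d = - int ?d * fps_nth W ?d"
    by (rule pw_one_plus_high[of _ h]) (simp_all add: W_def)
  moreover have "fps_nth W ?d = 0"
  proof -
    have "fps_nth ?F ?d = 0"
      unfolding fps_mult_nth
    proof (rule sum.neutral, rule ballI)
      fix i assume "i \<in> {0..?d}"
      show "fps_nth (list_fps es) i * fps_nth (list_fps (inverse_list p es)) (?d - i) = 0"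
        using len by (cases "i \<le> h") (simp_all add: list_fps_degree)
    qed
    then show ?thesis by (simp add: W_def)
  qed
  ultimately have "int p dvd pw p ?F ?d" by simp
  moreover have "int p dvd pw p ?F ?d - (pw p (list_fps es) ?d + pw p (list_fps (inverse_list p es)) ?d)"
    by (rule pw_mult[OF p]) (use np in \<open>simp_all add: list_fps_nth\<close>)
  ultimately have "int p dvd pw p ?F ?d - (pw p ?F ?d - (pw p (list_fps es) ?d + pw p (list_fps (inverse_list p es)) ?d))"
    by (rule dvd_diff)
  then show ?thesis by (simp add: add.commute)
qed

text \<open>Split the coefficients at degree h and factor out the lower part: the exponent becomes
  linear in the upper coefficients, with factors taken from the inverse of the lower part.
  Orthogonality forces that inverse to have degree at most 2 h - k, and passing to it as new
  variable conjugates the summand.\<close>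

lemma power_char_sum_upper_half:
  assumes p: "prime p" and pd: "\<not> p dvd 2 * h + 1" and k: "h \<le> k" "k \<le> 2 * h"
  shows "power_char_sum p (2 * h + 1) k = of_nat p ^ (k - h) * cnj (power_char_sum p (2 * h + 1) (2 * h - k))"
proof -
  let ?d = "2 * h + 1" and ?n = "k - h"
  have p0: "p > 0" and np: "\<not> int p dvd 1" using p prime_gt_0_nat by auto
  define m where "m = Suc h"
  \<comment> \<open>The inverse of \<open>lo\<close> has no terms in the degrees 2 h - k + 1 to
    h.\<close>
  define cond where "cond lo \<longleftrightarrow> (\<forall>j<?n. int p dvd fps_nth (list_fps_inverse lo) (h - j))" for lo
  define f where "f lo = add_char p (pw p (list_fps lo) ?d)" for lo
  have "power_char_sum p ?d k = power_char_sum p ?d (h + ?n)" using k by simp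
  also have "\<dots> = (\<Sum>lo\<in>residue_lists p h. \<Sum>hi\<in>residue_lists p ?n. f (lo @ hi))"
    unfolding power_char_sum_def sum_residue_lists_add f_def ..
  also have "\<dots> = (\<Sum>lo\<in>residue_lists p h. f lo * (if cond lo then of_nat p ^ ?n else 0))"
  proof (rule sum.cong[OF refl])
    fix lo assume lo: "lo \<in> residue_lists p h"
    have len: "length lo = h" using lo by (rule residue_lists_length)
    let ?q = "list_fps_inverse lo"
    have "f (lo @ hi) = f lo * add_char p (\<Sum>j<?n. hi ! j * (- int ?d * fps_nth ?q (h - j)))"
      if hi: "hi \<in> residue_lists p ?n" for hi
    proof -
      have lenh: "length hi = ?n" using hi by (rule residue_lists_length)
      define H where "H = Abs_fps (\<lambda>j. if j < ?n then hi ! j else 0)"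
      have 1: "list_fps (lo @ hi) = list_fps lo + fps_X ^ m * H"
      proof (rule fps_ext)
        fix n
        show "fps_nth (list_fps (lo @ hi)) n = fps_nth (list_fps lo + fps_X ^ m * H) n"
          unfolding fps_add_nth fps_X_power_mult_nth list_fps_nth H_def m_def
          using len lenh by (auto simp: nth_append)
      qed
      also have "\<dots> = list_fps lo * (1 + fps_X ^ m * (H * ?q))"
      proof -
        have "list_fps lo * (1 + fps_X ^ m * (H * ?q)) = list_fps lo + fps_X ^ m * H * (list_fps lo * ?q)"
          by (simp only: distrib_left mult_1_right mult.assoc mult.left_commute[of "list_fps lo"])
        then show ?thesis unfolding list_fps_inverse by simp
      qed
      finally have eq: "list_fps (lo @ hi) = list_fps lo * (1 + fps_X ^ m * (H * ?q))" .
      have c0: "fps_nth (1 + fps_X ^ m * (H * ?q)) 0 = 1"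
        unfolding fps_add_nth fps_X_power_mult_nth by (simp add: m_def)
      have "pw p (1 + fps_X ^ m * (H * ?q)) ?d = - int ?d * fps_nth (1 + fps_X ^ m * (H * ?q)) ?d"
      proof (rule pw_one_plus_high[of _ h])
        fix i assume "1 \<le> i" "i \<le> h"
        then have "i \<noteq> 0" "i < m" by (simp_all add: m_def)
        then show "fps_nth (1 + fps_X ^ m * (H * ?q)) i = 0" by (simp add: fps_X_power_mult_nth)
      next
        show "fps_nth (1 + fps_X ^ m * (H * ?q)) 0 = 1" by (rule c0)
      qed simp
      also have "fps_nth (1 + fps_X ^ m * (H * ?q)) ?d = fps_nth (H * ?q) h"
      proof -
        have "?d \<noteq> 0" "\<not> ?d < m" "?d - m = h" by (simp_all add: m_def)
        then show ?thesis unfolding fps_add_nth fps_X_power_mult_nth by simp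
      qed
      also have "fps_nth (H * ?q) h = (\<Sum>j<?n. hi ! j * fps_nth ?q (h - j))"
        unfolding fps_mult_nth H_def using k by (intro sum.mono_neutral_cong_right) auto
      also have "- int ?d * \<dots> = (\<Sum>j<?n. hi ! j * (- int ?d * fps_nth ?q (h - j)))"
        by (simp add: sum_distrib_left mult_ac)
      finally have 2: "pw p (1 + fps_X ^ m * (H * ?q)) ?d = (\<Sum>j<?n. hi ! j * (- int ?d * fps_nth ?q (h - j)))" .
      have "int p dvd pw p (list_fps (lo @ hi)) ?d - (pw p (list_fps lo) ?d + pw p (1 + fps_X ^ m * (H * ?q)) ?d)"
      proof -
        have "\<not> int p dvd fps_nth (list_fps lo) 0" "\<not> int p dvd fps_nth (1 + fps_X ^ m * (H * ?q)) 0"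
          unfolding c0 using np by (simp_all add: list_fps_nth)
        then show ?thesis unfolding eq by (rule pw_mult[OF p])
      qed
      then show ?thesis unfolding f_def 2 add_char_add[symmetric] by (rule add_char_eqI)
    qed
    then have "(\<Sum>hi\<in>residue_lists p ?n. f (lo @ hi)) =
        f lo * (\<Sum>hi\<in>residue_lists p ?n. add_char p (\<Sum>j<?n. hi ! j * (- int ?d * fps_nth ?q (h - j))))"
      unfolding sum_distrib_left by (intro sum.cong refl)
    also have "\<dots> = f lo * (if \<forall>j<?n. int p dvd - int ?d * fps_nth ?q (h - j) then of_nat p ^ ?n else 0)"
      unfolding sum_add_char_linear[OF p0] ..
    also have "(\<forall>j<?n. int p dvd - int ?d * fps_nth ?q (h - j)) \<longleftrightarrow> cond lo"
    proof -
      have "\<not> int p dvd int ?d" using pd int_dvd_int_iff[of p ?d] by blast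
      moreover have "prime (int p)" using p by simp
      ultimately have "int p dvd - int ?d * x \<longleftrightarrow> int p dvd x" for x
        by (simp only: prime_dvd_mult_iff dvd_minus_iff) simp
      then show ?thesis unfolding cond_def by blast
    qed
    finally show "(\<Sum>hi\<in>residue_lists p ?n. f (lo @ hi)) = f lo * (if cond lo then of_nat p ^ ?n else 0)" .
  qed
  \<comment> \<open>After this substitution the condition on the inverse becomes the vanishing of
    the last k - h entries of \<open>lo\<close> itself.\<close>
  also have "\<dots> = (\<Sum>lo\<in>residue_lists p h. f (inverse_list p lo) * (if cond (inverse_list p lo) then of_nat p ^ ?n else 0))"
    by (rule sum.reindex_bij_betw[symmetric], rule bij_betwI[of _ _ _ "inverse_list p"])
      (auto simp: inverse_list_in[OF p0] inverse_list_inverse_list)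
  also have "\<dots> = (\<Sum>lo\<in>residue_lists p (2 * h - k + ?n). cnj (f lo) * (if drop (2 * h - k) lo = replicate ?n 0 then of_nat p ^ ?n else 0))"
  proof (rule sum.cong)
    show "residue_lists p h = residue_lists p (2 * h - k + ?n)" using k by simp
    fix lo assume "lo \<in> residue_lists p (2 * h - k + ?n)"
    then have lo: "lo \<in> residue_lists p h" using k by simp
    have len: "length lo = h" using lo by (rule residue_lists_length)
    have "f (inverse_list p lo) = cnj (f lo)"
      unfolding f_def cnj_add_char by (rule add_char_eqI) (use pw_inverse_list[OF p len] in simp)
    moreover have "cond (inverse_list p lo) \<longleftrightarrow> drop (2 * h - k) lo = replicate ?n 0"
    proof -
      have nth: "int p dvd fps_nth (list_fps_inverse (inverse_list p lo)) (h - j) \<longleftrightarrow> lo ! (h - j - 1) = 0" if j: "j < ?n" for j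
      proof -
        have i: "h - j = Suc (h - j - 1)" "h - j - 1 < h" using j k by auto
        have "lo ! (h - j - 1) = inverse_list p (inverse_list p lo) ! (h - j - 1)"
          using inverse_list_inverse_list[OF lo] by simp
        also have "\<dots> = fps_nth (list_fps_inverse (inverse_list p lo)) (h - j) mod int p"
          using i len by (simp add: inverse_list_def[of p "inverse_list p lo"])
        finally show ?thesis by (simp add: dvd_eq_mod_eq_0)
      qed
      have "drop (2 * h - k) lo = replicate ?n 0 \<longleftrightarrow> (\<forall>i<?n. lo ! (2 * h - k + i) = 0)"
        using len k by (auto simp: list_eq_iff_nth_eq)
      also have "\<dots> \<longleftrightarrow> (\<forall>j<?n. lo ! (h - j - 1) = 0)"
      proof (intro iffI allI impI)
        fix j assume *: "\<forall>i<?n. lo ! (2 * h - k + i) = 0" and j: "j < ?n"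
        have "2 * h - k + (?n - 1 - j) = h - j - 1" "?n - 1 - j < ?n" using j k by auto
        with * show "lo ! (h - j - 1) = 0" by metis
      next
        fix i assume *: "\<forall>j<?n. lo ! (h - j - 1) = 0" and i: "i < ?n"
        have "h - (?n - 1 - i) - 1 = 2 * h - k + i" "?n - 1 - i < ?n" using i k by auto
        with * show "lo ! (2 * h - k + i) = 0" by metis
      qed
      finally show ?thesis unfolding cond_def using nth by blast
    qed
    ultimately show "f (inverse_list p lo) * (if cond (inverse_list p lo) then of_nat p ^ ?n else 0) =
      cnj (f lo) * (if drop (2 * h - k) lo = replicate ?n 0 then of_nat p ^ ?n else 0)" by simp
  qed
  also have "\<dots> = (\<Sum>lo\<in>residue_lists p (2 * h - k). \<Sum>hi\<in>residue_lists p ?n.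
      if hi = replicate ?n 0 then cnj (f (lo @ hi)) * of_nat p ^ ?n else 0)"
    unfolding sum_residue_lists_add by (intro sum.cong refl) (auto dest: residue_lists_length)
  also have "\<dots> = (\<Sum>lo\<in>residue_lists p (2 * h - k). cnj (f lo) * of_nat p ^ ?n)"
  proof (rule sum.cong[OF refl])
    fix lo :: "int list"
    have "list_fps (lo @ replicate ?n 0) = list_fps lo"
      by (intro fps_ext) (auto simp: list_fps_nth nth_append)
    moreover have "replicate ?n 0 \<in> residue_lists p ?n" using p0 by (auto simp: residue_lists_def)
    ultimately show "(\<Sum>hi\<in>residue_lists p ?n. if hi = replicate ?n 0 then cnj (f (lo @ hi)) * of_nat p ^ ?n else 0)
        = cnj (f lo) * of_nat p ^ ?n" by (simp add: sum.delta f_def)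
  qed
  also have "\<dots> = of_nat p ^ ?n * cnj (power_char_sum p ?d (2 * h - k))"
    unfolding power_char_sum_def f_def[symmetric] cnj_sum sum_distrib_left by (intro sum.cong refl mult.commute)
  finally show ?thesis .
qed

text \<open>For k < h this is the upper half with k and 2 h - k exchanged; the powers of
  \<open>p\<close> on both sides give a form without division.\<close>

lemma power_char_sum_functional_equation:
  assumes p: "prime p" and pd: "\<not> p dvd 2 * h + 1" and k: "k \<le> 2 * h"
  shows "of_nat p ^ h * power_char_sum p (2 * h + 1) k = of_nat p ^ k * cnj (power_char_sum p (2 * h + 1) (2 * h - k))"
proof (cases "h \<le> k")
  case True
  have "of_nat p ^ h * of_nat p ^ (k - h) = (of_nat p ^ k :: complex)" using True by (simp flip: power_add)
  then show ?thesis unfolding power_char_sum_upper_half[OF p pd True k] mult.assoc[symmetric] by simp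
next
  case False
  have "2 * h - k - h = h - k" "2 * h - (2 * h - k) = k" using k by simp_all
  then have "power_char_sum p (2 * h + 1) (2 * h - k) = of_nat p ^ (h - k) * cnj (power_char_sum p (2 * h + 1) k)"
    using power_char_sum_upper_half[OF p pd, of "2 * h - k"] False by simp
  then have "of_nat p ^ k * cnj (power_char_sum p (2 * h + 1) (2 * h - k)) =
      (of_nat p ^ k * of_nat p ^ (h - k)) * power_char_sum p (2 * h + 1) k" by simp
  also have "of_nat p ^ k * of_nat p ^ (h - k) = (of_nat p ^ h :: complex)" using False by (simp flip: power_add)
  finally show ?thesis by simp
qed

section \<open>Transforming the roots of integer polynomials\<close>

text \<open>The reciprocal polynomial of \<open>list_fps es\<close>: the reciprocal roots there are
  the roots here, so that they become eigenvalues.\<close>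

definition monic_poly_of :: "int list \<Rightarrow> int poly" where
  "monic_poly_of es = Poly (rev (1 # es))"

lemma coeff_monic_poly_of:
  "poly.coeff (monic_poly_of es) i = (if i \<le> length es then (1 # es) ! (length es - i) else 0)"
  unfolding monic_poly_of_def coeff_Poly nth_default_def rev_nth
  by (cases "i \<le> length es") (auto simp: rev_nth nth_append)

lemma degree_monic_poly_of: "Polynomial.degree (monic_poly_of es) = length es"
proof (rule antisym)
  show "Polynomial.degree (monic_poly_of es) \<le> length es" by (rule degree_le) (simp add: coeff_monic_poly_of)
  show "length es \<le> Polynomial.degree (monic_poly_of es)" by (rule le_degree) (simp add: coeff_monic_poly_of)
qed

lemma ex_monic_poly_of:
  assumes "Polynomial.degree P = k" "poly.coeff P k = 1"
  shows "\<exists>es. length es = k \<and> P = monic_poly_of es"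
proof (intro exI conjI)
  let ?es = "map (\<lambda>i. poly.coeff P (k - 1 - i)) [0..<k]"
  show "P = monic_poly_of ?es"
  proof (rule poly_eqI)
    fix i
    have "k - 1 - (k - i - 1) = i" if "i < k" using that by simp
    then show "poly.coeff P i = poly.coeff (monic_poly_of ?es) i"
      using assms by (auto simp: coeff_monic_poly_of nth_Cons' coeff_eq_0)
  qed
qed simp

lemma root_fps_nth:
  "fps_nth (root_fps xs) n = (if n \<le> length xs then poly.coeff (\<Prod>x\<leftarrow>xs. [:- x, 1:]) (length xs - n) else 0)"
proof (induction xs arbitrary: n)
  case (Cons x xs)
  let ?Q = "\<Prod>x\<leftarrow>xs. [:- x, 1:]" and ?k = "length xs"
  have deg: "Polynomial.degree ?Q = ?k" by (rule degree_linear_factors)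
  have "fps_nth (root_fps (x # xs)) n = fps_nth (root_fps xs) n - x * fps_nth (fps_X * root_fps xs) n"
    by (simp add: left_diff_distrib mult.assoc del: fps_X_mult_nth)
  also have "\<dots> = (if n \<le> Suc ?k then poly.coeff (\<Prod>x\<leftarrow>x # xs. [:- x, 1:]) (Suc ?k - n) else 0)"
  proof (cases n)
    case 0
    then show ?thesis using deg by (simp add: Cons.IH coeff_eq_0)
  next
    case (Suc m)
    show ?thesis
    proof (cases "m < ?k")
      case True
      then have "?k - m = Suc (?k - Suc m)" by simp
      then show ?thesis using True by (simp add: Suc Cons.IH)
    next
      case False
      then show ?thesis by (cases "m = ?k") (simp_all add: Suc Cons.IH)
    qed
  qed
  finally show ?case by simp
qed simp

lemma list_fps_eq_root_fps:
  assumes "map_poly of_int (monic_poly_of es) = (\<Prod>x\<leftarrow>xs. [:- x, 1 :: complex:])"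
  shows "of_int (fps_nth (list_fps es) n) = fps_nth (root_fps xs) n"
proof -
  have "Polynomial.degree (map_poly complex_of_int (monic_poly_of es)) = Polynomial.degree (monic_poly_of es)"
    by (rule degree_map_poly) simp
  then have len: "length xs = length es"
    unfolding assms degree_monic_poly_of degree_linear_factors .
  have "poly.coeff (\<Prod>x\<leftarrow>xs. [:- x, 1:]) i = of_int (poly.coeff (monic_poly_of es) i)" for i
    unfolding assms[symmetric] by (rule coeff_map_poly) simp
  then show ?thesis
    unfolding root_fps_nth len by (auto simp: coeff_monic_poly_of list_fps_nth nth_Cons')
qed

definition companion_mat :: "int list \<Rightarrow> int mat" where
  "companion_mat es = Matrix.mat (length es) (length es)
     (\<lambda>(i, j). if i = 0 then - es ! j else if i = Suc j then 1 else 0)"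

lemma companion_mat_carrier [simp]: "companion_mat es \<in> carrier_mat (length es) (length es)"
  by (simp add: companion_mat_def)

text \<open>Expansion along the last column: its only nonzero entries are the first, which is the
  new coefficient with a triangular minor, and the last, which is X with the smaller companion
  matrix as minor.\<close>

lemma char_poly_companion_mat: "char_poly (companion_mat es) = monic_poly_of es"
proof (induction es rule: rev_induct)
  case Nil
  then show ?case by (simp add: char_poly_def companion_mat_def monic_poly_of_def char_poly_matrix_def det_def)
next
  case (snoc e es)
  let ?n = "length es"
  define A where "A = char_poly_matrix (companion_mat (es @ [e]))"
  have A: "A \<in> carrier_mat (Suc ?n) (Suc ?n)"
    unfolding A_def by (rule char_poly_matrix_closed) (use companion_mat_carrier[of "es @ [e]"] in simp)
  have nth: "A $$ (i, j) = (if i = j then [:0, 1:] else 0) +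
      [: - (if i = 0 then - (es @ [e]) ! j else if i = Suc j then 1 else 0) :]" if "i < Suc ?n" "j < Suc ?n" for i j
    using that unfolding A_def char_poly_matrix_def companion_mat_def by auto
  have del: "mat_delete A ?n ?n = char_poly_matrix (companion_mat es)"
    unfolding mat_delete_def using A
    by (intro eq_matI) (auto simp: nth char_poly_matrix_def companion_mat_def nth_append)
  have c_last: "cofactor A ?n ?n = monic_poly_of es"
    unfolding cofactor_def del snoc.IH[symmetric] char_poly_def by simp
  have mono: "monic_poly_of (es @ [e]) = [:0, 1:] * monic_poly_of es + [:e:]"
    by (simp add: monic_poly_of_def)
  show ?case
  proof (cases "?n = 0")
    case True
    have "det A = (\<Sum>i<Suc ?n. A $$ (i, ?n) * cofactor A i ?n)" by (rule laplace_expansion_column[OF A]) simp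
    also have "\<dots> = A $$ (0, 0) * cofactor A ?n ?n" using True by simp
    also have "\<dots> = monic_poly_of (es @ [e])" unfolding c_last mono using True nth[of 0 0] by (simp add: monic_poly_of_def)
    finally show ?thesis unfolding char_poly_def A_def .
  next
    case False
    have U: "upper_triangular (mat_delete A 0 ?n)"
      unfolding upper_triangular_def mat_delete_def using A by (auto simp: nth nth_append)
    have Uc: "mat_delete A 0 ?n \<in> carrier_mat ?n ?n" using mat_delete_carrier[OF A, of 0 ?n] by simp
    have "diag_mat (mat_delete A 0 ?n) = replicate ?n (- 1)"
      unfolding diag_mat_def mat_delete_def using A
      by (intro nth_equalityI) (auto simp: nth one_pCons)
    then have "det (mat_delete A 0 ?n) = (- 1) ^ ?n"
      using det_upper_triangular[OF U Uc] by (simp add: prod_list_replicate)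
    then have c_first: "cofactor A 0 ?n = 1"
      unfolding cofactor_def by (simp flip: power_add mult_2)
    have "det A = (\<Sum>i<Suc ?n. A $$ (i, ?n) * cofactor A i ?n)" by (rule laplace_expansion_column[OF A]) simp
    also have "\<dots> = (\<Sum>i\<in>{0, ?n}. A $$ (i, ?n) * cofactor A i ?n)"
      by (rule sum.mono_neutral_right) (auto simp: nth)
    also have "\<dots> = A $$ (0, ?n) * cofactor A 0 ?n + A $$ (?n, ?n) * cofactor A ?n ?n" using False by simp
    also have "\<dots> = monic_poly_of (es @ [e])"
      unfolding c_first c_last mono using False by (simp add: nth)
    finally show ?thesis unfolding char_poly_def A_def .
  qed
qed

lemma upper_triangular_mult_diag:
  fixes A B :: "'a :: comm_ring_1 mat"
  assumes A: "A \<in> carrier_mat n n" "upper_triangular A" and B: "B \<in> carrier_mat n n" "upper_triangular B"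
  shows "upper_triangular (A * B)" and "i < n \<Longrightarrow> (A * B) $$ (i, i) = A $$ (i, i) * B $$ (i, i)"
proof -
  have z: "A $$ (i, j) = 0" "B $$ (i, j) = 0" if "i < n" "j < i" for i j
    using A B that by (auto simp: upper_triangular_def)
  have nth: "(A * B) $$ (i, j) = (\<Sum>l<n. A $$ (i, l) * B $$ (l, j))" if "i < n" "j < n" for i j
    using A B that by (simp add: times_mat_def scalar_prod_def lessThan_atLeast0)
  show "upper_triangular (A * B)"
    unfolding upper_triangular_def
  proof (intro allI impI)
    fix i j assume "i < dim_row (A * B)" "j < i"
    then have i: "i < n" "j < n" "j < i" using A by auto
    show "(A * B) $$ (i, j) = 0"
      unfolding nth[OF i(1,2)]
    proof (rule sum.neutral, rule ballI)
      fix l assume "l \<in> {..<n}"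
      then show "A $$ (i, l) * B $$ (l, j) = 0" using z[of i l] z[of l j] i by (cases "l < i") auto
    qed
  qed
  show "(A * B) $$ (i, i) = A $$ (i, i) * B $$ (i, i)" if i: "i < n"
  proof -
    have "(A * B) $$ (i, i) = (\<Sum>l\<in>{i}. A $$ (i, l) * B $$ (l, i))"
      unfolding nth[OF i i]
    proof (rule sum.mono_neutral_right)
      show "\<forall>l\<in>{..<n} - {i}. A $$ (i, l) * B $$ (l, i) = 0"
      proof
        fix l assume "l \<in> {..<n} - {i}"
        then show "A $$ (i, l) * B $$ (l, i) = 0" using z[of i l] z[of l i] i by (cases "l < i") auto
      qed
    qed (use i in auto)
    then show ?thesis by simp
  qed
qed

lemma upper_triangular_pow_diag:
  fixes A :: "'a :: comm_ring_1 mat"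
  assumes A: "A \<in> carrier_mat n n" "upper_triangular A"
  shows "upper_triangular (A ^\<^sub>m t) \<and> (\<forall>i<n. (A ^\<^sub>m t) $$ (i, i) = A $$ (i, i) ^ t)"
proof (induction t)
  case 0
  then show ?case using A by (auto simp: upper_triangular_def)
next
  case (Suc t)
  have "A ^\<^sub>m t \<in> carrier_mat n n" using A by simp
  then show ?case using Suc upper_triangular_mult_diag[OF _ _ A, of "A ^\<^sub>m t"] by simp
qed

text \<open>The witness is the characteristic polynomial of the \<open>t\<close>-th power of the companion matrix.\<close>

lemma power_roots_integral:
  assumes xs: "char_poly (map_mat complex_of_int (companion_mat es)) = (\<Prod>x\<leftarrow>xs. [:- x, 1:])"
  shows "\<exists>es'. length es' = length es \<and>
    map_poly of_int (monic_poly_of es') = (\<Prod>x\<leftarrow>xs. [:- (x ^ t), 1:])"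
proof -
  let ?n = "length es" and ?A = "map_mat complex_of_int (companion_mat es)"
  interpret of_int_hom: comm_ring_hom complex_of_int by unfold_locales auto
  have A: "?A \<in> carrier_mat ?n ?n" by simp
  \<comment> \<open>A triangular form with diagonal \<open>xs\<close>: taking powers keeps the
    similarity and raises the diagonal entries, so the eigenvalues of the power are found with
    multiplicities.\<close>
  obtain B P Q where schur: "schur_decomposition ?A xs = (B, P, Q)" by (cases "schur_decomposition ?A xs")
  note S = schur_decomposition[OF A xs schur]
  then have sim: "similar_mat_wit ?A B P Q" and B: "upper_triangular B" "diag_mat B = xs" by auto
  have carr: "B \<in> carrier_mat ?n ?n" by (rule similar_mat_witD2(5)[OF A sim])
  have "similar_mat_wit (?A ^\<^sub>m t) (B ^\<^sub>m t) P Q" by (rule similar_mat_wit_pow[OF sim])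
  then have "char_poly (?A ^\<^sub>m t) = char_poly (B ^\<^sub>m t)"
    by (intro char_poly_similar) (auto simp: similar_mat_def)
  also have "\<dots> = (\<Prod>a\<leftarrow>diag_mat (B ^\<^sub>m t). [:- a, 1:])"
    by (rule char_poly_upper_triangular[of _ ?n]) (simp_all add: carr upper_triangular_pow_diag[OF carr B(1)])
  also have "diag_mat (B ^\<^sub>m t) = map (\<lambda>x. x ^ t) xs"
  proof -
    have "diag_mat (B ^\<^sub>m t) = map (\<lambda>i. B $$ (i, i) ^ t) [0..<?n]"
      unfolding diag_mat_def using upper_triangular_pow_diag[OF carr B(1)] carr by auto
    also have "\<dots> = map (\<lambda>x. x ^ t) (diag_mat B)" using carr by (simp add: diag_mat_def)
    finally show ?thesis unfolding B(2) .
  qed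
  also have "(\<Prod>a\<leftarrow>map (\<lambda>x. x ^ t) xs. [:- a, 1:]) = (\<Prod>x\<leftarrow>xs. [:- (x ^ t), 1:])"
    by (simp add: o_def)
  finally have 1: "char_poly (?A ^\<^sub>m t) = (\<Prod>x\<leftarrow>xs. [:- (x ^ t), 1:])" .
  have pow: "companion_mat es ^\<^sub>m t \<in> carrier_mat ?n ?n" by simp
  have "?A ^\<^sub>m t = map_mat complex_of_int (companion_mat es ^\<^sub>m t)"
    by (rule of_int_hom.mat_hom_pow[symmetric, of _ ?n]) simp
  then have 2: "char_poly (?A ^\<^sub>m t) = map_poly of_int (char_poly (companion_mat es ^\<^sub>m t))"
    by (simp add: of_int_hom.char_poly_hom[OF pow])
  obtain es' where es': "length es' = ?n" "char_poly (companion_mat es ^\<^sub>m t) = monic_poly_of es'"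
    using ex_monic_poly_of[OF degree_monic_char_poly[OF pow, THEN conjunct1] degree_monic_char_poly[OF pow, THEN conjunct2]]
    by blast
  have "map_poly of_int (monic_poly_of es') = (\<Prod>x\<leftarrow>xs. [:- (x ^ t), 1 :: complex:])"
    unfolding es'(2)[symmetric] by (rule trans[OF sym[OF 2] 1])
  with es'(1) show ?thesis by blast
qed

text \<open>One and the same list of complex roots has to serve the polynomial and all its
  transforms, hence the joint statement. Powers of the roots come from powers of the companion
  matrix, translates from substituting X - s; both keep the coefficients integral.\<close>

lemma ex_integer_roots:
  obtains xs where "length xs = length es"
    and "\<And>n. of_int (fps_nth (list_fps es) n) = fps_nth (root_fps xs) n"
    and "\<And>t. \<exists>es'. length es' = length es \<and> (\<forall>n. of_int (fps_nth (list_fps es') n) = fps_nth (root_fps (map (\<lambda>x. x ^ t) xs)) n)"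
    and "\<And>s :: int. \<exists>es'. length es' = length es \<and> (\<forall>n. of_int (fps_nth (list_fps es') n) = fps_nth (root_fps (map (\<lambda>x. x + of_int s) xs)) n)"
proof -
  interpret of_int_hom: comm_ring_hom complex_of_int by unfold_locales auto
  let ?A = "map_mat complex_of_int (companion_mat es)"
  have A: "?A \<in> carrier_mat (length es) (length es)" by simp
  obtain xs where xs: "char_poly ?A = (\<Prod>x\<leftarrow>xs. [:- x, 1:])" "length xs = length es"
    using char_poly_factorized[OF A] by blast
  have fac: "map_poly of_int (monic_poly_of es) = (\<Prod>x\<leftarrow>xs. [:- x, 1 :: complex:])"
    using trans[OF sym[OF of_int_hom.char_poly_hom[OF companion_mat_carrier[of es]]] xs(1)]
    unfolding char_poly_companion_mat .
  show ?thesis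
  proof (rule that[OF xs(2) list_fps_eq_root_fps[OF fac]])
    fix t
    obtain es' where "length es' = length es" "map_poly of_int (monic_poly_of es') = (\<Prod>x\<leftarrow>xs. [:- (x ^ t), 1 :: complex:])"
      using power_roots_integral[OF xs(1), of t] by blast
    moreover have "(\<Prod>x\<leftarrow>xs. [:- (x ^ t), 1:]) = (\<Prod>x\<leftarrow>map (\<lambda>x. x ^ t) xs. [:- x, 1 :: complex:])" by (simp add: o_def)
    ultimately show "\<exists>es'. length es' = length es \<and> (\<forall>n. of_int (fps_nth (list_fps es') n) = fps_nth (root_fps (map (\<lambda>x. x ^ t) xs)) n)"
      using list_fps_eq_root_fps[of es' "map (\<lambda>x. x ^ t) xs"] by auto
  next
    fix s :: int
    let ?P = "pcompose (monic_poly_of es) [:- s, 1:]"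
    have deg: "Polynomial.degree ?P = length es" by (simp add: degree_pcompose degree_monic_poly_of)
    moreover have "poly.coeff ?P (length es) = 1"
      using lead_coeff_comp[of "[:- s, 1:]" "monic_poly_of es"] unfolding deg
      by (simp add: degree_monic_poly_of coeff_monic_poly_of)
    ultimately obtain es' where es': "length es' = length es" "?P = monic_poly_of es'"
      using ex_monic_poly_of[of ?P "length es"] by auto
    have "map_poly of_int ?P = pcompose (\<Prod>x\<leftarrow>xs. [:- x, 1:]) [:- of_int s, 1 :: complex:]"
      unfolding fac[symmetric] by (simp add: of_int_hom.map_poly_pcompose)
    also have "\<dots> = (\<Prod>x\<leftarrow>xs. [:- (x + of_int s), 1:])"
    proof (induction xs)
      case (Cons a xs)
      have "pcompose [:- a, 1:] [:- complex_of_int s, 1:] = [:- (a + of_int s), 1:]" by (simp add: pcompose_pCons)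
      then show ?case unfolding list.map prod_list.Cons pcompose_mult Cons.IH by (rule arg_cong)
    qed simp
    also have "\<dots> = (\<Prod>x\<leftarrow>map (\<lambda>x. x + of_int s) xs. [:- x, 1 :: complex:])" by (simp add: o_def)
    finally have "map_poly of_int (monic_poly_of es') = (\<Prod>x\<leftarrow>map (\<lambda>x. x + of_int s) xs. [:- x, 1 :: complex:])"
      unfolding es'(2) .
    then show "\<exists>es'. length es' = length es \<and> (\<forall>n. of_int (fps_nth (list_fps es') n) = fps_nth (root_fps (map (\<lambda>x. x + of_int s) xs)) n)"
      using es'(1) list_fps_eq_root_fps[of es' "map (\<lambda>x. x + of_int s) xs"] by auto
  qed
qed

section \<open>The power of 3 in p^d - 1 and the common exponent\<close>

lemma power_two_three_pow:
  fixes g :: int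
  assumes "g mod 9 = 2 \<or> g mod 9 = 5"
  shows "\<exists>u. g ^ (2 * 3 ^ j) = 1 + 3 ^ (j + 1) * u \<and> \<not> 3 dvd u"
proof (induction j)
  case 0
  define k where "k = g div 9"
  have "g = 9 * k + 2 \<or> g = 9 * k + 5" 
    using assms minus_mod_eq_mult_div[of g 9] unfolding k_def by (elim disjE) (rule disjI1, linarith, rule disjI2, linarith)
  then show ?case
  proof
    assume g: "g = 9 * k + 2"
    have "g ^ (2 * 3 ^ 0) = 1 + 3 ^ (0 + 1) * (3 * (9 * k\<^sup>2 + 4 * k) + 1)" by (simp add: g power2_eq_square algebra_simps)
    moreover have "\<not> 3 dvd 3 * (9 * k\<^sup>2 + 4 * k) + 1" by presburger
    ultimately show ?thesis by blast
  next
    assume g: "g = 9 * k + 5"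
    have "g ^ (2 * 3 ^ 0) = 1 + 3 ^ (0 + 1) * (3 * (9 * k\<^sup>2 + 10 * k + 2) + 2)" by (simp add: g power2_eq_square algebra_simps)
    moreover have "\<not> 3 dvd 3 * (9 * k\<^sup>2 + 10 * k + 2) + 2" by presburger
    ultimately show ?thesis by blast
  qed
next
  case (Suc j)
  then obtain u where u: "g ^ (2 * 3 ^ j) = 1 + 3 ^ (j + 1) * u" "\<not> 3 dvd u" by blast
  define b :: int where "b = 3 ^ j"
  let ?w = "3 * (b * u\<^sup>2 + b\<^sup>2 * u ^ 3)"
  \<comment> \<open>Cubing raises the exact power of 3 by one, since in (1 + 3 b u)^3 the terms
    after 9 b u carry a further factor 3.\<close>
  have "g ^ (2 * 3 ^ Suc j) = (g ^ (2 * 3 ^ j)) ^ 3" unfolding power_mult[symmetric] by (simp add: mult_ac)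
  also have "\<dots> = (1 + 3 * b * u) ^ 3" unfolding u b_def by simp
  also have "\<dots> = 1 + 9 * b * (u + ?w)" by (simp add: power2_eq_square power3_eq_cube algebra_simps)
  also have "9 * b = 3 ^ (Suc j + 1)" by (simp add: b_def)
  finally have "g ^ (2 * 3 ^ Suc j) = 1 + 3 ^ (Suc j + 1) * (u + ?w)" .
  moreover have "\<not> 3 dvd u + ?w" using u(2) by (simp add: dvd_add_left_iff)
  ultimately show ?case by blast
qed

text \<open>The order of \<open>p\<close> modulo 3 ^ a is 2 * 3 ^ (a - 1): it is even because
  \<open>p\<close> is -1 modulo 3, and divides the totient, so it is 2 * 3 ^ i; a smaller i
  contradicts the exact power of 3 in p ^ (2 * 3 ^ i) - 1.\<close>

lemma three_power_not_dvd_power_minus_1: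
  assumes p: "p mod 9 = 2 \<or> p mod 9 = 5" and a: "a \<ge> 1" and d: "0 < d" "d < 2 * 3 ^ (a - 1)"
  shows "\<not> 3 ^ a dvd (p ^ d - 1 :: nat)"
proof
  assume dvd: "3 ^ a dvd p ^ d - 1"
  have p0: "p > 0" using p by (auto intro!: gr0I)
  then have "p ^ d \<ge> 1" by simp
  have pd: "[p ^ d = 1] (mod 3 ^ a)" using dvd \<open>p ^ d \<ge> 1\<close> mod_eq_dvd_iff_nat[of 1 "p ^ d" "3 ^ a"] unfolding cong_def by blast
  define o' where "o' = ord (3 ^ a) p"
  have od: "o' dvd d" using pd unfolding o'_def ord_divides .
  have pm3: "p mod 3 = 2"
  proof -
    have "p mod 3 = p mod 9 mod 3" by (simp add: mod_mod_cancel)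
    then show ?thesis using p by auto
  qed
  have ev: "even o'"
  proof (rule ccontr)
    assume "odd o'"
    then obtain j where j: "o' = 2 * j + 1" by (auto elim: oddE)
    have "[p ^ o' = 1] (mod 3 ^ a)" unfolding o'_def by (rule ord)
    then have "[p ^ o' = 1] (mod 3)" using a cong_dvd_modulus_nat[of "p ^ o'" 1 "3 ^ a" 3] by (simp add: dvd_power)
    moreover have "[p ^ o' = 2 ^ o'] (mod 3)" by (rule cong_pow) (simp add: cong_def pm3)
    moreover have "[2 ^ o' = (4 ^ j * 2 :: nat)] (mod 3)" 
    proof -
      have "(2::nat) ^ o' = 4 ^ j * 2" unfolding j power_add power_mult by simp
      then show ?thesis by (simp only: cong_refl)
    qed
    moreover have "[4 ^ j * 2 = 1 ^ j * (2 :: nat)] (mod 3)" by (intro cong_mult cong_pow) (simp_all add: cong_def)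
    ultimately have "[1 = (2::nat)] (mod 3)" using cong_sym cong_trans by (metis power_one mult_1)
    then show False by (simp add: cong_def)
  qed
  have copr: "coprime p (3 ^ a)"
  proof -
    have "\<not> 3 dvd p" using pm3 by presburger
    then show ?thesis using prime_imp_coprime[of 3 p] by (simp add: coprime_commute)
  qed
  have "o' dvd totient (3 ^ a)" unfolding o'_def by (rule order_divides_totient) (use copr in \<open>simp add: coprime_commute\<close>)
  also have "totient (3 ^ a) = 2 * 3 ^ (a - 1)" using a by (subst totient_prime_power) simp_all
  finally have o1: "o' dvd 2 * 3 ^ (a - 1)" .
  obtain o2 where o2: "o' = 2 * o2" using ev by (auto elim: evenE)
  then have "o2 dvd 3 ^ (a - 1)" using o1 by simp
  then obtain i where i: "i \<le> a - 1" "o2 = 3 ^ i" using divides_primepow_nat[of 3 o2 "a - 1"] by auto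
  have "o' \<le> d" using od d by (simp add: dvd_imp_le)
  then have "i \<noteq> a - 1" using d o2 i by auto
  then have i': "i + 2 \<le> a" using i by simp
  have "[p ^ o' = 1] (mod 3 ^ a)" unfolding o'_def by (rule ord)
  then have "[int p ^ (2 * 3 ^ i) = 1] (mod 3 ^ a)"
    using cong_int_iff[of "p ^ o'" 1 "3 ^ a"] by (simp add: o2 i)
  then have c: "3 ^ a dvd int p ^ (2 * 3 ^ i) - 1" by (simp add: cong_iff_dvd_diff)
  have "int p mod 9 = 2 \<or> int p mod 9 = 5" using p by (metis of_nat_mod of_nat_numeral)
  from power_two_three_pow[OF this, of i] obtain u
    where u: "int p ^ (2 * 3 ^ i) = 1 + 3 ^ (i + 1) * u" "\<not> 3 dvd u" by blast
  have "(3 :: int) ^ (i + 1) * 3 dvd 3 ^ a" using le_imp_power_dvd[OF i', of "3 :: int"] by simp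
  then have "(3 :: int) ^ (i + 1) * 3 dvd 3 ^ (i + 1) * u" 
    using c unfolding u(1) add_diff_cancel_left' by (rule dvd_trans)
  moreover have nz: "(3 :: int) ^ (i + 1) \<noteq> 0" by simp
  ultimately show False using u(2) unfolding dvd_times_left_cancel_iff[OF nz] by blast
qed

text \<open>With \<open>Q\<close> the prime-to-3 part of the product of the p ^ d - 1, the exponent
  is E = 3 ^ (a - 1) * Q. A unit \<open>t\<close> that is 3 modulo Q and 1 modulo 3 carries 3 ^ (a -
  1) to 3 ^ a, because after multiplication by 3 ^ (a - 1) only its residue modulo Q
  matters.\<close>

lemma ex_exponent:
  assumes p: "prime p" "p mod 9 = 2 \<or> p mod 9 = 5" and a: "a \<ge> 1" and k: "k < 2 * 3 ^ (a - 1)"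
  shows "\<exists>E t t'. E > 0 \<and> (\<forall>d. 0 < d \<and> d \<le> k \<longrightarrow> p ^ d - 1 dvd E) \<and>
    [3 ^ (a - 1) * t = 3 ^ a] (mod E) \<and> [t * t' = 1] (mod E) \<and> t > 0 \<and> t' > (0 :: nat)"
proof -
  define m where "m = (\<Prod>d\<in>{1..k}. p ^ d - 1)"
  have p1: "p ^ d > 1" if "d > 0" for d by (rule one_less_power[OF prime_gt_1_nat[OF p(1)] that])
  have "p ^ d - 1 \<noteq> 0" if "d \<in> {1..k}" for d using p1[of d] that by simp
  then have m0: "m \<noteq> 0" unfolding m_def by (subst prod_zero_iff) auto
  obtain Q where Q: "m = 3 ^ multiplicity 3 m * Q" "\<not> 3 dvd Q"
    using multiplicity_decompose'[of m 3] m0 by auto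
  define E where "E = 3 ^ (a - 1) * Q"
  have Q0: "Q > 0" using Q(2) by (auto intro!: gr0I)
  have cop3: "coprime 3 Q" using Q(2) prime_imp_coprime[of 3 Q] by simp
  have dvdE: "p ^ d - 1 dvd E" if d: "0 < d" "d \<le> k" for d
  proof -
    have n0: "p ^ d - 1 \<noteq> 0" using p1[OF d(1)] by simp
    obtain r where r: "p ^ d - 1 = 3 ^ multiplicity 3 (p ^ d - 1) * r" "\<not> 3 dvd r"
      using multiplicity_decompose'[of "p ^ d - 1" 3] n0 by auto
    let ?i = "multiplicity 3 (p ^ d - 1)"
    have "\<not> a \<le> ?i"
    proof
      assume "a \<le> ?i"
      then have "3 ^ a dvd p ^ d - 1" by (rule multiplicity_dvd')
      then show False using three_power_not_dvd_power_minus_1[OF p(2) a d(1)] d k by simp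
    qed
    then have "(3::nat) ^ ?i dvd 3 ^ (a - 1)" by (intro le_imp_power_dvd) simp
    moreover have "r dvd Q"
    proof -
      have "p ^ d - 1 dvd m" unfolding m_def using d by (intro dvd_prodI) auto
      then have "r dvd 3 ^ multiplicity 3 m * Q" using r(1) Q(1) by (metis dvd_mult_right)
      moreover have "coprime r (3 ^ multiplicity 3 m)"
        using r(2) prime_imp_coprime[of 3 r] by (simp add: coprime_commute)
      ultimately show ?thesis by (simp add: coprime_dvd_mult_right_iff)
    qed
    ultimately have "3 ^ ?i * r dvd E" unfolding E_def by (rule mult_dvd_mono)
    then show ?thesis using r(1) by simp
  qed
  obtain t where t: "[t = 3] (mod Q)" "[t = 1] (mod 3)"
    using binary_chinese_remainder_nat[of Q 3 3 1] cop3 by (auto simp: coprime_commute)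
  have "coprime t Q" using cong_imp_coprime[OF cong_sym[OF t(1)]] cop3 by simp
  moreover have "coprime t (3 ^ (a - 1))" using cong_imp_coprime[OF cong_sym[OF t(2)]] by simp
  ultimately have "coprime t E" unfolding E_def by simp
  then obtain t' where t': "[t * t' = Suc 0] (mod E)" using cong_solve_coprime_nat by blast
  have E0: "E > 0" using Q0 by (simp add: E_def)
  \<comment> \<open>Adding \<open>E\<close> makes the inverse positive; power sums are periodic only
    from index 1 on.\<close>
  have "[t * (t' + E) = 1] (mod E)" using t' by (simp add: distrib_left cong_def)
  moreover have "[3 ^ (a - 1) * t = 3 ^ a] (mod E)"
  proof -
    have "[3 ^ (a - 1) * t = 3 ^ (a - 1) * 3] (mod 3 ^ (a - 1) * Q)"
      using t(1) by (simp add: cong_def mod_mult_mult1)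
    moreover have "(3::nat) ^ (a - 1) * 3 = 3 ^ a" using a power_Suc2[of "3::nat" "a - 1"] by simp
    ultimately show ?thesis unfolding E_def by simp
  qed
  moreover have "t > 0" using t(2) by (auto intro!: gr0I simp: cong_def)
  ultimately show ?thesis using E0 dvdE by (intro exI[of _ E] exI[of _ t] exI[of _ "t' + E"]) simp
qed

section \<open>Permuting coefficient lists by powers and translates of the roots\<close>

lemma sum_residue_lists_correspondence:
  fixes f g :: "int list \<Rightarrow> complex"
  assumes ex: "\<And>es. es \<in> residue_lists p k \<Longrightarrow> \<exists>es'\<in>residue_lists p k. Rel es es'"
    and inj: "\<And>es1 es2 es'. \<lbrakk>es1 \<in> residue_lists p k; es2 \<in> residue_lists p k; es' \<in> residue_lists p k; Rel es1 es'; Rel es2 es'\<rbrakk> \<Longrightarrow> es1 = es2"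
    and eq: "\<And>es es'. \<lbrakk>es \<in> residue_lists p k; es' \<in> residue_lists p k; Rel es es'\<rbrakk> \<Longrightarrow> f es' = g es"
  shows "sum f (residue_lists p k) = sum g (residue_lists p k)"
proof -
  \<comment> \<open>A root transformation is only known to supply some related list. Choosing one
    gives an injective self-map of a finite set, hence a permutation.\<close>
  obtain T where T: "\<And>es. es \<in> residue_lists p k \<Longrightarrow> T es \<in> residue_lists p k \<and> Rel es (T es)"
    using ex by metis
  have inj_T: "inj_on T (residue_lists p k)"
  proof (rule inj_onI)
    fix x y assume h: "x \<in> residue_lists p k" "y \<in> residue_lists p k" "T x = T y"
    show "x = y" using inj[OF h(1,2), of "T x"] T[OF h(1)] T[OF h(2)] h(3) by simp
  qed
  moreover have "T ` residue_lists p k = residue_lists p k"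
    by (rule endo_inj_surj) (use inj_T T in auto)
  ultimately have "bij_betw T (residue_lists p k) (residue_lists p k)" by (simp add: bij_betw_def)
  then have "sum f (residue_lists p k) = (\<Sum>es\<in>residue_lists p k. f (T es))" by (rule sum.reindex_bij_betw[symmetric])
  also have "\<dots> = sum g (residue_lists p k)" by (rule sum.cong) (use eq T in auto)
  finally show ?thesis .
qed

text \<open>Newton's identities: below the characteristic the power sums determine the coefficients.\<close>

lemma residue_lists_eqI:
  assumes p: "prime p" and k: "k < p" and es: "es1 \<in> residue_lists p k" "es2 \<in> residue_lists p k"
    and eq: "\<And>n. n > 0 \<Longrightarrow> int p dvd pw p (list_fps es1) n - pw p (list_fps es2) n"
  shows "es1 = es2"
proof -
  have len: "length es1 = k" "length es2 = k" using es by (auto dest: residue_lists_length)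
  have nth: "fps_nth (list_fps es1) n = fps_nth (list_fps es2) n" if "n \<le> k" for n
    using that
  proof (induction n rule: less_induct)
    case (less n)
    show ?case
    proof (cases "n = 0")
      case False
      let ?x = "fps_nth (list_fps es1) n" and ?y = "fps_nth (list_fps es2) n"
      have "pw p (list_fps es1) n = pw p (list_fps es2) n - int n * (?x - ?y)"
        by (rule pw_update_last) (use less False in \<open>auto simp: list_fps_nth[of _ 0]\<close>)
      then have "int p dvd int n * (?x - ?y)" using eq[of n] False by simp
      moreover have "\<not> int p dvd int n" using less.prems k False by (auto dest: dvd_imp_le)
      moreover have "prime (int p)" using p by simp
      ultimately have "int p dvd ?x - ?y" by (simp add: prime_dvd_mult_iff)
      moreover have "?x \<in> {0..<int p}" "?y \<in> {0..<int p}"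
        using es less.prems False len by (auto simp: residue_lists_def list_fps_nth subset_iff)
      ultimately show ?thesis using mod_eq_dvd_iff[of ?x "int p" ?y] by auto
    qed (simp add: list_fps_nth)
  qed
  show ?thesis
  proof (rule nth_equalityI)
    fix i assume "i < length es1"
    then show "es1 ! i = es2 ! i" using nth[of "Suc i"] len by (simp add: list_fps_nth)
  qed (simp add: len)
qed

lemma residue_list_representative:
  assumes p: "prime p" and len: "length es = k"
  shows "\<exists>es'\<in>residue_lists p k. \<forall>n. int p dvd pw p (list_fps es') n - pw p (list_fps es) n"
proof (intro bexI allI)
  let ?es = "map (\<lambda>x. x mod int p) es"
  show "?es \<in> residue_lists p k" using len p prime_gt_0_nat by (auto simp: residue_lists_def)
  fix n
  have "\<not> int p dvd 1" using p by auto
  then show "int p dvd pw p (list_fps ?es) n - pw p (list_fps es) n"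
    by (intro pw_cong p) (auto simp: fps_const_dvd_iff list_fps_nth mod_eq_dvd_iff[symmetric])
qed

definition power_sums_periodic :: "nat \<Rightarrow> nat \<Rightarrow> nat \<Rightarrow> bool" where
  "power_sums_periodic p k E \<longleftrightarrow> (\<forall>es\<in>residue_lists p k. \<forall>n>0.
     int p dvd pw p (list_fps es) (n + E) - pw p (list_fps es) n)"

lemma power_sums_periodic_cong:
  assumes per: "power_sums_periodic p k E" and es: "es \<in> residue_lists p k"
    and mn: "m > 0" "n > 0" "[m = n] (mod E)"
  shows "int p dvd pw p (list_fps es) m - pw p (list_fps es) n"
proof -
  have step: "int p dvd pw p (list_fps es) (n + j * E) - pw p (list_fps es) n" if "n > 0" for n j
  proof (induction j)
    case (Suc j)
    have "int p dvd pw p (list_fps es) ((n + j * E) + E) - pw p (list_fps es) (n + j * E)"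
      using per es that by (simp add: power_sums_periodic_def)
    from dvd_add[OF this Suc] show ?case by (simp add: add.commute add.left_commute)
  qed simp
  have main: "int p dvd pw p (list_fps es) m - pw p (list_fps es) n" if "n \<le> m" "n > 0" "[m = n] (mod E)" for m n
  proof -
    have "E dvd m - n" using that mod_eq_dvd_iff_nat[of n m E] unfolding cong_def by blast
    then obtain j where "m - n = E * j" by (auto elim: dvdE)
    then have "m = n + j * E" using that by (simp add: mult.commute)
    then show ?thesis using step[OF that(2), of j] by simp
  qed
  show ?thesis
  proof (cases "n \<le> m")
    case True then show ?thesis using main mn by blast
  next
    case False
    then have "int p dvd pw p (list_fps es) n - pw p (list_fps es) m" using main[of m n] mn cong_sym by auto
    then show ?thesis by (simp add: dvd_diff_commute)
  qed
qed

text \<open>Raising the roots to the power \<open>t\<close> turns the d-th power sum into the one of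
  index t * d, congruent to d' modulo the period. It permutes the polynomials because
  \<open>t\<close> is invertible modulo the period.\<close>

lemma power_char_sum_tower:
  assumes p: "prime p" and k: "k < p" and per: "power_sums_periodic p k E"
    and t: "[d * t = d'] (mod E)" "[t * t' = 1] (mod E)" "t > 0" "t' > 0" "d > 0" "d' > 0"
  shows "power_char_sum p d' k = power_char_sum p d k"
proof -
  define Rel where "Rel es es' \<longleftrightarrow> (\<forall>n>0. int p dvd pw p (list_fps es') n - pw p (list_fps es) (t * n))" for es es'
  have "(\<Sum>es\<in>residue_lists p k. add_char p (pw p (list_fps es) d)) = (\<Sum>es\<in>residue_lists p k. add_char p (pw p (list_fps es) d'))"
  proof (rule sum_residue_lists_correspondence[where Rel = Rel])
    fix es assume es: "es \<in> residue_lists p k"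
    obtain xs where xs: "length xs = length es" "\<And>n. of_int (fps_nth (list_fps es) n) = fps_nth (root_fps xs) n"
      "\<And>t. \<exists>es'. length es' = length es \<and> (\<forall>n. of_int (fps_nth (list_fps es') n) = fps_nth (root_fps (map (\<lambda>x. x ^ t) xs)) n)"
      using ex_integer_roots[of es] by metis
    obtain es' where es': "length es' = length es" "\<And>n. of_int (fps_nth (list_fps es') n) = fps_nth (root_fps (map (\<lambda>x. x ^ t) xs)) n"
      using xs(3)[of t] by blast
    obtain es2 where es2: "es2 \<in> residue_lists p k" "\<And>n. int p dvd pw p (list_fps es2) n - pw p (list_fps es') n"
      using residue_list_representative[OF p, of es' k] es' residue_lists_length[OF es] by auto
    have "pw p (list_fps es') n = pw p (list_fps es) (t * n)" if n: "n > 0" for n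
    proof -
      have "complex_of_int (pw p (list_fps es') n) = (\<Sum>x\<leftarrow>map (\<lambda>x. x ^ t) xs. x ^ n)"
        by (rule pw_eq_sum_powers[OF _ es'(2) n]) (simp add: list_fps_nth)
      also have "\<dots> = (\<Sum>x\<leftarrow>xs. x ^ (t * n))" by (simp add: o_def power_mult)
      also have "\<dots> = complex_of_int (pw p (list_fps es) (t * n))"
        by (rule pw_eq_sum_powers[OF _ xs(2), symmetric]) (use n t in \<open>simp_all add: list_fps_nth\<close>)
      finally show ?thesis by simp
    qed
    note key = this
    have "Rel es es2"
      unfolding Rel_def
    proof (intro allI impI)
      fix n :: nat assume "n > 0"
      from es2(2)[of n, unfolded key[OF this]]
      show "int p dvd pw p (list_fps es2) n - pw p (list_fps es) (t * n)" .
    qed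
    then show "\<exists>es'\<in>residue_lists p k. Rel es es'" using es2(1) by blast
  next
    fix es1 es2 es' assume es: "es1 \<in> residue_lists p k" "es2 \<in> residue_lists p k" and R: "Rel es1 es'" "Rel es2 es'"
    show "es1 = es2"
    proof (rule residue_lists_eqI[OF p k es])
      fix n :: nat assume n: "n > 0"
      \<comment> \<open>Reading the common image at index t' * n recovers the n-th power sum of both
        preimages.\<close>
      have c: "[t * (t' * n) = n] (mod E)" using cong_mult[OF t(2) cong_refl[of n]] by (simp add: mult.assoc)
      have pos: "t * (t' * n) > 0" "t' * n > 0" using t n by simp_all
      have 1: "int p dvd pw p (list_fps es1) (t * (t' * n)) - pw p (list_fps es1) n"
        by (rule power_sums_periodic_cong[OF per es(1) pos(1) n c])
      have 2: "int p dvd pw p (list_fps es2) (t * (t' * n)) - pw p (list_fps es2) n"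
        by (rule power_sums_periodic_cong[OF per es(2) pos(1) n c])
      have 3: "int p dvd pw p (list_fps es') (t' * n) - pw p (list_fps es1) (t * (t' * n))"
        using R(1) pos(2) by (simp add: Rel_def)
      have 4: "int p dvd pw p (list_fps es') (t' * n) - pw p (list_fps es2) (t * (t' * n))"
        using R(2) pos(2) by (simp add: Rel_def)
      show "int p dvd pw p (list_fps es1) n - pw p (list_fps es2) n"
        using dvd_diff[OF dvd_add[OF 4 2] dvd_add[OF 3 1]] by simp
    qed
  next
    fix es es' assume es: "es \<in> residue_lists p k" and R: "Rel es es'"
    have 1: "int p dvd pw p (list_fps es') d - pw p (list_fps es) (t * d)" using R t by (simp add: Rel_def)
    have c: "[t * d = d'] (mod E)" using t(1) by (simp add: mult.commute)
    have 2: "int p dvd pw p (list_fps es) (t * d) - pw p (list_fps es) d'"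
      by (rule power_sums_periodic_cong[OF per es _ t(6) c]) (use t in simp)
    show "add_char p (pw p (list_fps es') d) = add_char p (pw p (list_fps es) d')"
      by (rule add_char_eqI) (use dvd_add[OF 1 2] in simp)
  qed
  then show ?thesis by (simp add: power_char_sum_def)
qed

text \<open>The binomial expansion of the d-th power sum of the roots translated by
  \<open>s\<close>, without its term j = 0. That term is s ^ d times the number of roots, zeros
  included: it depends on the bound k for the degree and produces the factor z^k, while the rest
  depends only on the polynomial modulo X^(d+1) and is additive.\<close>

definition shifted_exponent :: "nat \<Rightarrow> nat \<Rightarrow> int \<Rightarrow> int fps \<Rightarrow> int" where
  "shifted_exponent p d s G = (\<Sum>j=1..d. int (d choose j) * s ^ (d - j) * pw p G j)"

text \<open>Translating the reciprocal roots by \<open>s\<close> only multiplies the sums by powers of a root of unity;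
  this is how \<open>L(u)\<close> becomes \<open>L(z u)\<close>.\<close>

lemma shifted_power_char_sum:
  assumes p: "prime p" and k: "k < p" and d: "d > 0"
  shows "(\<Sum>es\<in>residue_lists p k. add_char p (shifted_exponent p d s (list_fps es))) =
    add_char p (- (s ^ d)) ^ k * power_char_sum p d k"
proof -
  define Rel where "Rel es es' \<longleftrightarrow> (\<forall>n>0. int p dvd pw p (list_fps es') n - (shifted_exponent p n s (list_fps es) + int k * s ^ n))" for es es'
  have "(\<Sum>es\<in>residue_lists p k. add_char p (pw p (list_fps es) d)) =
      (\<Sum>es\<in>residue_lists p k. add_char p (shifted_exponent p d s (list_fps es) + int k * s ^ d))"
  proof (rule sum_residue_lists_correspondence[where Rel = Rel])
    fix es assume es: "es \<in> residue_lists p k"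
    have len: "length es = k" using es by (rule residue_lists_length)
    obtain xs where xs: "length xs = length es" "\<And>n. of_int (fps_nth (list_fps es) n) = fps_nth (root_fps xs) n"
      "\<And>s :: int. \<exists>es'. length es' = length es \<and> (\<forall>n. of_int (fps_nth (list_fps es') n) = fps_nth (root_fps (map (\<lambda>x. x + of_int s) xs)) n)"
      using ex_integer_roots[of es] by metis
    obtain es' where es': "length es' = length es" "\<And>n. of_int (fps_nth (list_fps es') n) = fps_nth (root_fps (map (\<lambda>x. x + of_int s) xs)) n"
      using xs(3)[of s] by blast
    obtain es2 where es2: "es2 \<in> residue_lists p k" "\<And>n. int p dvd pw p (list_fps es2) n - pw p (list_fps es') n"
      using residue_list_representative[OF p, of es' k] es' len by auto
    have "pw p (list_fps es') n = shifted_exponent p n s (list_fps es) + int k * s ^ n" if n: "n > 0" for n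
    proof -
      have "complex_of_int (pw p (list_fps es') n) = (\<Sum>x\<leftarrow>map (\<lambda>x. x + of_int s) xs. x ^ n)"
        by (rule pw_eq_sum_powers[OF _ es'(2) n]) (simp add: list_fps_nth)
      also have "\<dots> = (\<Sum>x\<leftarrow>xs. \<Sum>j\<le>n. of_nat (n choose j) * x ^ j * of_int s ^ (n - j))"
        by (simp add: o_def binomial_ring)
      also have "\<dots> = (\<Sum>j\<le>n. of_nat (n choose j) * of_int s ^ (n - j) * (\<Sum>x\<leftarrow>xs. x ^ j))"
      proof (induction xs)
        case (Cons x xs)
        then show ?case by (simp add: distrib_left sum.distrib mult_ac)
      qed simp
      also have "{..n} = insert 0 {1..n}" by auto
      also have "(\<Sum>j\<in>insert 0 {1..n}. of_nat (n choose j) * of_int s ^ (n - j) * (\<Sum>x\<leftarrow>xs. x ^ j)) =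
          of_nat k * of_int s ^ n + (\<Sum>j=1..n. of_nat (n choose j) * of_int s ^ (n - j) * (\<Sum>x\<leftarrow>xs. x ^ j))"
        using xs(1) len by (simp add: sum_list_triv)
      also have "(\<Sum>j=1..n. of_nat (n choose j) * of_int s ^ (n - j) * (\<Sum>x\<leftarrow>xs. x ^ j)) =
          complex_of_int (shifted_exponent p n s (list_fps es))"
      proof -
        have "(\<Sum>x\<leftarrow>xs. x ^ j) = complex_of_int (pw p (list_fps es) j)" if "j \<in> {1..n}" for j
          by (rule pw_eq_sum_powers[OF _ xs(2), symmetric]) (use that in \<open>simp_all add: list_fps_nth\<close>)
        then show ?thesis unfolding shifted_exponent_def by simp
      qed
      also have "of_nat k * of_int s ^ n + complex_of_int (shifted_exponent p n s (list_fps es)) =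
          complex_of_int (shifted_exponent p n s (list_fps es) + int k * s ^ n)" by simp
      finally show ?thesis by (simp only: of_int_eq_iff)
    qed
    note key = this
    have "Rel es es2"
      unfolding Rel_def
    proof (intro allI impI)
      fix n :: nat assume "n > 0"
      from es2(2)[of n, unfolded key[OF this]]
      show "int p dvd pw p (list_fps es2) n - (shifted_exponent p n s (list_fps es) + int k * s ^ n)" .
    qed
    then show "\<exists>es'\<in>residue_lists p k. Rel es es'" using es2(1) by blast
  next
    fix es1 es2 es' assume es: "es1 \<in> residue_lists p k" "es2 \<in> residue_lists p k" and R: "Rel es1 es'" "Rel es2 es'"
    show "es1 = es2"
    proof (rule residue_lists_eqI[OF p k es])
      fix n :: nat assume "n > 0"
      then show "int p dvd pw p (list_fps es1) n - pw p (list_fps es2) n"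
      \<comment> \<open>The binomial system is triangular with diagonal entries 1, so equal
        translated power sums force equal power sums.\<close>
      proof (induction n rule: less_induct)
        case (less n)
        let ?y = "\<lambda>j. pw p (list_fps es1) j - pw p (list_fps es2) j"
        have R1: "int p dvd pw p (list_fps es') n - (shifted_exponent p n s (list_fps es1) + int k * s ^ n)"
          and R2: "int p dvd pw p (list_fps es') n - (shifted_exponent p n s (list_fps es2) + int k * s ^ n)"
          using R less.prems by (auto simp: Rel_def)
        have "int p dvd shifted_exponent p n s (list_fps es1) - shifted_exponent p n s (list_fps es2)"
          using dvd_diff[OF R2 R1] by simp
        also have "shifted_exponent p n s (list_fps es1) - shifted_exponent p n s (list_fps es2) =
            (\<Sum>j=1..n. int (n choose j) * s ^ (n - j) * ?y j)"
          unfolding shifted_exponent_def sum_subtractf[symmetric] right_diff_distrib ..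
        also have "{1..n} = insert n {1..<n}" using less.prems by auto
        also have "(\<Sum>j\<in>insert n {1..<n}. int (n choose j) * s ^ (n - j) * ?y j) =
            ?y n + (\<Sum>j\<in>{1..<n}. int (n choose j) * s ^ (n - j) * ?y j)" by simp
        finally have A: "int p dvd ?y n + (\<Sum>j\<in>{1..<n}. int (n choose j) * s ^ (n - j) * ?y j)" .
        have "int p dvd (\<Sum>j\<in>{1..<n}. int (n choose j) * s ^ (n - j) * ?y j)"
          by (intro dvd_sum dvd_mult less.IH) auto
        from dvd_diff[OF A this] show ?case by simp
      qed
    qed
  next
    fix es es' assume "Rel es es'"
    then show "add_char p (pw p (list_fps es') d) = add_char p (shifted_exponent p d s (list_fps es) + int k * s ^ d)"
      using d by (intro add_char_eqI) (simp add: Rel_def)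
  qed
  then have eq: "power_char_sum p d k = (\<Sum>es\<in>residue_lists p k. add_char p (shifted_exponent p d s (list_fps es))) * add_char p (s ^ d) ^ k"
    by (simp add: power_char_sum_def add_char_add add_char_power sum_distrib_right)
  have "add_char p (- (s ^ d)) ^ k * add_char p (s ^ d) ^ k = 1"
    by (simp flip: power_mult_distrib add_char_add)
  then show ?thesis unfolding eq by (simp add: mult.left_commute)
qed

text \<open>From level a to level a + 1 the first two thirds are unchanged, and beyond 3 ^ a they
  vanish. The last third is a copy of the first, scaled by p ^ (3 ^ a); this gives the new
  factor.\<close>

lemma power_char_sum_generating:
  assumes p: "prime p" "p > 3 ^ a" "p > 3"
    and tower: "\<And>b k. 1 \<le> b \<Longrightarrow> b \<le> a \<Longrightarrow> k < 2 * 3 ^ (b - 1) \<Longrightarrow>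
      power_char_sum p (3 ^ b) k = power_char_sum p (3 ^ (b - 1)) k"
  shows "(\<Sum>k<3 ^ a. power_char_sum p (3 ^ a) k * u ^ k) = (\<Prod>i<a. 1 + (of_nat p * u\<^sup>2) ^ (3 ^ i))"
  using p(2) tower
proof (induction a)
  case 0
  have "pw p (list_fps []) 1 = 0"
    using pw_local[of 1 "list_fps []" "fps_const 1" p] pw_const[of p 1 1] by (simp add: list_fps_nth)
  then show ?case by (simp add: power_char_sum_def)
next
  case (Suc a)
  let ?n = "3 ^ a :: nat" and ?B = "\<lambda>b k. power_char_sum p (3 ^ b) k"
  define h where "h = ?n div 2"
  have n: "?n = 2 * h + 1" unfolding h_def by (simp add: odd_two_times_div_two_succ)
  define h' where "h' = 3 * h + 1"
  have n': "3 ^ Suc a = 2 * h' + 1" unfolding h'_def using n by simp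
  have pd: "\<not> p dvd 3 ^ b" for b
  proof
    assume "p dvd 3 ^ b"
    then have "p dvd 3" using p(1) prime_dvd_power by blast
    then show False using p(3) by (auto dest: dvd_imp_le)
  qed
  have p0: "(of_nat p :: complex) \<noteq> 0" using p by auto
  have low: "?B (Suc a) k = ?B a k" if "k < 2 * ?n" for k using Suc.prems(2)[of "Suc a" k] that by simp
  have zero: "?B a k = 0" if "k \<ge> ?n" for k
    by (rule power_char_sum_vanish[OF p(1)]) (use that pd[of a] in auto)
  \<comment> \<open>The functional equation at level a + 1 reflects 2 * ?n + j to 2 * h - j, where
    the levels agree; the one at level a reflects back to j, undoing the conjugation.\<close>
  have high: "?B (Suc a) (2 * ?n + j) = of_nat p ^ ?n * ?B a j" if j: "j < ?n" for j
  proof -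
    have 1: "of_nat p ^ h' * ?B (Suc a) (2 * ?n + j) = of_nat p ^ (2 * ?n + j) * cnj (?B (Suc a) (2 * h - j))"
    proof -
      have "2 * h' - (2 * ?n + j) = 2 * h - j" "2 * ?n + j \<le> 2 * h'" using n j by (simp_all add: h'_def)
      then show ?thesis
        using power_char_sum_functional_equation[OF p(1), of h' "2 * ?n + j"] pd[of "Suc a"] unfolding n' by simp
    qed
    have 2: "of_nat p ^ h * ?B a j = of_nat p ^ j * cnj (?B a (2 * h - j))"
      using power_char_sum_functional_equation[OF p(1), of h j] pd[of a] j unfolding n by simp
    have 3: "?B (Suc a) (2 * h - j) = ?B a (2 * h - j)" by (rule low) (use n in simp)
    have "of_nat p ^ h' * ?B (Suc a) (2 * ?n + j) = of_nat p ^ (2 * ?n) * (of_nat p ^ j * cnj (?B a (2 * h - j)))"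
      unfolding 1 3 by (simp add: power_add)
    also have "\<dots> = of_nat p ^ (2 * ?n + h) * ?B a j" unfolding 2[symmetric] by (simp add: power_add)
    also have "2 * ?n + h = h' + ?n" using n by (simp add: h'_def)
    also have "of_nat p ^ (h' + ?n) * ?B a j = of_nat p ^ h' * (of_nat p ^ ?n * ?B a j)" by (simp add: power_add)
    finally show ?thesis using p0 by simp
  qed
  let ?S = "\<Sum>k<?n. ?B a k * u ^ k"
  have "(\<Sum>k<3 ^ Suc a. ?B (Suc a) k * u ^ k) = (\<Sum>k<2 * ?n. ?B (Suc a) k * u ^ k) + (\<Sum>k\<in>{2 * ?n..<2 * ?n + ?n}. ?B (Suc a) k * u ^ k)"
    by (simp add: lessThan_atLeast0 sum.atLeastLessThan_concat)
  also have "(\<Sum>k<2 * ?n. ?B (Suc a) k * u ^ k) = (\<Sum>k<2 * ?n. ?B a k * u ^ k)" 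
  proof (rule sum.cong[OF refl])
    fix k assume "k \<in> {..<2 * ?n}"
    then have "?B (Suc a) k = ?B a k" by (intro low) simp
    then show "?B (Suc a) k * u ^ k = ?B a k * u ^ k" by (rule arg_cong)
  qed
  also have "\<dots> = ?S" by (rule sum.mono_neutral_right) (auto simp: zero)
  also have "(\<Sum>k\<in>{2 * ?n..<2 * ?n + ?n}. ?B (Suc a) k * u ^ k) = (\<Sum>j<?n. ?B (Suc a) (2 * ?n + j) * u ^ (2 * ?n + j))"
    using sum.shift_bounds_nat_ivl[of "\<lambda>k. ?B (Suc a) k * u ^ k" 0 "2 * ?n" ?n] by (simp add: lessThan_atLeast0 add.commute)
  also have "\<dots> = (\<Sum>j<?n. (of_nat p * u\<^sup>2) ^ ?n * (?B a j * u ^ j))"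
  proof (rule sum.cong[OF refl])
    fix j assume "j \<in> {..<?n}"
    then have *: "?B (Suc a) (2 * ?n + j) = of_nat p ^ ?n * ?B a j" by (intro high) simp
    have "u ^ (2 * ?n + j) = (u\<^sup>2) ^ ?n * u ^ j" by (simp only: power_add power_mult)
    then show "?B (Suc a) (2 * ?n + j) * u ^ (2 * ?n + j) = (of_nat p * u\<^sup>2) ^ ?n * (?B a j * u ^ j)"
      unfolding * power_mult_distrib by (simp only: mult_ac)
  qed
  also have "\<dots> = (of_nat p * u\<^sup>2) ^ ?n * ?S" by (simp add: sum_distrib_left)
  also have "?S + (of_nat p * u\<^sup>2) ^ ?n * ?S = ?S * (1 + (of_nat p * u\<^sup>2) ^ ?n)" by (simp add: algebra_simps)
  also have "?S = (\<Prod>i<a. 1 + (of_nat p * u\<^sup>2) ^ (3 ^ i))" using Suc.prems by (intro Suc.IH) auto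
  finally show ?case by simp
qed

section \<open>Polynomials over a finite field\<close>

definition monic_polys :: "('a, 'b) ring_scheme \<Rightarrow> 'a list set" where
  "monic_polys R = {f \<in> carrier (poly_ring R). f \<noteq> [] \<and> hd f = \<one>\<^bsub>R\<^esub>}"

context field
begin

lemma poly_ring_principal: "principal_domain (poly_ring R)"
  by (rule univ_poly_is_principal[OF carrier_is_subfield])

lemma poly_ring_mult_Nil_iff:
  assumes "f \<in> carrier (poly_ring R)" "g \<in> carrier (poly_ring R)"
  shows "f \<otimes>\<^bsub>poly_ring R\<^esub> g = [] \<longleftrightarrow> f = [] \<or> g = []"
  using domain.integral_iff[OF univ_poly_is_domain[OF carrier_is_subring] assms] by (simp add: univ_poly_zero)

lemma hd_poly_ring_mult:
  assumes "f \<in> carrier (poly_ring R)" "g \<in> carrier (poly_ring R)" "f \<noteq> []" "g \<noteq> []"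
  shows "hd (f \<otimes>\<^bsub>poly_ring R\<^esub> g) = hd f \<otimes> hd g"
  unfolding univ_poly_mult
  by (rule poly_mult_lead_coeff[OF carrier_is_subring]) (use assms in \<open>simp_all add: univ_poly_carrier\<close>)

lemma degree_poly_ring_mult:
  assumes "f \<in> carrier (poly_ring R)" "g \<in> carrier (poly_ring R)" "f \<noteq> []" "g \<noteq> []"
  shows "length (f \<otimes>\<^bsub>poly_ring R\<^esub> g) - 1 = (length f - 1) + (length g - 1)"
  using poly_mult_degree_eq[OF carrier_is_subring, of f g] assms by (simp add: univ_poly_mult univ_poly_carrier)

lemma hd_in_carrier: "f \<in> carrier (poly_ring R) \<Longrightarrow> f \<noteq> [] \<Longrightarrow> hd f \<in> carrier R - {\<zero>}"
  by (auto simp: univ_poly_carrier[symmetric] polynomial_def)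

lemma monic_polys_mult_iff:
  assumes \<pi>: "\<pi> \<in> monic_polys R" and f: "f \<in> carrier (poly_ring R)"
  shows "\<pi> \<otimes>\<^bsub>poly_ring R\<^esub> f \<in> monic_polys R \<longleftrightarrow> f \<in> monic_polys R"
proof -
  interpret UP: principal_domain "poly_ring R" by (rule poly_ring_principal)
  have p: "\<pi> \<in> carrier (poly_ring R)" "\<pi> \<noteq> []" "hd \<pi> = \<one>" using \<pi> by (auto simp: monic_polys_def)
  show ?thesis
  proof (cases "f = []")
    case True
    then show ?thesis using poly_ring_mult_Nil_iff[OF p(1) f] by (simp add: monic_polys_def)
  next
    case False
    then have "hd f \<in> carrier R" using hd_in_carrier[OF f] by simp
    then show ?thesis
      using poly_ring_mult_Nil_iff[OF p(1) f] hd_poly_ring_mult[OF p(1) f p(2) False] p f False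
      by (simp add: monic_polys_def)
  qed
qed

lemma monic_irreducibles_monic: "monic_irreducibles R \<subseteq> monic_polys R"
  using pirreducibleE(1)[OF carrier_is_subring] by (auto simp: monic_irreducibles_def monic_polys_def)

lemma monic_associated_eq:
  assumes "f \<in> monic_polys R" "g \<in> monic_polys R" "f \<sim>\<^bsub>poly_ring R\<^esub> g"
  shows "f = g"
proof -
  have c: "f \<in> carrier (poly_ring R)" "g \<in> carrier (poly_ring R)" "f \<noteq> []" "g \<noteq> []"
    "hd f = \<one>" "hd g = \<one>" using assms by (auto simp: monic_polys_def)
  interpret UP: principal_domain "poly_ring R" by (rule poly_ring_principal)
  obtain k where k: "k \<in> carrier R - {\<zero>}" "f = [k] \<otimes>\<^bsub>poly_ring R\<^esub> g"
    using associated_polynomials_iff[OF carrier_is_subfield c(1,2)] assms(3) by auto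
  have kc: "[k] \<in> carrier (poly_ring R)" using k by (simp add: univ_poly_carrier[symmetric] polynomial_def)
  have "hd f = k" using hd_poly_ring_mult[OF kc c(2)] c k by simp
  then have "[k] = \<one>\<^bsub>poly_ring R\<^esub>" using c by (simp add: univ_poly_one)
  then show ?thesis using k c by simp
qed

lemma monic_irreducible_dividing:
  assumes "f \<in> carrier (poly_ring R)" "length f > 1"
  shows "\<exists>\<pi>\<in>monic_irreducibles R. \<pi> divides\<^bsub>poly_ring R\<^esub> f"
proof -
  interpret UP: principal_domain "poly_ring R" by (rule poly_ring_principal)
  have "f \<noteq> []" using assms by auto
  moreover have "f \<notin> Units (poly_ring R)"
  proof
    assume "f \<in> Units (poly_ring R)"
    then obtain k where "f = [k]" unfolding univ_poly_carrier_units by blast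
    then show False using assms(2) by simp
  qed
  ultimately obtain b where b: "b \<in> carrier (poly_ring R)" "pirreducible (carrier R) b" "b divides\<^bsub>poly_ring R\<^esub> f"
    using assms(1) by - (rule UP.exists_irreducible_divisor[of f], simp_all add: univ_poly_zero)
  have b0: "b \<noteq> []" using pirreducibleE(1)[OF carrier_is_subring b(1,2)] .
  define k where "k = inv (hd b)"
  have hb: "hd b \<in> carrier R - {\<zero>}" using hd_in_carrier[OF b(1) b0] .
  then have k: "k \<in> carrier R - {\<zero>}" "k \<otimes> hd b = \<one>"
    using subfield_m_inv[OF carrier_is_subfield, of "hd b"] by (auto simp: k_def)
  have kU: "[k] \<in> Units (poly_ring R)" unfolding univ_poly_carrier_units using k(1) by blast
  then have kc: "[k] \<in> carrier (poly_ring R)" by (rule UP.Units_closed)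
  let ?c = "[k] \<otimes>\<^bsub>poly_ring R\<^esub> b"
  have c: "?c \<in> carrier (poly_ring R)" using kc b by simp
  have c1: "hd ?c = \<one>" using hd_poly_ring_mult[OF kc b(1)] b0 k by simp
  have ass: "b \<sim>\<^bsub>poly_ring R\<^esub> ?c"
    using associated_polynomials_iff[OF carrier_is_subfield c b(1)] k(1) UP.associated_sym by blast
  have "pirreducible (carrier R) ?c"
  proof -
    have "?c \<noteq> []" using poly_ring_mult_Nil_iff[OF kc b(1)] b0 by simp
    moreover have "irreducible (poly_ring R) b" using b(2) unfolding ring_irreducible_def by blast
    then have "irreducible (poly_ring R) ?c" by (rule UP.irreducible_prod_lI[OF _ kU kc b(1)])
    ultimately show ?thesis unfolding ring_irreducible_def univ_poly_zero by blast
  qed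
  moreover have "?c divides\<^bsub>poly_ring R\<^esub> f"
    using UP.divides_cong_l[OF UP.associated_sym[OF ass] b(3)] b(1) c assms(1) by blast
  ultimately show ?thesis using c c1 unfolding monic_irreducibles_def by blast
qed

lemma monic_irreducible_divides_mult:
  assumes "\<pi> \<in> monic_irreducibles R" "f \<in> carrier (poly_ring R)" "g \<in> carrier (poly_ring R)"
  shows "\<pi> divides\<^bsub>poly_ring R\<^esub> f \<otimes>\<^bsub>poly_ring R\<^esub> g \<longleftrightarrow> \<pi> divides\<^bsub>poly_ring R\<^esub> f \<or> \<pi> divides\<^bsub>poly_ring R\<^esub> g"
proof -
  interpret UP: principal_domain "poly_ring R" by (rule poly_ring_principal)
  have \<pi>: "\<pi> \<in> carrier (poly_ring R)" "pprime (carrier R) \<pi>"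
    using assms(1) pprime_iff_pirreducible[OF carrier_is_subfield] by (auto simp: monic_irreducibles_def)
  note 1 = pprimeE(3)[OF carrier_is_subfield \<pi> assms(2,3), unfolded pdivides_def]
  have 2: "\<pi> divides\<^bsub>poly_ring R\<^esub> f \<otimes>\<^bsub>poly_ring R\<^esub> g" if "\<pi> divides\<^bsub>poly_ring R\<^esub> f"
    by (rule UP.divides_prod_r[OF that \<pi>(1) assms(3)])
  have 3: "\<pi> divides\<^bsub>poly_ring R\<^esub> f \<otimes>\<^bsub>poly_ring R\<^esub> g" if "\<pi> divides\<^bsub>poly_ring R\<^esub> g"
    by (rule UP.divides_prod_l[OF \<pi>(1) assms(3,2) that])
  show ?thesis using 1 2 3 by argo
qed

lemma monic_irreducible_divides_eq:
  assumes "\<pi> \<in> monic_irreducibles R" "\<rho> \<in> monic_irreducibles R" "\<pi> divides\<^bsub>poly_ring R\<^esub> \<rho>"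
  shows "\<pi> = \<rho>"
proof (rule monic_associated_eq)
  have c: "\<pi> \<in> carrier (poly_ring R)" "pirreducible (carrier R) \<rho>" "pirreducible (carrier R) \<pi>"
    using assms by (auto simp: monic_irreducibles_def)
  then show "\<pi> \<sim>\<^bsub>poly_ring R\<^esub> \<rho>"
    using divides_pirreducible_condition[OF c(2,1) assms(3)] pirreducibleE(2)[OF carrier_is_subring c(1,3)] by blast
qed (use assms monic_irreducibles_monic in auto)

lemma not_monic_irreducible_divides_one:
  assumes "\<pi> \<in> monic_irreducibles R"
  shows "\<not> \<pi> divides\<^bsub>poly_ring R\<^esub> \<one>\<^bsub>poly_ring R\<^esub>"
proof
  interpret UP: principal_domain "poly_ring R" by (rule poly_ring_principal)
  assume "\<pi> divides\<^bsub>poly_ring R\<^esub> \<one>\<^bsub>poly_ring R\<^esub>"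
  then have "\<pi> \<in> Units (poly_ring R)" using assms UP.divides_unit by (auto simp: monic_irreducibles_def)
  then show False using assms pirreducibleE(2)[OF carrier_is_subring] by (auto simp: monic_irreducibles_def)
qed

lemma one_monic: "\<one>\<^bsub>poly_ring R\<^esub> \<in> monic_polys R"
proof -
  interpret UP: principal_domain "poly_ring R" by (rule poly_ring_principal)
  show ?thesis using UP.one_closed by (auto simp: monic_polys_def univ_poly_one)
qed

section \<open>Sieving by irreducible polynomials and the Euler product\<close>

lemma infsum_coprime_monic_irreducibles:
  fixes \<phi> :: "'a list \<Rightarrow> complex"
  assumes mult: "\<And>f g. f \<in> monic_polys R \<Longrightarrow> g \<in> monic_polys R \<Longrightarrow> \<phi> (f \<otimes>\<^bsub>poly_ring R\<^esub> g) = \<phi> f * \<phi> g"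
    and sum: "\<phi> summable_on monic_polys R"
    and "finite F" "F \<subseteq> monic_irreducibles R"
  shows "infsum \<phi> {f \<in> monic_polys R. \<forall>\<pi>\<in>F. \<not> \<pi> divides\<^bsub>poly_ring R\<^esub> f} =
    (\<Prod>\<pi>\<in>F. 1 - \<phi> \<pi>) * infsum \<phi> (monic_polys R)"
  using assms(3,4)
proof (induction F)
  case (insert \<pi> F)
  let ?P = "poly_ring R"
  interpret UP: principal_domain "poly_ring R" by (rule poly_ring_principal)
  let ?N = "{f \<in> monic_polys R. \<forall>\<rho>\<in>F. \<not> \<rho> divides\<^bsub>?P\<^esub> f}"
  have sm: "\<phi> summable_on M" if "M \<subseteq> monic_polys R" for M by (rule summable_on_subset_banach[OF sum that])
  have \<pi>: "\<pi> \<in> monic_irreducibles R" "\<pi> \<in> monic_polys R" "\<pi> \<in> carrier ?P" "\<pi> \<noteq> []"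
    using insert.prems monic_irreducibles_monic by (auto simp: monic_polys_def)
  have "infsum \<phi> {f\<in>?N. \<pi> divides\<^bsub>?P\<^esub> f} = \<phi> \<pi> * infsum \<phi> ?N"
  proof -
    have "{f\<in>?N. \<pi> divides\<^bsub>?P\<^esub> f} = (\<lambda>f. \<pi> \<otimes>\<^bsub>?P\<^esub> f) ` ?N"
    proof safe
      fix f assume f: "f \<in> monic_polys R" "\<forall>\<rho>\<in>F. \<not> \<rho> divides\<^bsub>?P\<^esub> f" "\<pi> divides\<^bsub>?P\<^esub> f"
      then obtain g where g: "g \<in> carrier ?P" "f = \<pi> \<otimes>\<^bsub>?P\<^esub> g" by (auto elim: dividesE)
      have "g \<in> ?N"
        using f g monic_polys_mult_iff[OF \<pi>(2) g(1)] monic_irreducible_divides_mult[OF _ \<pi>(3) g(1)] insert.prems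
        by (simp add: subset_iff)
      then show "f \<in> (\<lambda>f. \<pi> \<otimes>\<^bsub>?P\<^esub> f) ` ?N" using g by blast
    next
      fix g assume g: "g \<in> monic_polys R" "\<forall>\<rho>\<in>F. \<not> \<rho> divides\<^bsub>?P\<^esub> g"
      then have gc: "g \<in> carrier ?P" by (simp add: monic_polys_def)
      show "\<pi> \<otimes>\<^bsub>?P\<^esub> g \<in> monic_polys R" using g monic_polys_mult_iff[OF \<pi>(2) gc] by simp
      show "\<pi> divides\<^bsub>?P\<^esub> \<pi> \<otimes>\<^bsub>?P\<^esub> g" using gc by blast
      fix \<rho> assume r: "\<rho> \<in> F" "\<rho> divides\<^bsub>?P\<^esub> \<pi> \<otimes>\<^bsub>?P\<^esub> g"
      then have "\<rho> divides\<^bsub>?P\<^esub> \<pi>"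
        using monic_irreducible_divides_mult[OF _ \<pi>(3) gc, of \<rho>] g insert.prems by auto
      then show False using monic_irreducible_divides_eq[of \<rho> \<pi>] r insert.prems insert.hyps by auto
    qed
    moreover have "inj_on (\<lambda>f. \<pi> \<otimes>\<^bsub>?P\<^esub> f) ?N"
    proof (rule inj_onI)
      fix f g assume "f \<in> ?N" "g \<in> ?N" "\<pi> \<otimes>\<^bsub>?P\<^esub> f = \<pi> \<otimes>\<^bsub>?P\<^esub> g"
      then show "f = g" using UP.m_lcancel[of \<pi> f g] \<pi> by (simp add: monic_polys_def univ_poly_zero)
    qed
    ultimately have "infsum \<phi> {f\<in>?N. \<pi> divides\<^bsub>?P\<^esub> f} = infsum (\<lambda>f. \<phi> (\<pi> \<otimes>\<^bsub>?P\<^esub> f)) ?N"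
      by (simp add: infsum_reindex o_def)
    also have "\<dots> = infsum (\<lambda>f. \<phi> \<pi> * \<phi> f) ?N" by (rule infsum_cong) (use mult \<pi> in auto)
    also have "\<dots> = \<phi> \<pi> * infsum \<phi> ?N" by (rule infsum_cmult_right) (auto intro: sm)
    finally show ?thesis .
  qed
  moreover have "infsum \<phi> ({f\<in>?N. \<pi> divides\<^bsub>?P\<^esub> f} \<union> {f\<in>?N. \<not> \<pi> divides\<^bsub>?P\<^esub> f}) =
      infsum \<phi> {f\<in>?N. \<pi> divides\<^bsub>?P\<^esub> f} + infsum \<phi> {f\<in>?N. \<not> \<pi> divides\<^bsub>?P\<^esub> f}"
    by (rule infsum_Un_disjoint) (auto intro: sm)
  moreover have "{f\<in>?N. \<pi> divides\<^bsub>?P\<^esub> f} \<union> {f\<in>?N. \<not> \<pi> divides\<^bsub>?P\<^esub> f} = ?N" by auto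
  ultimately have "infsum \<phi> {f\<in>?N. \<not> \<pi> divides\<^bsub>?P\<^esub> f} = (1 - \<phi> \<pi>) * infsum \<phi> ?N"
    by (simp add: algebra_simps)
  moreover have "{f\<in>?N. \<not> \<pi> divides\<^bsub>?P\<^esub> f} = {f \<in> monic_polys R. \<forall>\<rho>\<in>insert \<pi> F. \<not> \<rho> divides\<^bsub>?P\<^esub> f}" by auto
  ultimately show ?case using insert by simp
qed simp

text \<open>The sum over polynomials free of factors from F is the finite product of the 1 - \<phi>
  \<pi> times the full sum, and it tends to the value 1 at the polynomial 1. Hence the full sum is
  nonzero and the inverse products converge to it.\<close>

theorem euler_product:
  fixes \<phi> :: "'a list \<Rightarrow> complex"
  assumes mult: "\<And>f g. f \<in> monic_polys R \<Longrightarrow> g \<in> monic_polys R \<Longrightarrow> \<phi> (f \<otimes>\<^bsub>poly_ring R\<^esub> g) = \<phi> f * \<phi> g"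
    and one: "\<phi> \<one>\<^bsub>poly_ring R\<^esub> = 1"
    and sum: "(\<lambda>f. norm (\<phi> f)) summable_on monic_polys R"
  shows "tendsto (\<lambda>F. \<Prod>\<pi>\<in>F. inverse (1 - \<phi> \<pi>)) (infsum \<phi> (monic_polys R))
    (finite_subsets_at_top (monic_irreducibles R))"
proof -
  let ?P = "poly_ring R" and ?M = "monic_polys R" and ?A = "finite_subsets_at_top (monic_irreducibles R)"
  let ?S = "infsum \<phi> ?M"
  let ?N = "\<lambda>F. {f \<in> ?M. \<forall>\<pi>\<in>F. \<not> \<pi> divides\<^bsub>?P\<^esub> f}"
  have sm: "\<phi> summable_on ?M" by (rule abs_summable_summable[OF sum])
  have sub: "\<phi> summable_on M" "(\<lambda>f. norm (\<phi> f)) summable_on M" if "M \<subseteq> ?M" for M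
    using that by (auto intro: summable_on_subset_banach[OF sm] summable_on_subset_banach[OF sum])
  have lim: "tendsto (\<lambda>F. infsum \<phi> (?N F)) (1) ?A"
  proof (rule tendstoI)
    fix e :: real assume e: "e > 0"
    let ?I = "infsum (\<lambda>f. norm (\<phi> f)) ?M"
    have "((\<lambda>f. norm (\<phi> f)) has_sum ?I) ?M" using sum by simp
    then have "eventually (\<lambda>S. dist (\<Sum>f\<in>S. norm (\<phi> f)) ?I < e) (finite_subsets_at_top ?M)"
      using e unfolding has_sum_def by (rule tendstoD)
    then obtain S0 where S0: "finite S0" "S0 \<subseteq> ?M"
      "\<And>S. finite S \<Longrightarrow> S0 \<subseteq> S \<Longrightarrow> S \<subseteq> ?M \<Longrightarrow> dist (\<Sum>f\<in>S. norm (\<phi> f)) ?I < e"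
      unfolding eventually_finite_subsets_at_top by (elim exE conjE) simp
    have tail: "infsum (\<lambda>f. norm (\<phi> f)) (?M - S0) < e"
    proof -
      have "infsum (\<lambda>f. norm (\<phi> f)) (?M - S0) = ?I - (\<Sum>f\<in>S0. norm (\<phi> f))"
        using infsum_Diff[OF sum, of S0] S0 by simp
      then show ?thesis using S0(3)[OF S0(1) order_refl S0(2)] by (auto simp: dist_norm)
    qed
    have "\<exists>\<pi>\<in>monic_irreducibles R. \<pi> divides\<^bsub>?P\<^esub> f" if f: "f \<in> S0 - {\<one>\<^bsub>?P\<^esub>}" for f
    proof (rule monic_irreducible_dividing)
      show "f \<in> carrier ?P" using f S0 by (auto simp: monic_polys_def)
      have "f \<noteq> []" "hd f = \<one>" "f \<noteq> [\<one>]" using f S0 by (auto simp: monic_polys_def univ_poly_one)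
      then show "length f > 1" by (cases f; cases "tl f") auto
    qed
    \<comment> \<open>Once F contains one irreducible factor of each element of \<open>S0\<close>
      other than 1, only the polynomial 1 and part of the small tail outside \<open>S0\<close>
      survive the sieve.\<close>
    then obtain q where q: "\<And>f. f \<in> S0 - {\<one>\<^bsub>?P\<^esub>} \<Longrightarrow> q f \<in> monic_irreducibles R \<and> q f divides\<^bsub>?P\<^esub> f"
      by metis
    show "eventually (\<lambda>F. dist (infsum \<phi> (?N F)) 1 < e) ?A"
      unfolding eventually_finite_subsets_at_top
    proof (intro exI[of _ "q ` (S0 - {\<one>\<^bsub>?P\<^esub>})"] conjI allI impI)
      fix F assume F: "finite F \<and> q ` (S0 - {\<one>\<^bsub>?P\<^esub>}) \<subseteq> F \<and> F \<subseteq> monic_irreducibles R"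
      let ?N' = "?N F - {\<one>\<^bsub>?P\<^esub>}"
      have 1: "\<one>\<^bsub>?P\<^esub> \<in> ?N F" using F not_monic_irreducible_divides_one one_monic by auto
      have "?N' \<subseteq> ?M - S0" using q F by blast
      have "infsum \<phi> ?N' = infsum \<phi> (?N F) - 1"
        using infsum_Diff[of \<phi> "?N F" "{\<one>\<^bsub>?P\<^esub>}"] 1 one sub(1)[of "?N F"] by auto
      then have "dist (infsum \<phi> (?N F)) 1 = norm (infsum \<phi> ?N')" by (simp add: dist_norm)
      also have "\<dots> \<le> infsum (\<lambda>f. norm (\<phi> f)) ?N'"
        by (rule norm_infsum_bound) (rule sub(2), auto)
      also have "\<dots> \<le> infsum (\<lambda>f. norm (\<phi> f)) (?M - S0)"
        by (rule infsum_mono_neutral) (use \<open>?N' \<subseteq> ?M - S0\<close> in \<open>auto intro: sub(2)\<close>)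
      finally show "dist (infsum \<phi> (?N F)) 1 < e" using tail by simp
    qed (use q S0 in auto)
  qed
  have eq: "eventually (\<lambda>F. infsum \<phi> (?N F) = (\<Prod>\<pi>\<in>F. 1 - \<phi> \<pi>) * ?S) ?A"
    unfolding eventually_finite_subsets_at_top
    by (intro exI[of _ "{}"]) (auto intro!: infsum_coprime_monic_irreducibles[OF mult sm])
  have lim2: "tendsto (\<lambda>F. (\<Prod>\<pi>\<in>F. 1 - \<phi> \<pi>) * ?S) (1) ?A"
    using lim eq by (rule Lim_transform_eventually)
  then have "tendsto (\<lambda>F. ?S * inverse ((\<Prod>\<pi>\<in>F. 1 - \<phi> \<pi>) * ?S)) (?S * inverse 1) ?A"
    by (intro tendsto_intros) auto
  moreover have "?S \<noteq> 0"
  proof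
    assume "?S = 0"
    then have "tendsto (\<lambda>F. 0 :: complex) (1) ?A" using lim2 by simp
    then show False by (simp add: tendsto_const_iff)
  qed
  then have "(\<lambda>F. ?S * inverse ((\<Prod>\<pi>\<in>F. 1 - \<phi> \<pi>) * ?S)) = (\<lambda>F. \<Prod>\<pi>\<in>F. inverse (1 - \<phi> \<pi>))"
    by (intro ext) (simp add: prod_inversef[symmetric] o_def inverse_mult_distrib)
  ultimately show ?thesis by simp
qed

end

section \<open>Residue fields and divisors of X^E - 1\<close>

context field
begin

lemma monic_irreducibleD:
  assumes "\<pi> \<in> monic_irreducibles R"
  shows "\<pi> \<in> carrier (poly_ring R)" "\<pi> \<noteq> []" "length \<pi> - 1 \<ge> 1"
proof -
  have c: "\<pi> \<in> carrier (poly_ring R)" "pirreducible (carrier R) \<pi>"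
    using assms by (simp_all add: monic_irreducibles_def)
  show "\<pi> \<in> carrier (poly_ring R)" by (rule c(1))
  show "\<pi> \<noteq> []" by (rule pirreducibleE(1)[OF carrier_is_subring c])
  show "length \<pi> - 1 \<ge> 1" by (rule pirreducible_degree[OF carrier_is_subfield c])
qed

lemma bij_betw_normalize:
  "bij_betw normalize {es. length es = d \<and> set es \<subseteq> carrier R} {f \<in> carrier (poly_ring R). length f \<le> d}"
proof (rule bij_betw_imageI)
  show "inj_on normalize {es. length es = d \<and> set es \<subseteq> carrier R}"
  proof (rule inj_onI)
    fix es es' assume h: "es \<in> {es. length es = d \<and> set es \<subseteq> carrier R}" "es' \<in> {es. length es = d \<and> set es \<subseteq> carrier R}"
      "normalize es = normalize es'"
    show "es = es'" using normalize_trick[of es] normalize_trick[of es'] h by simp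
  qed
  show "normalize ` {es. length es = d \<and> set es \<subseteq> carrier R} = {f \<in> carrier (poly_ring R). length f \<le> d}"
  proof (intro equalityI subsetI)
    fix f assume "f \<in> normalize ` {es. length es = d \<and> set es \<subseteq> carrier R}"
    then obtain es where "length es = d" "set es \<subseteq> carrier R" "f = normalize es" by blast
    then show "f \<in> {f \<in> carrier (poly_ring R). length f \<le> d}"
      using normalize_gives_polynomial[of es "carrier R"] normalize_length_le[of es]
      by (simp add: univ_poly_carrier)
  next
    fix f assume "f \<in> {f \<in> carrier (poly_ring R). length f \<le> d}"
    then have f: "f \<in> carrier (poly_ring R)" "length f \<le> d" by auto
    then have pf: "polynomial (carrier R) f" by (simp add: univ_poly_carrier)
    have 1: "normalize (replicate (d - length f) \<zero> @ f) = f"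
      using normalize_polynomial[OF pf] by (simp add: normalize_replicate_zero)
    have 2: "replicate (d - length f) \<zero> @ f \<in> {es. length es = d \<and> set es \<subseteq> carrier R}"
      using f polynomial_incl[OF pf] by auto
    show "f \<in> normalize ` {es. length es = d \<and> set es \<subseteq> carrier R}" 
      by (rule image_eqI[where f = normalize, OF sym[OF 1] 2])
  qed
qed

text \<open>Each class has exactly one representative of degree below that of \<pi>, and these
  correspond to coefficient lists of fixed length with leading zeros allowed.\<close>

lemma card_rupture:
  assumes fin: "finite (carrier R)" and \<pi>: "\<pi> \<in> carrier (poly_ring R)" "\<pi> \<noteq> []"
  shows "finite (carrier (Rupt (carrier R) \<pi>))"
    and "card (carrier (Rupt (carrier R) \<pi>)) = card (carrier R) ^ (length \<pi> - 1)"
proof -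
  let ?S = "{f \<in> carrier (poly_ring R). length f \<le> length \<pi> - 1}" and ?h = "rupture_surj (carrier R) \<pi>"
  have "bij_betw ?h ?S (carrier (Rupt (carrier R) \<pi>))"
    unfolding pmod_image_characterization[OF carrier_is_subfield \<pi>, symmetric] bij_betw_def
    using rupture_surj_inj_on[OF carrier_is_subfield \<pi>(1)] rupture_carrier_as_pmod_image[OF carrier_is_subfield \<pi>(1)]
    by simp
  with bij_betw_normalize[of "length \<pi> - 1"] have bij:
    "bij_betw (?h \<circ> normalize) {es. length es = length \<pi> - 1 \<and> set es \<subseteq> carrier R} (carrier (Rupt (carrier R) \<pi>))"
    by (rule bij_betw_trans)
  have "card {es. set es \<subseteq> carrier R \<and> length es = length \<pi> - 1} = card (carrier R) ^ (length \<pi> - 1)"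
    by (rule card_lists_length_eq[OF fin])
  then show "card (carrier (Rupt (carrier R) \<pi>)) = card (carrier R) ^ (length \<pi> - 1)"
    using bij_betw_same_card[OF bij] by (simp add: conj_commute)
  show "finite (carrier (Rupt (carrier R) \<pi>))"
    using bij_betw_finite[OF bij] finite_lists_length_eq[OF fin] by (simp add: conj_commute)
qed

lemma rupture_surj_eq_iff:
  assumes \<pi>: "\<pi> \<in> carrier (poly_ring R)" and f: "f \<in> carrier (poly_ring R)" "g \<in> carrier (poly_ring R)"
  shows "rupture_surj (carrier R) \<pi> f = rupture_surj (carrier R) \<pi> g \<longleftrightarrow> \<pi> divides\<^bsub>poly_ring R\<^esub> (f \<ominus>\<^bsub>poly_ring R\<^esub> g)"
proof -
  interpret UP: principal_domain "poly_ring R" by (rule poly_ring_principal)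
  have c: "f \<ominus>\<^bsub>poly_ring R\<^esub> g \<in> carrier (poly_ring R)" using f by simp
  have "rupture_surj (carrier R) \<pi> f = rupture_surj (carrier R) \<pi> g \<longleftrightarrow> f \<ominus>\<^bsub>poly_ring R\<^esub> g \<in> PIdl\<^bsub>poly_ring R\<^esub> \<pi>"
    using UP.quotient_eq_iff_same_a_r_cos[OF UP.cgenideal_ideal[OF \<pi>] f] by simp
  also have "\<dots> \<longleftrightarrow> \<pi> divides\<^bsub>poly_ring R\<^esub> (f \<ominus>\<^bsub>poly_ring R\<^esub> g)"
    unfolding cgenideal_def factor_def using UP.m_comm[OF \<pi>] by auto
  finally show ?thesis .
qed

text \<open>Lagrange's theorem in the multiplicative group of the residue field, where X is a
  nonzero element.\<close>

lemma monic_irreducible_divides_var_pow: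
  assumes fin: "finite (carrier R)" and \<pi>: "\<pi> \<in> monic_irreducibles R" "\<not> \<pi> divides\<^bsub>poly_ring R\<^esub> X"
    and E: "card (carrier R) ^ (length \<pi> - 1) - 1 dvd E"
  shows "\<pi> divides\<^bsub>poly_ring R\<^esub> (X [^]\<^bsub>poly_ring R\<^esub> E \<ominus>\<^bsub>poly_ring R\<^esub> \<one>\<^bsub>poly_ring R\<^esub>)"
proof -
  let ?P = "poly_ring R" and ?Q = "Rupt (carrier R) \<pi>" and ?h = "rupture_surj (carrier R) \<pi>"
  interpret UP: principal_domain "poly_ring R" by (rule poly_ring_principal)
  have c: "\<pi> \<in> carrier ?P" "pirreducible (carrier R) \<pi>" "\<pi> \<noteq> []"
    using \<pi> monic_irreducibles_monic by (auto simp: monic_irreducibles_def monic_polys_def)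
  interpret Q: field ?Q by (rule rupture_is_field_iff_pirreducible[OF carrier_is_subfield c(1), THEN iffD2, OF c(2)])
  note hom = rupture_surj_hom[OF carrier_is_subring c(1)]
  have X: "X \<in> carrier ?P" by (rule var_closed(1)[OF carrier_is_subring])
  have hX: "?h X \<in> carrier ?Q" by (rule ring_hom_closed[OF hom(1) X])
  have "?h X \<noteq> ?h \<zero>\<^bsub>?P\<^esub>"
    using rupture_surj_eq_iff[OF c(1) X UP.zero_closed] \<pi>(2) X by (simp add: UP.minus_eq)
  moreover have "?h \<zero>\<^bsub>?P\<^esub> = \<zero>\<^bsub>?Q\<^esub>"
    by (rule ring_hom_zero[OF hom(1) UP.ring_axioms Q.ring_axioms])
  ultimately have "?h X \<in> carrier (Multiplicative_Group.mult_of ?Q)" using hX by (simp add: Multiplicative_Group.carrier_mult_of)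
  then have "?h X [^]\<^bsub>Multiplicative_Group.mult_of ?Q\<^esub> order (Multiplicative_Group.mult_of ?Q) = \<one>\<^bsub>Multiplicative_Group.mult_of ?Q\<^esub>"
    by (rule group.pow_order_eq_1[OF Q.field_mult_group])
  also have "order (Multiplicative_Group.mult_of ?Q) = card (carrier R) ^ (length \<pi> - 1) - 1"
    using Q.order_mult_of card_rupture[OF fin c(1,3)] by (simp add: order_def)
  finally have 1: "?h X [^]\<^bsub>?Q\<^esub> (card (carrier R) ^ (length \<pi> - 1) - 1) = \<one>\<^bsub>?Q\<^esub>"
    by (simp add: Multiplicative_Group.nat_pow_mult_of)
  obtain m where m: "E = (card (carrier R) ^ (length \<pi> - 1) - 1) * m" using E by (rule dvdE)
  have "?h X [^]\<^bsub>?Q\<^esub> E = \<one>\<^bsub>?Q\<^esub>"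
    unfolding m using Q.nat_pow_pow[of "?h X" "card (carrier R) ^ (length \<pi> - 1) - 1" m] 1 hX by simp
  then have "?h (X [^]\<^bsub>?P\<^esub> E) = ?h \<one>\<^bsub>?P\<^esub>"
    using ring_hom_ring.hom_nat_pow[OF hom(2) X, of E] ring_hom_one[OF hom(1)] by simp
  then show ?thesis using rupture_surj_eq_iff[OF c(1), of "X [^]\<^bsub>?P\<^esub> E" "\<one>\<^bsub>?P\<^esub>"] X by simp
qed

lemma var_pow_eq: "X [^]\<^bsub>poly_ring R\<^esub> (n :: nat) = \<one> # replicate n \<zero>"
proof (induction n)
  case (Suc n)
  interpret UP: principal_domain "poly_ring R" by (rule poly_ring_principal)
  have c: "\<one> # replicate n \<zero> \<in> carrier (poly_ring R)" by (auto simp: univ_poly_carrier[symmetric] polynomial_def)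
  have "X [^]\<^bsub>poly_ring R\<^esub> Suc n = (\<one> # replicate n \<zero>) \<otimes>\<^bsub>poly_ring R\<^esub> X" using Suc by simp
  then show ?case using poly_mult_var[OF carrier_is_subring c] by (simp add: replicate_append_same)
qed (simp add: univ_poly_one)

text \<open>The divisibility recast with an explicit cofactor, its degree bound and an explicit
  coefficient list for X^E, as \<open>pw_periodic\<close> needs after lifting to integers.\<close>

lemma ex_var_pow_minus_one_factor:
  assumes fin: "finite (carrier R)" and \<pi>: "\<pi> \<in> monic_irreducibles R" "\<not> \<pi> divides\<^bsub>poly_ring R\<^esub> X"
    and E: "card (carrier R) ^ (length \<pi> - 1) - 1 dvd E" "E > 0"
  shows "\<exists>h\<in>carrier (poly_ring R). (\<pi> \<otimes>\<^bsub>poly_ring R\<^esub> h) \<oplus>\<^bsub>poly_ring R\<^esub> \<one>\<^bsub>poly_ring R\<^esub> = \<one> # replicate E \<zero> \<and>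
    (length \<pi> - 1) + (length h - 1) \<le> E \<and> \<pi> \<otimes>\<^bsub>poly_ring R\<^esub> h \<in> carrier (poly_ring R)"
proof -
  let ?P = "poly_ring R"
  interpret UP: principal_domain ?P by (rule poly_ring_principal)
  note c = monic_irreducibleD[OF \<pi>(1)]
  have "\<pi> divides\<^bsub>?P\<^esub> (X [^]\<^bsub>?P\<^esub> E \<ominus>\<^bsub>?P\<^esub> \<one>\<^bsub>?P\<^esub>)"
    by (rule monic_irreducible_divides_var_pow[OF fin \<pi> E(1)])
  then obtain h where h: "h \<in> carrier ?P" "X [^]\<^bsub>?P\<^esub> E \<ominus>\<^bsub>?P\<^esub> \<one>\<^bsub>?P\<^esub> = \<pi> \<otimes>\<^bsub>?P\<^esub> h"
    unfolding factor_def by blast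
  have XE: "X [^]\<^bsub>?P\<^esub> E \<in> carrier ?P"
    by (rule UP.nat_pow_closed[OF var_closed(1)[OF carrier_is_subring]])
  have "(X [^]\<^bsub>?P\<^esub> E \<ominus>\<^bsub>?P\<^esub> \<one>\<^bsub>?P\<^esub>) \<oplus>\<^bsub>?P\<^esub> \<one>\<^bsub>?P\<^esub> = X [^]\<^bsub>?P\<^esub> E"
    unfolding UP.minus_eq UP.a_assoc[OF XE UP.a_inv_closed[OF UP.one_closed] UP.one_closed] UP.l_neg[OF UP.one_closed]
    by (rule UP.r_zero[OF XE])
  then have eq: "\<pi> \<otimes>\<^bsub>?P\<^esub> h \<oplus>\<^bsub>?P\<^esub> \<one>\<^bsub>?P\<^esub> = \<one> # replicate E \<zero>"
    unfolding h(2) unfolding var_pow_eq .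
  have "(length \<pi> - 1) + (length h - 1) \<le> E"
  proof (cases "h = []")
    case True
    have "\<pi> \<otimes>\<^bsub>?P\<^esub> h = \<zero>\<^bsub>?P\<^esub>" using UP.r_null[OF c(1)] unfolding True univ_poly_zero .
    then have "\<one> # replicate E \<zero> = \<one>\<^bsub>?P\<^esub>"
      unfolding eq[symmetric] by (simp only: UP.l_zero[OF UP.one_closed])
    then show ?thesis using E(2) by (simp add: univ_poly_one)
  next
    case False
    have "length (\<pi> \<otimes>\<^bsub>?P\<^esub> h) \<le> max (length (X [^]\<^bsub>?P\<^esub> E)) (length (\<ominus>\<^bsub>?P\<^esub> \<one>\<^bsub>?P\<^esub>))"
      unfolding h(2)[symmetric] UP.minus_eq univ_poly_add by (rule poly_add_length_le)
    also have "\<dots> = E + 1"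
      using univ_poly_a_inv_length[OF carrier_is_subring UP.one_closed] by (simp add: var_pow_eq univ_poly_one)
    finally show ?thesis
      using degree_poly_ring_mult[OF c(1) h(1) c(2) False] by linarith
  qed
  moreover have "\<pi> \<otimes>\<^bsub>?P\<^esub> h \<in> carrier ?P" by (rule UP.m_closed[OF c(1) h(1)])
  ultimately show ?thesis using h(1) eq by blast
qed

lemma one_poly_closed: "\<one>\<^bsub>poly_ring R\<^esub> \<in> carrier (poly_ring R)"
  using one_monic by (simp add: monic_polys_def)

end

definition int_poly :: "int list \<Rightarrow> int poly" where
  "int_poly f = Poly (rev f)"

lemma coeff_int_poly: "poly.coeff (int_poly f) n = (if n < length f then f ! (length f - 1 - n) else 0)"
  by (simp add: int_poly_def nth_default_def rev_nth)

lemma degree_int_poly: "Polynomial.degree (int_poly f) \<le> length f - 1"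
  by (rule degree_le) (auto simp: coeff_int_poly)

section \<open>Lifting polynomials over the prime field to integer polynomials\<close>

context residues_prime
begin

abbreviation PR where "PR \<equiv> poly_ring R"

lemma coeff_eq_int_poly: "coeff f n = poly.coeff (int_poly f) n"
  by (induction f) (auto simp: int_poly_def nth_default_append res_zero_eq nth_default_def nth_append)

lemma set_poly_ring: "f \<in> carrier PR \<Longrightarrow> set f \<subseteq> {0..<int p}"
  using polynomial_incl[of "carrier R" f] unfolding univ_poly_carrier res_carrier_eq by auto

lemma int_poly_mult:
  assumes f: "f \<in> carrier PR" and g: "g \<in> carrier PR"
  shows "int p dvd poly.coeff (int_poly (f \<otimes>\<^bsub>PR\<^esub> g)) n - poly.coeff (int_poly f * int_poly g) n"
proof -
  have c: "set f \<subseteq> carrier R" "set g \<subseteq> carrier R" using f g polynomial_incl by (auto simp: univ_poly_carrier)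
  have "poly.coeff (int_poly (f \<otimes>\<^bsub>PR\<^esub> g)) n = (\<Oplus>k\<in>{..n}. (coeff f k \<otimes> coeff g (n - k)))"
    unfolding coeff_eq_int_poly[symmetric] univ_poly_mult poly_mult_coeff[OF c] ..
  also have "\<dots> = (\<Oplus>k\<in>{..n}. (coeff f k * coeff g (n - k)) mod int p)" unfolding res_mult_eq ..
  also have "\<dots> = (\<Sum>k\<le>n. coeff f k * coeff g (n - k)) mod int p" by (rule sum_cong) simp
  also have "(\<Sum>k\<le>n. coeff f k * coeff g (n - k)) = poly.coeff (int_poly f * int_poly g) n"
    by (simp add: coeff_mult coeff_eq_int_poly)
  finally show ?thesis by (simp add: mod_eq_dvd_iff[symmetric])
qed

lemma int_poly_add:
  assumes f: "f \<in> carrier PR" and g: "g \<in> carrier PR"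
  shows "int p dvd poly.coeff (int_poly (f \<oplus>\<^bsub>PR\<^esub> g)) n - poly.coeff (int_poly f + int_poly g) n"
proof -
  have c: "set f \<subseteq> carrier R" "set g \<subseteq> carrier R" using f g polynomial_incl by (auto simp: univ_poly_carrier)
  have "poly.coeff (int_poly (f \<oplus>\<^bsub>PR\<^esub> g)) n = coeff f n \<oplus> coeff g n"
    unfolding coeff_eq_int_poly[symmetric] univ_poly_add poly_add_coeff[OF c] ..
  then show ?thesis by (simp add: res_add_eq coeff_eq_int_poly mod_eq_dvd_iff[symmetric])
qed

abbreviation poly_fps :: "int list \<Rightarrow> int fps" where "poly_fps f \<equiv> fps_of_poly (int_poly f)"

lemma poly_fps_mult:
  assumes "f \<in> carrier PR" "g \<in> carrier PR"
  shows "fps_const (int p) dvd poly_fps (f \<otimes>\<^bsub>PR\<^esub> g) - poly_fps f * poly_fps g"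
  unfolding fps_const_dvd_iff using int_poly_mult[OF assms] by (simp flip: fps_of_poly_mult)

lemma coeff_0_mult:
  assumes "f \<in> carrier PR" "g \<in> carrier PR"
  shows "int p dvd poly.coeff (int_poly (f \<otimes>\<^bsub>PR\<^esub> g)) 0 \<longleftrightarrow>
    int p dvd poly.coeff (int_poly f) 0 \<or> int p dvd poly.coeff (int_poly g) 0"
proof -
  have "prime (int p)" using p_prime by simp
  moreover have "int p dvd poly.coeff (int_poly (f \<otimes>\<^bsub>PR\<^esub> g)) 0 \<longleftrightarrow> int p dvd poly.coeff (int_poly f * int_poly g) 0"
  proof -
    have "poly.coeff (int_poly (f \<otimes>\<^bsub>PR\<^esub> g)) 0 mod int p = poly.coeff (int_poly f * int_poly g) 0 mod int p"
      using int_poly_mult[OF assms, of 0] by (simp only: mod_eq_dvd_iff)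
    then show ?thesis by (simp only: dvd_eq_mod_eq_0)
  qed
  ultimately show ?thesis by (simp add: coeff_mult prime_dvd_mult_iff)
qed

lemma pw_poly_mult:
  assumes f: "f \<in> carrier PR" "\<not> int p dvd poly.coeff (int_poly f) 0"
    and g: "g \<in> carrier PR" "\<not> int p dvd poly.coeff (int_poly g) 0"
  shows "int p dvd pw p (poly_fps (f \<otimes>\<^bsub>PR\<^esub> g)) n - (pw p (poly_fps f) n + pw p (poly_fps g) n)"
proof -
  have pr: "prime (int p)" using p_prime by simp
  have 1: "int p dvd pw p (poly_fps (f \<otimes>\<^bsub>PR\<^esub> g)) n - pw p (poly_fps f * poly_fps g) n"
    by (rule pw_cong[OF p_prime _ poly_fps_mult[OF f(1) g(1)]]) (use f g pr in \<open>simp add: prime_dvd_mult_iff\<close>)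
  have 2: "int p dvd pw p (poly_fps f * poly_fps g) n - (pw p (poly_fps f) n + pw p (poly_fps g) n)"
    by (rule pw_mult[OF p_prime]) (use f g in simp_all)
  show ?thesis using dvd_add[OF 1 2] by (simp only: add_diff_eq diff_add_cancel)
qed

lemma card_carrier: "card (carrier R) = p"
  by (simp add: res_carrier_eq)

lemma not_divides_var:
  assumes \<pi>: "\<pi> \<in> monic_irreducibles R" "\<not> int p dvd poly.coeff (int_poly \<pi>) 0"
  shows "\<not> \<pi> divides\<^bsub>PR\<^esub> X"
proof
  note c = monic_irreducibleD[OF \<pi>(1)]
  assume "\<pi> divides\<^bsub>PR\<^esub> X"
  then obtain h where h: "h \<in> carrier PR" "X = \<pi> \<otimes>\<^bsub>PR\<^esub> h" unfolding factor_def by blast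
  have h0: "h \<noteq> []" using h poly_ring_mult_Nil_iff[OF c(1) h(1)] by (auto simp: var_def)
  have "length X - 1 = (length \<pi> - 1) + (length h - 1)" unfolding h(2) by (rule degree_poly_ring_mult[OF c(1) h(1) c(2) h0])
  moreover have "length X - 1 = 1" by (simp add: var_def)
  ultimately have "length h - 1 = 0" using c(3) by linarith
  then have "length h = 1" using h0 by (cases h) auto
  then obtain k where k: "h = [k]" by (auto simp: length_Suc_conv)
  have "int p dvd poly.coeff (int_poly X) 0" by (simp add: coeff_int_poly var_def res_zero_eq)
  then have "int p dvd poly.coeff (int_poly h) 0" unfolding h(2) using coeff_0_mult[OF c(1) h(1)] \<pi>(2) by simp
  moreover have "k \<in> {0..<int p}" "k \<noteq> 0" using set_poly_ring[OF h(1)] hd_in_carrier[OF h(1) h0] k by (auto simp: res_zero_eq)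
  ultimately show False using k by (auto simp: coeff_int_poly dest: zdvd_imp_le)
qed

lemma pw_periodic_irreducible:
  assumes \<pi>: "\<pi> \<in> monic_irreducibles R" "\<not> int p dvd poly.coeff (int_poly \<pi>) 0"
    and E: "p ^ (length \<pi> - 1) - 1 dvd E" "E > 0" and n: "n > 0"
  shows "int p dvd pw p (poly_fps \<pi>) (n + E) - pw p (poly_fps \<pi>) n"
proof -
  note c = monic_irreducibleD[OF \<pi>(1)]
  have X: "X \<in> carrier PR" by (rule var_closed(1)[OF carrier_is_subring])
  have "\<not> \<pi> divides\<^bsub>PR\<^esub> X" by (rule not_divides_var[OF \<pi>])
  from ex_var_pow_minus_one_factor[OF finite \<pi>(1) this, unfolded card_carrier, OF E]
  obtain h where h: "h \<in> carrier PR" "(\<pi> \<otimes>\<^bsub>PR\<^esub> h) \<oplus>\<^bsub>PR\<^esub> \<one>\<^bsub>PR\<^esub> = \<one> # replicate E \<zero>"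
    "(length \<pi> - 1) + (length h - 1) \<le> E" "\<pi> \<otimes>\<^bsub>PR\<^esub> h \<in> carrier PR" by blast
  show ?thesis
  proof (rule pw_periodic[where q = "int_poly h", OF p_prime \<pi>(2) _ _ n])
    show "Polynomial.degree (int_poly \<pi>) + Polynomial.degree (int_poly h) \<le> E"
      using h(3) degree_int_poly[of \<pi>] degree_int_poly[of h] by linarith
    fix i
    have a: "poly.coeff (int_poly (\<one> # replicate E \<zero>)) i = poly.coeff (Polynomial.monom 1 E) i"
      unfolding coeff_eq_int_poly[symmetric] monom_def[symmetric] monom_coeff
      by (simp add: res_zero_eq res_one_eq)
    have b: "poly.coeff (int_poly \<one>\<^bsub>PR\<^esub>) i = poly.coeff 1 i"
      by (simp add: univ_poly_one coeff_int_poly res_one_eq coeff_1)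
    have "int p dvd poly.coeff (int_poly (\<one> # replicate E \<zero>)) i -
        (poly.coeff (int_poly (\<pi> \<otimes>\<^bsub>PR\<^esub> h)) i + poly.coeff (int_poly \<one>\<^bsub>PR\<^esub>) i)"
      using int_poly_add[OF h(4) one_poly_closed, of i] unfolding h(2) coeff_add .
    moreover have "q dvd d - (a - c)" if "q dvd a - (b + c)" "q dvd b - d" for q a b c d :: int
    proof -
      have "d - (a - c) = - ((a - (b + c)) + (b - d))" by simp
      then show ?thesis using dvd_add[OF that] by (simp only: dvd_minus_iff)
    qed
    ultimately have "int p dvd poly.coeff (int_poly \<pi> * int_poly h) i -
        (poly.coeff (int_poly (\<one> # replicate E \<zero>)) i - poly.coeff (int_poly \<one>\<^bsub>PR\<^esub>) i)"
      using int_poly_mult[OF c(1) h(1), of i] by blast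
    then show "int p dvd poly.coeff (int_poly \<pi> * int_poly h - (Polynomial.monom 1 E - 1)) i"
      unfolding coeff_diff a b .
  qed
qed

text \<open>Split off irreducible factors one at a time: power sums add, and each factor has degree
  at most k, so \<open>E\<close> is a period for it.\<close>

lemma pw_periodic_poly:
  assumes "f \<in> carrier PR" "\<not> int p dvd poly.coeff (int_poly f) 0" "length f \<le> Suc k"
    and E: "\<And>d. 0 < d \<Longrightarrow> d \<le> k \<Longrightarrow> p ^ d - 1 dvd E" "E > 0" and n: "n > 0"
  shows "int p dvd pw p (poly_fps f) (n + E) - pw p (poly_fps f) n"
  using assms(1-3)
proof (induction "length f" arbitrary: f rule: less_induct)
  case less
  have f0: "f \<noteq> []" using less.prems by (auto simp: coeff_int_poly)
  show ?case
  proof (cases "length f = 1")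
    case True
    then obtain c where "f = [c]" by (auto simp: length_Suc_conv)
    then have "poly_fps f = fps_const c" by (simp add: int_poly_def)
    then show ?thesis by (simp only: pw_const) simp
  next
    case False
    then have "length f > 1" using f0 by (cases f) auto
    then obtain \<pi> where \<pi>: "\<pi> \<in> monic_irreducibles R" "\<pi> divides\<^bsub>PR\<^esub> f"
      using monic_irreducible_dividing less.prems(1) by blast
    then obtain g where g: "g \<in> carrier PR" "f = \<pi> \<otimes>\<^bsub>PR\<^esub> g" by (auto elim: dividesE)
    note c = monic_irreducibleD[OF \<pi>(1)]
    have g0: "g \<noteq> []" using f0 g poly_ring_mult_Nil_iff[OF c(1) g(1)] by auto
    have len: "length f - 1 = (length \<pi> - 1) + (length g - 1)"
      unfolding g(2) by (rule degree_poly_ring_mult[OF c(1) g(1) c(2) g0])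
    have co: "\<not> int p dvd poly.coeff (int_poly \<pi>) 0" "\<not> int p dvd poly.coeff (int_poly g) 0"
      using less.prems(2) coeff_0_mult[OF c(1) g(1)] g(2) by auto
    have "length \<pi> - 1 \<le> k" using len less.prems(3) by linarith
    then have 1: "int p dvd pw p (poly_fps \<pi>) (n + E) - pw p (poly_fps \<pi>) n"
      using pw_periodic_irreducible[OF \<pi>(1) co(1) _ E(2) n] E(1)[of "length \<pi> - 1"] c(3) by simp
    have "length g > 0" "length f > 0" using g0 f0 by blast+
    then have lg: "length g < length f" using len c(3) by linarith
    have 2: "int p dvd pw p (poly_fps g) (n + E) - pw p (poly_fps g) n"
      by (rule less.hyps[OF lg g(1) co(2)]) (use lg less.prems(3) in simp)
    note mult = pw_poly_mult[OF c(1) co(1) g(1) co(2), folded g(2)]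
    show ?thesis
      using dvd_add[OF dvd_diff[OF mult[of "n + E"] mult[of n]] dvd_add[OF 1 2]]
      by (rule back_subst) simp
  qed
qed

lemma power_sums_periodic:
  assumes "\<And>d. 0 < d \<Longrightarrow> d \<le> k \<Longrightarrow> p ^ d - 1 dvd E" "E > 0"
  shows "power_sums_periodic p k E"
  unfolding power_sums_periodic_def
proof (intro ballI allI impI)
  fix es and n :: nat assume es: "es \<in> residue_lists p k" and n: "n > 0"
  \<comment> \<open>Ring polynomials list the leading coefficient first; \<open>normalize\<close>
    strips the zeros that appear when the degree is below k.\<close>
  let ?f = "normalize (rev es @ [1])"
  have "set (rev es @ [1]) \<subseteq> carrier R"
    using es prime_gt_1_nat[OF p_prime] by (auto simp: residue_lists_def res_carrier_eq)
  then have f: "?f \<in> carrier PR"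
    unfolding univ_poly_carrier[symmetric] by (rule normalize_gives_polynomial)
  have eq: "poly_fps ?f = list_fps es"
  proof (rule fps_ext)
    fix i
    have "fps_nth (poly_fps ?f) i = poly.coeff (int_poly (rev es @ [1])) i"
      using normalize_coeff[of "rev es @ [1]"] by (simp flip: coeff_eq_int_poly)
    also have "\<dots> = fps_nth (list_fps es) i"
      by (auto simp: coeff_int_poly list_fps_nth nth_append rev_nth)
    finally show "fps_nth (poly_fps ?f) i = fps_nth (list_fps es) i" .
  qed
  have "poly.coeff (int_poly ?f) 0 = 1" using arg_cong[OF eq, of "\<lambda>F. fps_nth F 0"] by (simp add: list_fps_nth)
  moreover have "\<not> int p dvd 1" using p_prime by auto
  moreover have "length ?f \<le> Suc k" using normalize_length_le[of "rev es @ [1]"] residue_lists_length[OF es] by simp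
  ultimately show "int p dvd pw p (list_fps es) (n + E) - pw p (list_fps es) n"
    using pw_periodic_poly[OF f _ _ assms n] eq by simp
qed

end

text \<open>The term j = d is the plain power sum, and the terms of lower index do not see the d-th
  coefficient, so the vanishing over that coefficient persists.\<close>

lemma shifted_char_sum_vanish:
  assumes p: "prime p" and d: "d > 0" "\<not> p dvd d" and k: "k \<ge> d"
  shows "(\<Sum>es\<in>residue_lists p k. add_char p (shifted_exponent p d s (list_fps es))) = 0"
proof -
  let ?C = "\<lambda>G. \<Sum>j\<in>{1..<d}. int (d choose j) * s ^ (d - j) * pw p G j"
  have "{1..d} = insert d {1..<d}" using d by auto
  then have "shifted_exponent p d s G = pw p G d + ?C G" for G by (simp add: shifted_exponent_def)
  moreover have "(\<Sum>es\<in>residue_lists p k. add_char p (pw p (list_fps es) d + ?C (list_fps es))) = 0"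
  proof (rule sum_add_char_pw_vanish[OF assms])
    fix F G :: "int fps" assume FG: "\<And>i. i < d \<Longrightarrow> fps_nth F i = fps_nth G i"
    show "?C F = ?C G"
    proof (rule sum.cong[OF refl])
      fix j assume "j \<in> {1..<d}"
      then have "pw p F j = pw p G j" by (intro pw_local FG) simp
      then show "int (d choose j) * s ^ (d - j) * pw p F j = int (d choose j) * s ^ (d - j) * pw p G j" by simp
    qed
  qed
  ultimately show ?thesis by simp
qed

section \<open>The characters and their \<open>L\<close>-functions\<close>

text \<open>For s = 0 this is the character of the overview; other \<open>s\<close> add lower power
  sums, which still depend only on f modulo X^(d+1). Nonzero constants have value 1, which causes
  the zero of the L-function at u = 1.\<close>

definition shift_char :: "nat \<Rightarrow> nat \<Rightarrow> int \<Rightarrow> int list \<Rightarrow> complex" where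
  "shift_char p d s f = (if int p dvd poly.coeff (int_poly f) 0 then 0
     else add_char p (shifted_exponent p d s (fps_of_poly (int_poly f))))"

lemma shifted_exponent_cong:
  assumes "\<And>j. 1 \<le> j \<Longrightarrow> j \<le> d \<Longrightarrow> int p dvd pw p F j - (pw p G j + pw p H j)"
  shows "add_char p (shifted_exponent p d s F) = add_char p (shifted_exponent p d s G) * add_char p (shifted_exponent p d s H)"
proof -
  have "shifted_exponent p d s F - (shifted_exponent p d s G + shifted_exponent p d s H) =
      (\<Sum>j=1..d. int (d choose j) * s ^ (d - j) * (pw p F j - (pw p G j + pw p H j)))"
    by (simp only: shifted_exponent_def sum_subtractf sum.distrib right_diff_distrib distrib_left)
  also have "int p dvd \<dots>" by (intro dvd_sum dvd_mult) (use assms in auto)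
  finally show ?thesis unfolding add_char_add[symmetric] by (rule add_char_eqI)
qed

context residues_prime
begin

lemma shift_char_mult:
  assumes f: "f \<in> carrier PR" and g: "g \<in> carrier PR"
  shows "shift_char p d s (f \<otimes>\<^bsub>PR\<^esub> g) = shift_char p d s f * shift_char p d s g"
proof (cases "int p dvd poly.coeff (int_poly f) 0 \<or> int p dvd poly.coeff (int_poly g) 0")
  case True
  then show ?thesis unfolding shift_char_def coeff_0_mult[OF f g] by auto
next
  case False
  then have n: "\<not> int p dvd poly.coeff (int_poly f) 0" "\<not> int p dvd poly.coeff (int_poly g) 0" by auto
  have "add_char p (shifted_exponent p d s (poly_fps (f \<otimes>\<^bsub>PR\<^esub> g))) =
    add_char p (shifted_exponent p d s (poly_fps f)) * add_char p (shifted_exponent p d s (poly_fps g))"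
    by (rule shifted_exponent_cong) (rule pw_poly_mult[OF f n(1) g n(2)])
  then show ?thesis using False unfolding shift_char_def coeff_0_mult[OF f g] by simp
qed

lemma shift_char_local:
  assumes "\<And>i. i \<le> d \<Longrightarrow> poly.coeff (int_poly f) i = poly.coeff (int_poly g) i"
  shows "shift_char p d s f = shift_char p d s g"
proof -
  have "pw p (poly_fps f) j = pw p (poly_fps g) j" if "j \<in> {1..d}" for j
    by (rule pw_local) (use that assms in auto)
  then have "shifted_exponent p d s (poly_fps f) = shifted_exponent p d s (poly_fps g)"
    unfolding shifted_exponent_def by (intro sum.cong) auto
  then show ?thesis using assms[of 0] by (simp add: shift_char_def)
qed

lemma norm_shift_char: "cmod (shift_char p d s f) \<le> 1"
  by (simp add: shift_char_def)

lemma shift_char_one: "shift_char p d s \<one>\<^bsub>PR\<^esub> = 1"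
proof -
  have eq: "poly_fps \<one>\<^bsub>PR\<^esub> = fps_const 1" by (simp add: univ_poly_one int_poly_def res_one_eq)
  have "\<not> int p dvd 1" using p_prime by auto
  moreover have "poly.coeff (int_poly \<one>\<^bsub>PR\<^esub>) 0 = 1" by (simp add: coeff_int_poly univ_poly_one res_one_eq)
  moreover have "shifted_exponent p d s (fps_const 1) = 0" unfolding shifted_exponent_def pw_const by simp
  ultimately show ?thesis unfolding shift_char_def eq by simp
qed

lemma int_poly_range: "f \<in> carrier PR \<Longrightarrow> poly.coeff (int_poly f) i \<in> {0..<int p}"
proof -
  assume f: "f \<in> carrier PR"
  have "i < length f \<Longrightarrow> f ! (length f - 1 - i) \<in> set f" by (rule nth_mem) simp
  then have "i < length f \<Longrightarrow> f ! (length f - 1 - i) \<in> {0..<int p}" using set_poly_ring[OF f] by blast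
  then show ?thesis using prime_gt_0_nat[OF p_prime] by (simp add: coeff_int_poly)
qed

lemma int_poly_eqI:
  assumes "f \<in> carrier PR" "g \<in> carrier PR" "int p dvd poly.coeff (int_poly f) i - poly.coeff (int_poly g) i"
  shows "poly.coeff (int_poly f) i = poly.coeff (int_poly g) i"
proof -
  have "poly.coeff (int_poly f) i mod int p = poly.coeff (int_poly g) i mod int p"
    using assms(3) by (simp only: mod_eq_dvd_iff)
  then show ?thesis using int_poly_range[OF assms(1), of i] int_poly_range[OF assms(2), of i] by simp
qed

lemma dvd_int_poly_iff: "f \<in> carrier PR \<Longrightarrow> int p dvd poly.coeff (int_poly f) i \<longleftrightarrow> poly.coeff (int_poly f) i = 0"
  using int_poly_range[of f i] by (auto dest: zdvd_imp_le)

lemma int_poly_var_pow: "int_poly (\<one> # replicate n \<zero>) = Polynomial.monom 1 n"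
  by (rule poly_eqI) (auto simp: coeff_int_poly nth_Cons' res_zero_eq res_one_eq)

lemma var_pow_closed': "\<one> # replicate n \<zero> \<in> carrier PR"
  using var_pow_closed[OF carrier_is_subring, of n] by (simp add: var_pow_eq)

lemma residue_class_var_pow_coeff:
  assumes f: "f \<in> carrier PR" and g: "g \<in> carrier PR"
    and eq: "residue_class R (\<one> # replicate N \<zero>) f = residue_class R (\<one> # replicate N \<zero>) g" and i: "i < N"
  shows "poly.coeff (int_poly f) i = poly.coeff (int_poly g) i"
proof -
  interpret UP: cring PR by (rule univ_poly_is_cring[OF carrier_is_subring])
  let ?X = "\<one> # replicate N \<zero>"
  have X: "?X \<in> carrier PR" by (rule var_pow_closed')
  have "?X divides\<^bsub>PR\<^esub> (f \<ominus>\<^bsub>PR\<^esub> g)"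
    using rupture_surj_eq_iff[OF X f g] eq unfolding residue_class_def by simp
  then obtain q where q: "q \<in> carrier PR" "f \<ominus>\<^bsub>PR\<^esub> g = ?X \<otimes>\<^bsub>PR\<^esub> q" unfolding factor_def by blast
  have Xq: "?X \<otimes>\<^bsub>PR\<^esub> q \<in> carrier PR" by (rule UP.m_closed[OF X q(1)])
  have "f = (f \<ominus>\<^bsub>PR\<^esub> g) \<oplus>\<^bsub>PR\<^esub> g"
    unfolding UP.minus_eq UP.a_assoc[OF f UP.a_inv_closed[OF g] g] UP.l_neg[OF g] UP.r_zero[OF f] ..
  then have "f = (?X \<otimes>\<^bsub>PR\<^esub> q) \<oplus>\<^bsub>PR\<^esub> g" unfolding q(2) .
  then have 1: "int p dvd poly.coeff (int_poly f) i - (poly.coeff (int_poly (?X \<otimes>\<^bsub>PR\<^esub> q)) i + poly.coeff (int_poly g) i)"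
    using int_poly_add[OF Xq g, of i] by simp
  have 2: "int p dvd poly.coeff (int_poly (?X \<otimes>\<^bsub>PR\<^esub> q)) i"
    using int_poly_mult[OF X q(1), of i] i unfolding int_poly_var_pow by (simp add: coeff_monom_mult)
  show ?thesis using int_poly_eqI[OF f g] dvd_add[OF 1 2] by simp
qed

lemma divides_coeff_0:
  assumes "d divides\<^bsub>PR\<^esub> f" "d \<in> carrier PR" "int p dvd poly.coeff (int_poly d) 0"
  shows "int p dvd poly.coeff (int_poly f) 0"
proof -
  obtain q where q: "q \<in> carrier PR" "f = d \<otimes>\<^bsub>PR\<^esub> q" using assms(1) unfolding factor_def by blast
  show ?thesis using assms(3) unfolding q(2) coeff_0_mult[OF assms(2) q(1)] by simp
qed

lemma var_divides:
  assumes f: "f \<in> carrier PR" "int p dvd poly.coeff (int_poly f) 0"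
  shows "\<exists>q\<in>carrier PR. f = q \<otimes>\<^bsub>PR\<^esub> X"
proof (cases "f = []")
  case True
  have z: "[] \<in> carrier PR" by (rule univ_poly_zero_closed)
  show ?thesis using poly_mult_var[OF carrier_is_subring z] z True by (intro bexI[of _ "[]"]) simp_all
next
  case False
  have "last f = 0" using f False dvd_int_poly_iff[OF f(1), of 0] by (simp add: coeff_int_poly last_conv_nth)
  then have eq: "f = butlast f @ [\<zero>]" using append_butlast_last_id[OF False] by (simp add: res_zero_eq)
  have pf: "polynomial (carrier R) f" using f by (simp add: univ_poly_carrier)
  have ne: "butlast f \<noteq> []"
  proof
    assume "butlast f = []"
    then have "hd f = \<zero>" using eq by (metis append_Nil list.sel(1))
    then show False using hd_in_carrier[OF f(1) False] by simp
  qed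
  have "hd (butlast f) = hd f" using ne by (cases f) auto
  then have b: "butlast f \<in> carrier PR"
    using pf ne False unfolding univ_poly_carrier[symmetric] polynomial_def by (auto dest: in_set_butlastD)
  show ?thesis using poly_mult_var[OF carrier_is_subring b] ne eq b by (intro bexI[of _ "butlast f"]) auto
qed

text \<open>A nonconstant common divisor has an irreducible factor, which divides a power of X and
  hence X itself.\<close>

lemma coprime_var_pow_iff:
  assumes f: "f \<in> carrier PR" and N: "N > 0"
  shows "coprime_poly R f (\<one> # replicate N \<zero>) \<longleftrightarrow> \<not> int p dvd poly.coeff (int_poly f) 0"
proof
  have var: "X \<in> carrier PR" by (rule var_closed(1)[OF carrier_is_subring])
  assume cop: "coprime_poly R f (\<one> # replicate N \<zero>)"
  show "\<not> int p dvd poly.coeff (int_poly f) 0"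
  proof
    assume *: "int p dvd poly.coeff (int_poly f) 0"
    interpret UP: cring PR by (rule univ_poly_is_cring[OF carrier_is_subring])
    have "X divides\<^bsub>PR\<^esub> h" if h: "h \<in> carrier PR" "int p dvd poly.coeff (int_poly h) 0" for h
      using var_divides[OF h] UP.m_comm[OF var] unfolding factor_def by metis
    moreover have "int p dvd poly.coeff (int_poly (\<one> # replicate N \<zero>)) 0"
      unfolding int_poly_var_pow using N by simp
    ultimately have "X \<in> Units PR"
      using cop var * f var_pow_closed'[of N] unfolding coprime_poly_def by blast
    then show False unfolding univ_poly_carrier_units by (auto simp: var_def)
  qed
next
  assume *: "\<not> int p dvd poly.coeff (int_poly f) 0"
  show "coprime_poly R f (\<one> # replicate N \<zero>)"
    unfolding coprime_poly_def
  proof (intro ballI impI, elim conjE)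
    fix d assume d: "d \<in> carrier PR" "d divides\<^bsub>PR\<^esub> f" "d divides\<^bsub>PR\<^esub> (\<one> # replicate N \<zero>)"
    have d0: "\<not> int p dvd poly.coeff (int_poly d) 0" using divides_coeff_0[OF d(2,1)] * by blast
    then have "d \<noteq> []" by (auto simp: coeff_int_poly)
    have "length d \<le> 1"
    proof (rule ccontr)
      assume "\<not> length d \<le> 1"
      then obtain \<pi> where \<pi>: "\<pi> \<in> monic_irreducibles R" "\<pi> divides\<^bsub>PR\<^esub> d"
        using monic_irreducible_dividing[OF d(1)] by auto
      have c: "\<pi> \<in> carrier PR" by (rule monic_irreducibleD[OF \<pi>(1)])
      interpret UP: cring PR by (rule univ_poly_is_cring[OF carrier_is_subring])
      have var: "X \<in> carrier PR" by (rule var_closed(1)[OF carrier_is_subring])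
      have "\<pi> divides\<^bsub>PR\<^esub> (X [^]\<^bsub>PR\<^esub> N)"
        unfolding var_pow_eq by (rule UP.divides_trans[OF \<pi>(2) d(3) c])
      moreover have "\<not> \<pi> divides\<^bsub>PR\<^esub> (X [^]\<^bsub>PR\<^esub> n)" for n :: nat
      proof (induction n)
        case 0
        then show ?case using not_monic_irreducible_divides_one[OF \<pi>(1)] by simp
      next
        case (Suc n)
        have "\<not> int p dvd poly.coeff (int_poly \<pi>) 0" using divides_coeff_0[OF \<pi>(2) c] d0 by blast
        then have "\<not> \<pi> divides\<^bsub>PR\<^esub> X" by (rule not_divides_var[OF \<pi>(1)])
        then show ?case
          using Suc monic_irreducible_divides_mult[OF \<pi>(1) UP.nat_pow_closed[OF var, of n] var] by simp
      qed
      ultimately show False by blast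
    qed
    then have "length d = 1" using \<open>d \<noteq> []\<close> by (cases d) auto
    then show "d \<in> Units PR" using d(1) \<open>d \<noteq> []\<close> univ_poly_units'[OF carrier_is_subfield, of d] by simp
  qed
qed

end

section \<open>The Dirichlet characters modulo powers of X\<close>

context residues_prime
begin

lemma residue_class_mult:
  assumes g: "g \<in> carrier PR" and f: "f \<in> carrier PR" "f' \<in> carrier PR"
  shows "residue_class R g f \<otimes>\<^bsub>Rupt (carrier R) g\<^esub> residue_class R g f' = residue_class R g (f \<otimes>\<^bsub>PR\<^esub> f')"
  using ring_hom_mult[OF rupture_surj_hom(1)[OF carrier_is_subring g] f] unfolding residue_class_def by simp

lemma ex_residue_class:
  assumes g: "g \<in> carrier PR" and C: "C \<in> carrier (Rupt (carrier R) g)"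
  shows "\<exists>f\<in>carrier PR. C = residue_class R g f"
  using C unfolding residue_class_def rupture_def FactRing_def A_RCOSETS_def' by auto

lemma residue_units_Rupt: "residue_units R g = units_of (Rupt (carrier R) g)"
  by (simp add: residue_units_def rupture_def)

text \<open>The choice of representative is harmless: congruent polynomials share the coefficients
  up to index d, and these determine the value.\<close>

definition shift_char_class :: "nat \<Rightarrow> int \<Rightarrow> int list set \<Rightarrow> complex" where
  "shift_char_class d s C = shift_char p d s (SOME f. f \<in> carrier PR \<and> residue_class R (\<one> # replicate (Suc d) \<zero>) f = C)"

lemma shift_char_class_eq:
  assumes f: "f \<in> carrier PR"
  shows "shift_char_class d s (residue_class R (\<one> # replicate (Suc d) \<zero>) f) = shift_char p d s f"
proof -
  let ?g = "\<one> # replicate (Suc d) \<zero>"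
  define f' where "f' = (SOME f'. f' \<in> carrier PR \<and> residue_class R ?g f' = residue_class R ?g f)"
  have "f' \<in> carrier PR \<and> residue_class R ?g f' = residue_class R ?g f"
    unfolding f'_def by (rule someI[of _ f]) (use f in simp)
  then have "shift_char p d s f' = shift_char p d s f"
    by (intro shift_char_local residue_class_var_pow_coeff[of f' f "Suc d"]) (use f in auto)
  then show ?thesis unfolding shift_char_class_def f'_def .
qed

lemma residue_units_one: "\<one>\<^bsub>Rupt (carrier R) g\<^esub> = residue_class R g \<one>\<^bsub>PR\<^esub>" if "g \<in> carrier PR"
  using ring_hom_one[OF rupture_surj_hom(1)[OF carrier_is_subring that]] unfolding residue_class_def by simp

lemma arises_from_shift_char:
  "arises_from R (\<one> # replicate (Suc d) \<zero>) (shift_char p d s) (shift_char_class d s)"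
  unfolding arises_from_def
proof (intro conjI ballI)
  let ?g = "\<one> # replicate (Suc d) \<zero>"
  have g: "?g \<in> carrier PR" by (rule var_pow_closed')
  fix f assume f: "f \<in> carrier PR"
  show "shift_char p d s f = (if coprime_poly R f ?g then shift_char_class d s (residue_class R ?g f) else 0)"
    unfolding coprime_var_pow_iff[OF f zero_less_Suc] shift_char_class_eq[OF f] by (simp add: shift_char_def)
next
  let ?g = "\<one> # replicate (Suc d) \<zero>" and ?\<psi> = "shift_char_class d s"
  let ?Q = "Rupt (carrier R) ?g"
  have g: "?g \<in> carrier PR" by (rule var_pow_closed')
  interpret P: cring PR by (rule univ_poly_is_cring[OF carrier_is_subring])
  have mult: "?\<psi> (C \<otimes>\<^bsub>?Q\<^esub> C') = ?\<psi> C * ?\<psi> C'" if C: "C \<in> carrier ?Q" "C' \<in> carrier ?Q" for C C'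
  proof -
    from ex_residue_class[OF g C(1)] obtain f where f: "f \<in> carrier PR" "C = residue_class R ?g f" by blast
    from ex_residue_class[OF g C(2)] obtain f' where f': "f' \<in> carrier PR" "C' = residue_class R ?g f'" by blast
    show ?thesis
      unfolding f(2) f'(2) residue_class_mult[OF g f(1) f'(1)] shift_char_class_eq[OF f(1)]
        shift_char_class_eq[OF f'(1)] shift_char_class_eq[OF P.m_closed[OF f(1) f'(1)]]
      by (rule shift_char_mult[OF f(1) f'(1)])
  qed
  have one: "?\<psi> \<one>\<^bsub>?Q\<^esub> = 1"
    unfolding residue_units_one[OF g] shift_char_class_eq[OF one_poly_closed] by (rule shift_char_one)
  show "?\<psi> \<in> hom (residue_units R ?g) complex_units"
    unfolding residue_units_Rupt
  proof (rule homI)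
    fix C assume "C \<in> carrier (units_of ?Q)"
    then obtain C' where C: "C \<in> carrier ?Q" "C' \<in> carrier ?Q" "C \<otimes>\<^bsub>?Q\<^esub> C' = \<one>\<^bsub>?Q\<^esub>"
      unfolding units_of_carrier Units_def by blast
    then have "?\<psi> C * ?\<psi> C' = 1" using mult[OF C(1,2)] one by simp
    then have "?\<psi> C \<noteq> 0" by auto
    then show "?\<psi> C \<in> carrier complex_units" by (simp add: complex_units_def)
    fix C'' assume "C'' \<in> carrier (units_of ?Q)"
    then have "C'' \<in> carrier ?Q" unfolding units_of_carrier Units_def by blast
    from mult[OF C(1) this]
    show "?\<psi> (C \<otimes>\<^bsub>units_of ?Q\<^esub> C'') = ?\<psi> C \<otimes>\<^bsub>complex_units\<^esub> ?\<psi> C''"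
      by (simp add: units_of_mult complex_units_def)
  qed
qed

lemma dirichlet_shift_char: "dirichlet_character R (\<one> # replicate (Suc d) \<zero>) (shift_char p d s)"
  unfolding dirichlet_character_def univ_poly_zero using arises_from_shift_char var_pow_closed' by blast

text \<open>The value at \<open>1 + X\<^bsup>d\<^esup>\<close> witnesses both non-triviality and primitivity.\<close>

lemma shift_char_one_plus_var_pow:
  assumes d: "d > 0" "\<not> p dvd d"
  shows "shift_char p d s (\<one>\<^bsub>PR\<^esub> \<oplus>\<^bsub>PR\<^esub> (\<one> # replicate d \<zero>)) \<noteq> 1"
    and "\<not> int p dvd poly.coeff (int_poly (\<one>\<^bsub>PR\<^esub> \<oplus>\<^bsub>PR\<^esub> (\<one> # replicate d \<zero>))) 0"
proof -
  let ?f = "\<one>\<^bsub>PR\<^esub> \<oplus>\<^bsub>PR\<^esub> (\<one> # replicate d \<zero>)"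
  have X: "\<one> # replicate d \<zero> \<in> carrier PR" by (rule var_pow_closed')
  define G :: "int fps" where "G = 1 + fps_X ^ d"
  have np: "\<not> int p dvd 1" using p_prime by auto
  have one: "int_poly \<one>\<^bsub>PR\<^esub> = 1" by (simp add: univ_poly_one int_poly_def res_one_eq)
  have cong: "int p dvd poly.coeff (int_poly ?f) i - fps_nth G i" for i
  proof -
    have "fps_nth G i = poly.coeff 1 i + poly.coeff (Polynomial.monom 1 d) i"
      by (auto simp: G_def coeff_1 fps_X_power_nth)
    then show ?thesis
      using int_poly_add[OF one_poly_closed X, of i] unfolding one int_poly_var_pow coeff_add by simp
  qed
  have G0: "fps_nth G 0 = 1" using d by (simp add: G_def fps_X_power_nth)
  have "poly.coeff (int_poly ?f) 0 mod int p = 1 mod int p"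
    using cong[of 0] unfolding G0 by (simp only: mod_eq_dvd_iff)
  then show f0: "\<not> int p dvd poly.coeff (int_poly ?f) 0" using np by (simp only: dvd_eq_mod_eq_0 not_False_eq_True)
  have "int p dvd pw p (poly_fps ?f) j - pw p G j" for j
    by (rule pw_cong[OF p_prime]) (use np cong in \<open>simp_all add: G0 fps_const_dvd_iff\<close>)
  then have "add_char p (shifted_exponent p d s (poly_fps ?f)) =
      add_char p (shifted_exponent p d s G) * add_char p (shifted_exponent p d s (fps_const 1))"
    by (intro shifted_exponent_cong) (simp only: pw_const add_0_right)
  also have "shifted_exponent p d s (fps_const 1) = 0" unfolding shifted_exponent_def pw_const by simp
  also have "shifted_exponent p d s G = - int d"
  proof -
    have "pw p G j = - int j * fps_nth G j" if "j \<in> {1..d}" for j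
      by (rule pw_one_plus_high[of _ "d - 1"]) (use that G0 d in \<open>auto simp: G_def fps_X_power_nth\<close>)
    then have "shifted_exponent p d s G = (\<Sum>j=1..d. if j = d then - int d else 0)"
      unfolding shifted_exponent_def by (intro sum.cong) (auto simp: G_def fps_X_power_nth)
    then show ?thesis using d by simp
  qed
  finally have "add_char p (shifted_exponent p d s (poly_fps ?f)) = add_char p (- int d)" by simp
  moreover have "add_char p (- int d) \<noteq> 1" by (rule add_char_neq_1) (use d p_prime prime_gt_0_nat in auto)
  ultimately show "shift_char p d s ?f \<noteq> 1" using f0 by (simp add: shift_char_def)
qed

lemma nontrivial_shift_char:
  assumes d: "d > 0" "\<not> p dvd d"
  shows "nontrivial_character R (\<one> # replicate (Suc d) \<zero>) (shift_char p d s)"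
proof -
  let ?g = "\<one> # replicate (Suc d) \<zero>"
  let ?Q = "Rupt (carrier R) ?g"
  let ?X = "\<one> # replicate d \<zero>"
  let ?f = "\<one>\<^bsub>PR\<^esub> \<oplus>\<^bsub>PR\<^esub> ?X" and ?f' = "\<one>\<^bsub>PR\<^esub> \<ominus>\<^bsub>PR\<^esub> ?X"
  interpret P: cring PR by (rule univ_poly_is_cring[OF carrier_is_subring])
  have var: "X \<in> carrier PR" by (rule var_closed(1)[OF carrier_is_subring])
  have X: "?X \<in> carrier PR" and g: "?g \<in> carrier PR" by (rule var_pow_closed')+
  have f: "?f \<in> carrier PR" "?f' \<in> carrier PR" using X by simp_all
  \<comment> \<open>As 2 d \<ge> d + 1, the square of X^d vanishes in the quotient, so 1 - X^d
    inverts the witness 1 + X^d.\<close>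
  have "?X \<otimes>\<^bsub>PR\<^esub> ?X = ?g \<otimes>\<^bsub>PR\<^esub> (X [^]\<^bsub>PR\<^esub> (d - 1))"
    unfolding var_pow_eq[symmetric] P.nat_pow_mult[OF var] using d(1) by (simp add: var_pow_eq)
  then have dv: "?g divides\<^bsub>PR\<^esub> (?X \<otimes>\<^bsub>PR\<^esub> ?X)"
    unfolding factor_def using P.nat_pow_closed[OF var, of "d - 1"] by blast
  have "?f \<otimes>\<^bsub>PR\<^esub> ?f' \<ominus>\<^bsub>PR\<^esub> \<one>\<^bsub>PR\<^esub> = \<ominus>\<^bsub>PR\<^esub> (?X \<otimes>\<^bsub>PR\<^esub> ?X)"
    using X P.one_closed by algebra
  moreover have "?g divides\<^bsub>PR\<^esub> (\<ominus>\<^bsub>PR\<^esub> (?X \<otimes>\<^bsub>PR\<^esub> ?X))"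
  proof -
    obtain q where q: "q \<in> carrier PR" "?X \<otimes>\<^bsub>PR\<^esub> ?X = ?g \<otimes>\<^bsub>PR\<^esub> q" using dv unfolding factor_def by blast
    have "\<ominus>\<^bsub>PR\<^esub> (?X \<otimes>\<^bsub>PR\<^esub> ?X) = ?g \<otimes>\<^bsub>PR\<^esub> (\<ominus>\<^bsub>PR\<^esub> q)"
      unfolding q(2) by (rule P.r_minus[OF g q(1), symmetric])
    then show ?thesis unfolding factor_def using P.a_inv_closed[OF q(1)] by blast
  qed
  ultimately have "residue_class R ?g (?f \<otimes>\<^bsub>PR\<^esub> ?f') = residue_class R ?g \<one>\<^bsub>PR\<^esub>"
    using rupture_surj_eq_iff[OF g P.m_closed[OF f] P.one_closed] unfolding residue_class_def by simp
  then have inv1: "residue_class R ?g ?f \<otimes>\<^bsub>?Q\<^esub> residue_class R ?g ?f' = \<one>\<^bsub>?Q\<^esub>"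
    unfolding residue_class_mult[OF g f] residue_units_one[OF g] .
  have inv2: "residue_class R ?g ?f' \<otimes>\<^bsub>?Q\<^esub> residue_class R ?g ?f = \<one>\<^bsub>?Q\<^esub>"
    using inv1 unfolding residue_class_mult[OF g f] residue_class_mult[OF g f(2,1)] P.m_comm[OF f(2,1)] .
  have cl: "residue_class R ?g h \<in> carrier ?Q" if "h \<in> carrier PR" for h
    using ring_hom_closed[OF rupture_surj_hom(1)[OF carrier_is_subring g] that] unfolding residue_class_def .
  have "residue_class R ?g ?f \<in> carrier (residue_units R ?g)"
    unfolding residue_units_Rupt units_of_carrier Units_def using inv1 inv2 cl[OF f(1)] cl[OF f(2)] by blast
  moreover have "shift_char_class d s (residue_class R ?g ?f) \<noteq> 1"
    unfolding shift_char_class_eq[OF f(1)] by (rule shift_char_one_plus_var_pow(1)[OF d])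
  ultimately show ?thesis unfolding nontrivial_character_def using arises_from_shift_char by blast
qed

lemma primitive_shift_char:
  assumes d: "d > 0" "\<not> p dvd d"
  shows "primitive_character R (\<one> # replicate (Suc d) \<zero>) (shift_char p d s)"
  unfolding primitive_character_def
proof
  let ?g = "\<one> # replicate (Suc d) \<zero>"
  let ?X = "\<one> # replicate d \<zero>"
  let ?f = "\<one>\<^bsub>PR\<^esub> \<oplus>\<^bsub>PR\<^esub> ?X"
  interpret P: domain PR by (rule univ_poly_is_domain[OF carrier_is_subring])
  have var: "X \<in> carrier PR" by (rule var_closed(1)[OF carrier_is_subring])
  have X: "?X \<in> carrier PR" and g: "?g \<in> carrier PR" by (rule var_pow_closed')+
  have f: "?f \<in> carrier PR" using X by simp
  assume "\<exists>h\<in>carrier PR. properfactor PR h ?g \<and> definable_modulo R ?g (shift_char p d s) h"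
  then obtain h where h: "h \<in> carrier PR" "h divides\<^bsub>PR\<^esub> ?g" "\<not> ?g divides\<^bsub>PR\<^esub> h"
    and def: "definable_modulo R ?g (shift_char p d s) h"
    unfolding properfactor_def by blast
  obtain q where q: "q \<in> carrier PR" "?g = h \<otimes>\<^bsub>PR\<^esub> q" using h(2) unfolding factor_def by blast
  \<comment> \<open>The nonunit cofactor q of a proper divisor h divides a power of X, so it is
    divisible by X. Hence h divides X^d, and 1 + X^d is congruent to 1 modulo h although the
    character separates them.\<close>
  have "q \<notin> Units PR"
  proof
    assume qU: "q \<in> Units PR"
    then have i: "inv\<^bsub>PR\<^esub> q \<in> carrier PR" by (rule P.Units_inv_closed)
    have "h = ?g \<otimes>\<^bsub>PR\<^esub> inv\<^bsub>PR\<^esub> q"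
      unfolding q(2) P.m_assoc[OF h(1) q(1) i] P.Units_r_inv[OF qU] P.r_one[OF h(1)] ..
    then show False using h(3) i unfolding factor_def by blast
  qed
  moreover have "q divides\<^bsub>PR\<^esub> ?g" unfolding factor_def using q h(1) P.m_comm[OF h(1) q(1)] by auto
  ultimately have "\<not> coprime_poly R q ?g" unfolding coprime_poly_def using P.divides_refl[OF q(1)] q(1) by blast
  then have "int p dvd poly.coeff (int_poly q) 0" using coprime_var_pow_iff[OF q(1), of "Suc d"] by simp
  then obtain q' where q': "q' \<in> carrier PR" "q = q' \<otimes>\<^bsub>PR\<^esub> X" using var_divides[OF q(1)] by blast
  have "?X \<otimes>\<^bsub>PR\<^esub> X = (h \<otimes>\<^bsub>PR\<^esub> q') \<otimes>\<^bsub>PR\<^esub> X"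
    using q(2) unfolding q'(2) P.m_assoc[OF h(1) q'(1) var] var_pow_eq[symmetric] by simp
  moreover have "X \<noteq> \<zero>\<^bsub>PR\<^esub>" by (simp add: univ_poly_zero var_def)
  ultimately have Xd: "?X = h \<otimes>\<^bsub>PR\<^esub> q'"
    using P.m_rcancel[OF _ var X P.m_closed[OF h(1) q'(1)]] by blast
  have "?f \<ominus>\<^bsub>PR\<^esub> \<one>\<^bsub>PR\<^esub> = ?X" using X P.one_closed by algebra
  then have "h divides\<^bsub>PR\<^esub> (?f \<ominus>\<^bsub>PR\<^esub> \<one>\<^bsub>PR\<^esub>)" unfolding factor_def using Xd q'(1) by auto
  then have cls: "residue_class R h ?f = residue_class R h \<one>\<^bsub>PR\<^esub>"
    using rupture_surj_eq_iff[OF h(1) f P.one_closed] unfolding residue_class_def by simp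
  obtain \<psi> where \<psi>: "\<And>f. f \<in> carrier PR \<Longrightarrow> coprime_poly R f ?g \<Longrightarrow> shift_char p d s f = \<psi> (residue_class R h f)"
    using def unfolding definable_modulo_def by blast
  have "shift_char p d s ?f = \<psi> (residue_class R h ?f)"
    by (rule \<psi>[OF f]) (use shift_char_one_plus_var_pow(2)[OF d] coprime_var_pow_iff[OF f, of "Suc d"] in simp)
  also have "\<dots> = shift_char p d s \<one>\<^bsub>PR\<^esub>"
    unfolding cls
  proof (rule \<psi>[OF P.one_closed, symmetric])
    have "poly.coeff (int_poly \<one>\<^bsub>PR\<^esub>) 0 = 1" by (simp add: coeff_int_poly univ_poly_one res_one_eq)
    moreover have "\<not> int p dvd 1" using p_prime by auto
    ultimately show "coprime_poly R \<one>\<^bsub>PR\<^esub> ?g" using coprime_var_pow_iff[OF P.one_closed, of "Suc d"] by simp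
  qed
  also have "\<dots> = 1" by (rule shift_char_one)
  finally show False using shift_char_one_plus_var_pow(1)[OF d] by blast
qed

end

text \<open>For a monic f with coefficients 1 # cs, leading one first, this is f / f(0) written from
  the constant coefficient 1 upward, with that 1 dropped. It translates between the monic
  normalization of the L-series and the normalization of the power sums.\<close>

definition monic_reverse :: "nat \<Rightarrow> int list \<Rightarrow> int list" where
  "monic_reverse p cs = tl (map (\<lambda>x. x * last (1 # cs) ^ (p - 2) mod int p) (rev (1 # cs)))"

text \<open>These lists play two roles: as \<open>1 # cs\<close> they are the monic polynomials of
  degree k prime to X, as arguments of \<open>list_fps\<close> the polynomials of degree exactly k.
  Prepending 1 covers k = 0.\<close>

definition unit_constant_lists :: "nat \<Rightarrow> nat \<Rightarrow> int list set" where
  "unit_constant_lists p k = {cs \<in> residue_lists p k. last (1 # cs) \<noteq> 0}"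

context
  fixes p :: nat
  assumes p: "prime p"
  notes last.simps [simp del]
begin

lemma unit_constantD:
  assumes cs: "cs \<in> unit_constant_lists p k"
  shows "length cs = k" "set (1 # cs) \<subseteq> {0..<int p}" "\<not> int p dvd last (1 # cs)"
proof -
  show 1: "length cs = k" "set (1 # cs) \<subseteq> {0..<int p}"
    using cs prime_gt_1_nat[OF p] by (auto simp: unit_constant_lists_def residue_lists_def)
  have "last (1 # cs) \<in> set (1 # cs)" by (rule last_in_set) simp
  then have l: "last (1 # cs) \<in> {0..<int p}" by (rule subsetD[OF 1(2)])
  have "last (1 # cs) \<noteq> 0" using cs by (simp add: unit_constant_lists_def)
  with l show "\<not> int p dvd last (1 # cs)" by (auto dest: zdvd_imp_le)
qed

lemma Cons_monic_reverse:
  assumes cs: "cs \<in> unit_constant_lists p k"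
  shows "1 # monic_reverse p cs = map (\<lambda>x. x * last (1 # cs) ^ (p - 2) mod int p) (rev (1 # cs))"
proof -
  let ?c = "last (1 # cs)"
  let ?L = "map (\<lambda>x. x * ?c ^ (p - 2) mod int p) (rev (1 # cs))"
  have ne: "?L \<noteq> []" by simp
  have "hd (rev (1 # cs)) = ?c" by (rule hd_rev)
  then have "hd ?L = ?c * ?c ^ (p - 2) mod int p" by (subst hd_map) simp_all
  also have "\<dots> = 1"
    using int_inverse_mod_prime[OF p unit_constantD(3)[OF cs]] prime_gt_1_nat[OF p] by (simp add: cong_def)
  finally show ?thesis unfolding monic_reverse_def using hd_Cons_tl[OF ne] by simp
qed

lemma last_Cons_monic_reverse:
  assumes cs: "cs \<in> unit_constant_lists p k"
  shows "last (1 # monic_reverse p cs) = last (1 # cs) ^ (p - 2) mod int p"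
  unfolding Cons_monic_reverse[OF cs] by (simp add: last_map)

lemma monic_reverse_in:
  assumes cs: "cs \<in> unit_constant_lists p k"
  shows "monic_reverse p cs \<in> unit_constant_lists p k"
proof -
  let ?c = "last (1 # cs)"
  have p1: "int p > 1" using prime_gt_1_nat[OF p] by simp
  have len: "length (monic_reverse p cs) = k" using unit_constantD(1)[OF cs] by (simp add: monic_reverse_def)
  have "set (1 # monic_reverse p cs) \<subseteq> {0..<int p}"
    unfolding Cons_monic_reverse[OF cs] using p1 by auto
  then have "monic_reverse p cs \<in> residue_lists p k" using len by (simp add: residue_lists_def)
  moreover have "?c ^ (p - 2) mod int p \<noteq> 0"
  proof
    assume "?c ^ (p - 2) mod int p = 0"
    then have "int p dvd ?c * ?c ^ (p - 2)" by (intro dvd_mult) (simp add: dvd_eq_mod_eq_0)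
    then show False
      using int_inverse_mod_prime[OF p unit_constantD(3)[OF cs]] p1 by (simp add: cong_def dvd_eq_mod_eq_0)
  qed
  ultimately show ?thesis unfolding unit_constant_lists_def last_Cons_monic_reverse[OF cs, symmetric] by simp
qed

lemma monic_reverse_involution:
  assumes cs: "cs \<in> unit_constant_lists p k"
  shows "monic_reverse p (monic_reverse p cs) = cs"
proof -
  let ?c = "last (1 # cs)" and ?T = "monic_reverse p cs"
  let ?i = "?c ^ (p - 2)"
  have T: "?T \<in> unit_constant_lists p k" by (rule monic_reverse_in[OF cs])
  define j where "j = last (1 # ?T) ^ (p - 2)"
  have l: "last (1 # ?T) = ?i mod int p" by (rule last_Cons_monic_reverse[OF cs])
  have "[last (1 # ?T) * j = 1] (mod int p)"
    unfolding j_def by (rule int_inverse_mod_prime[OF p unit_constantD(3)[OF T]])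
  then have ij: "[?i * j = 1] (mod int p)" unfolding l by (simp add: cong_def mod_mult_left_eq)
  have "1 # monic_reverse p ?T = map (\<lambda>x. x * j mod int p) (rev (1 # ?T))"
    unfolding j_def by (rule Cons_monic_reverse[OF T])
  also have "\<dots> = map (\<lambda>x. (x * ?i mod int p) * j mod int p) (1 # cs)"
    unfolding Cons_monic_reverse[OF cs] by (simp add: rev_map[symmetric] o_def del: last.simps)
  also have "\<dots> = map (\<lambda>x. x) (1 # cs)"
  proof (rule map_cong[OF refl])
    fix x assume "x \<in> set (1 # cs)"
    then have x: "x \<in> {0..<int p}" using unit_constantD(2)[OF cs] by blast
    have "(x * ?i mod int p) * j mod int p = x * (?i * j) mod int p" by (simp only: mod_mult_left_eq mult.assoc)
    also have "\<dots> = x * 1 mod int p" using cong_mult[OF cong_refl ij, of x] unfolding cong_def .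
    also have "\<dots> = x" using x by simp
    finally show "(x * ?i mod int p) * j mod int p = x" .
  qed
  finally show ?thesis by simp
qed

end

section \<open>The L-series as a sum over monic polynomials\<close>

context residues_prime
begin

text \<open>The two polynomials differ by a constant factor, whose power sums vanish.\<close>

lemma shift_char_monic_reverse:
  assumes cs: "cs \<in> unit_constant_lists p k"
  shows "shift_char p d s (1 # cs) = add_char p (shifted_exponent p d s (list_fps (monic_reverse p cs)))"
proof -
  let ?c = "last (1 # cs)" and ?f = "1 # cs"
  let ?i = "?c ^ (p - 2)" and ?F = "list_fps (monic_reverse p cs)"
  note D = unit_constantD[OF p_prime cs]
  have c0: "poly.coeff (int_poly ?f) 0 = ?c" by (simp add: coeff_int_poly last_conv_nth)
  have np: "\<not> int p dvd 1" using p_prime by auto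
  have pi: "prime (int p)" using p_prime by simp
  have "\<not> int p dvd ?i" using D(3) pi prime_dvd_power by blast
  have len: "length (monic_reverse p cs) = k" by (rule unit_constantD(1)[OF p_prime monic_reverse_in[OF p_prime cs]])
  have nth: "fps_nth ?F n = (if n \<le> k then (1 # monic_reverse p cs) ! n else 0)" for n
    unfolding list_fps_nth len by (cases n) auto
  have cong: "fps_const (int p) dvd ?F - poly_fps ?f * fps_const ?i"
    unfolding fps_const_dvd_iff
  proof
    fix n
    show "int p dvd fps_nth (?F - poly_fps ?f * fps_const ?i) n"
    proof (cases "n \<le> k")
      case True
      have "(1 # monic_reverse p cs) ! n = rev ?f ! n * ?i mod int p"
        unfolding Cons_monic_reverse[OF p_prime cs] by (rule nth_map) (use True D(1) in simp)
      moreover have "rev ?f ! n = poly.coeff (int_poly ?f) n"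
        using True D(1) by (subst rev_nth) (simp_all add: coeff_int_poly)
      ultimately show ?thesis using True by (simp add: nth mod_eq_dvd_iff[symmetric])
    next
      case False
      then show ?thesis using D(1) by (simp add: nth coeff_int_poly)
    qed
  qed
  have "int p dvd pw p ?F j - (pw p (poly_fps ?f) j + pw p (fps_const ?i) j)" for j
  proof -
    have 1: "int p dvd pw p ?F j - pw p (poly_fps ?f * fps_const ?i) j"
      by (rule pw_cong[OF p_prime _ cong]) (use c0 D(3) \<open>\<not> int p dvd ?i\<close> pi in \<open>simp add: prime_dvd_mult_iff del: last.simps\<close>)
    have 2: "int p dvd pw p (poly_fps ?f * fps_const ?i) j - (pw p (poly_fps ?f) j + pw p (fps_const ?i) j)"
      by (rule pw_mult[OF p_prime]) (use c0 D(3) \<open>\<not> int p dvd ?i\<close> in \<open>simp_all del: last.simps\<close>)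
    show ?thesis using dvd_add[OF 1 2] by (simp only: add_diff_eq diff_add_cancel)
  qed
  then have "add_char p (shifted_exponent p d s ?F) =
      add_char p (shifted_exponent p d s (poly_fps ?f)) * add_char p (shifted_exponent p d s (fps_const ?i))"
    by (rule shifted_exponent_cong)
  also have "shifted_exponent p d s (fps_const ?i) = 0" unfolding shifted_exponent_def pw_const by simp
  finally show ?thesis using c0 D(3) by (simp add: shift_char_def del: last.simps)
qed

definition shift_sum :: "nat \<Rightarrow> int \<Rightarrow> nat \<Rightarrow> complex" where
  "shift_sum d s k = (\<Sum>es\<in>residue_lists p k. add_char p (shifted_exponent p d s (list_fps es)))"

text \<open>Degree exactly k is degree at most k minus degree at most k - 1: a list ending in 0
  encodes the same polynomial as the list without that entry.\<close>

lemma sum_unit_constant_lists: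
  "(\<Sum>es\<in>unit_constant_lists p k. add_char p (shifted_exponent p d s (list_fps es))) =
    shift_sum d s k - (if k = 0 then 0 else shift_sum d s (k - 1))"
proof (cases k)
  case 0
  then show ?thesis by (simp add: shift_sum_def unit_constant_lists_def)
next
  case (Suc j)
  let ?w = "\<lambda>es. add_char p (shifted_exponent p d s (list_fps es))"
  let ?Z = "(\<lambda>lo. lo @ [0]) ` residue_lists p j"
  have Z: "residue_lists p k = unit_constant_lists p k \<union> ?Z" "unit_constant_lists p k \<inter> ?Z = {}"
  proof -
    show "unit_constant_lists p k \<inter> ?Z = {}" by (auto simp: unit_constant_lists_def)
    show "residue_lists p k = unit_constant_lists p k \<union> ?Z"
    proof (intro equalityI subsetI)
      fix es assume es: "es \<in> residue_lists p k"
      then have ne: "es \<noteq> []" using Suc by (auto simp: residue_lists_def)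
      show "es \<in> unit_constant_lists p k \<union> ?Z"
      proof (cases "last es = 0")
        case True
        then have "es = butlast es @ [0]" using append_butlast_last_id[OF ne] by simp
        moreover have "butlast es \<in> residue_lists p j"
          using es Suc by (auto simp: residue_lists_def dest: in_set_butlastD)
        ultimately show ?thesis by blast
      qed (use es ne in \<open>simp add: unit_constant_lists_def\<close>)
    next
      fix es assume "es \<in> unit_constant_lists p k \<union> ?Z"
      then show "es \<in> residue_lists p k"
        using Suc prime_gt_0_nat[OF p_prime] by (auto simp: unit_constant_lists_def residue_lists_def subset_iff)
    qed
  qed
  have "list_fps (lo @ [0]) = list_fps lo" for lo
    by (rule fps_ext) (auto simp: list_fps_nth nth_append)
  then have "sum ?w ?Z = shift_sum d s j"
    unfolding shift_sum_def by (subst sum.reindex) (auto simp: inj_on_def)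
  moreover have "finite (unit_constant_lists p k)" by (simp add: unit_constant_lists_def)
  then have "shift_sum d s k = sum ?w (unit_constant_lists p k) + sum ?w ?Z"
    unfolding shift_sum_def Z(1) by (intro sum.union_disjoint) (use Z(2) in simp_all)
  ultimately show ?thesis using Suc by simp
qed

lemma sum_shift_char_monic:
  "(\<Sum>cs\<in>residue_lists p k. shift_char p d s (1 # cs)) =
    shift_sum d s k - (if k = 0 then 0 else shift_sum d s (k - 1))"
proof -
  have "shift_char p d s (1 # cs) = 0" if "cs \<in> residue_lists p k - unit_constant_lists p k" for cs
  proof -
    have "poly.coeff (int_poly (1 # cs)) 0 = last (1 # cs)" by (simp add: coeff_int_poly last_conv_nth)
    then show ?thesis using that by (simp add: unit_constant_lists_def shift_char_def del: last.simps)
  qed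
  then have "(\<Sum>cs\<in>residue_lists p k. shift_char p d s (1 # cs)) = (\<Sum>cs\<in>unit_constant_lists p k. shift_char p d s (1 # cs))"
    by (intro sum.mono_neutral_right) (auto simp: unit_constant_lists_def)
  also have "\<dots> = (\<Sum>es\<in>unit_constant_lists p k. add_char p (shifted_exponent p d s (list_fps es)))"
    by (rule sum.reindex_bij_witness[where i = "monic_reverse p" and j = "monic_reverse p"])
      (auto simp: monic_reverse_involution[OF p_prime] monic_reverse_in[OF p_prime] shift_char_monic_reverse)
  also have "\<dots> = shift_sum d s k - (if k = 0 then 0 else shift_sum d s (k - 1))" by (rule sum_unit_constant_lists)
  finally show ?thesis .
qed

lemma bij_betw_monic: "bij_betw (\<lambda>(k, cs). 1 # cs) (Sigma UNIV (residue_lists p)) (monic_polys R)"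
proof (rule bij_betw_imageI)
  show "inj_on (\<lambda>(k, cs). 1 # cs) (Sigma UNIV (residue_lists p))"
    by (auto simp: inj_on_def residue_lists_def)
  have c: "carrier R = {0..<int p}" by (auto simp: res_carrier_eq)
  have mem: "f \<in> monic_polys R \<longleftrightarrow> (\<exists>cs. f = 1 # cs \<and> set cs \<subseteq> {0..<int p})" for f
  proof -
    have "f \<in> monic_polys R \<longleftrightarrow> polynomial (carrier R) f \<and> f \<noteq> [] \<and> hd f = 1"
      unfolding monic_polys_def univ_poly_carrier res_one_eq by simp
    also have "\<dots> \<longleftrightarrow> (\<exists>cs. f = 1 # cs \<and> set cs \<subseteq> {0..<int p})"
    proof (cases f)
      case (Cons a cs)
      have "int p > 1" using prime_gt_1_nat[OF p_prime] by simp
      then have "a = 1 \<Longrightarrow> a \<in> {0..<int p} \<and> a \<noteq> 0" by simp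
      then show ?thesis unfolding polynomial_def c res_zero_eq Cons list.sel by (intro iffI) simp_all
    qed simp
    finally show ?thesis .
  qed
  show "(\<lambda>(k, cs). 1 # cs) ` Sigma UNIV (residue_lists p) = monic_polys R"
    by (auto simp: mem residue_lists_def image_iff)
qed

lemma card_residue_lists: "card (residue_lists p k) = p ^ k"
  unfolding residue_lists_def using card_lists_length_eq[of "{0..<int p}" k] by (simp add: conj_commute)

lemma shift_char_abs_summable:
  assumes u: "real p * cmod u < 1"
  shows "(\<lambda>f. norm (shift_char p d s f * u ^ (length f - 1))) summable_on monic_polys R"
    and "(\<lambda>x. norm (case x of (k, cs) \<Rightarrow> shift_char p d s (1 # cs) * u ^ k)) summable_on Sigma UNIV (residue_lists p)"
proof -
  let ?g = "\<lambda>(k, cs). shift_char p d s (1 # cs) * u ^ k"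
  have le: "(\<Sum>cs\<in>residue_lists p k. norm (?g (k, cs))) \<le> (real p * cmod u) ^ k" for k
  proof -
    have "(\<Sum>cs\<in>residue_lists p k. norm (?g (k, cs))) \<le> (\<Sum>cs\<in>residue_lists p k. cmod u ^ k)"
      by (intro sum_mono) (simp add: norm_mult norm_power mult_left_le_one_le norm_shift_char)
    also have "\<dots> = (real p * cmod u) ^ k" by (simp add: card_residue_lists power_mult_distrib)
    finally show ?thesis .
  qed
  show 1: "(\<lambda>x. norm (?g x)) summable_on Sigma UNIV (residue_lists p)"
    unfolding Infinite_Sum.abs_summable_on_Sigma_iff
  proof (intro conjI ballI)
    show "(\<lambda>cs. norm (?g (k, cs))) summable_on residue_lists p k" for k by (rule summable_on_finite) simp
    have "summable (\<lambda>k. norm (\<Sum>cs\<in>residue_lists p k. norm (?g (k, cs))))"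
    proof (rule summable_comparison_test')
      show "summable (\<lambda>k. (real p * cmod u) ^ k)" by (rule summable_geometric) (use u in simp)
      fix k :: nat
      have "(\<Sum>cs\<in>residue_lists p k. norm (?g (k, cs))) \<ge> 0" by (rule sum_nonneg) simp
      then show "norm (norm (\<Sum>cs\<in>residue_lists p k. norm (?g (k, cs)))) \<le> (real p * cmod u) ^ k"
        using le[of k] by simp
    qed
    then have "(\<lambda>k. norm (\<Sum>cs\<in>residue_lists p k. norm (?g (k, cs)))) summable_on UNIV"
      by (intro norm_summable_imp_summable_on) simp
    then show "(\<lambda>k. norm (\<Sum>\<^sub>\<infinity>cs\<in>residue_lists p k. norm (?g (k, cs)))) summable_on UNIV"
      unfolding infsum_finite[OF finite_residue_lists] .
  qed
  have "(\<lambda>f. norm (shift_char p d s f * u ^ (length f - 1))) summable_on monic_polys R \<longleftrightarrow>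
      (\<lambda>x. norm (shift_char p d s ((\<lambda>(k, cs). 1 # cs) x) * u ^ (length ((\<lambda>(k, cs). 1 # cs) x) - 1))) summable_on Sigma UNIV (residue_lists p)"
    by (rule summable_on_reindex_bij_betw[OF bij_betw_monic, symmetric])
  also have "\<dots> \<longleftrightarrow> (\<lambda>x. norm (?g x)) summable_on Sigma UNIV (residue_lists p)"
    by (rule summable_on_cong) (auto simp: residue_lists_def)
  finally show "(\<lambda>f. norm (shift_char p d s f * u ^ (length f - 1))) summable_on monic_polys R" using 1 by simp
qed

text \<open>Grouped by degree, the coefficients are differences of consecutive sums, so summation by
  parts pulls out 1 - u. The boundary term at d vanishes, and so does everything beyond.\<close>

lemma infsum_shift_char:
  assumes u: "real p * cmod u < 1" and d: "d > 0" "\<not> p dvd d"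
  shows "infsum (\<lambda>f. shift_char p d s f * u ^ (length f - 1)) (monic_polys R) = (1 - u) * (\<Sum>k<d. shift_sum d s k * u ^ k)"
proof -
  let ?S = "shift_sum d s"
  let ?A = "\<lambda>k. ?S k - (if k = 0 then 0 else ?S (k - 1))"
  let ?g = "\<lambda>(k, cs). shift_char p d s (1 # cs) * u ^ k"
  have tele: "(\<Sum>k\<le>n. (S k - (if k = 0 then 0 else S (k - 1))) * u ^ k) = (1 - u) * (\<Sum>k<n. S k * u ^ k) + S n * u ^ n"
    for S :: "nat \<Rightarrow> complex" and n
    by (induction n) (simp_all add: algebra_simps)
  have zero: "?S k = 0" if "k \<ge> d" for k
    unfolding shift_sum_def by (rule shifted_char_sum_vanish[OF p_prime d that])
  have "infsum (\<lambda>f. shift_char p d s f * u ^ (length f - 1)) (monic_polys R) =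
      infsum (\<lambda>x. shift_char p d s ((\<lambda>(k, cs). 1 # cs) x) * u ^ (length ((\<lambda>(k, cs). 1 # cs) x) - 1)) (Sigma UNIV (residue_lists p))"
    by (rule infsum_reindex_bij_betw[OF bij_betw_monic, symmetric])
  also have "\<dots> = infsum ?g (Sigma UNIV (residue_lists p))"
    by (rule infsum_cong) (auto simp: residue_lists_def)
  also have "\<dots> = infsum (\<lambda>k. infsum (\<lambda>cs. ?g (k, cs)) (residue_lists p k)) UNIV"
    by (rule infsum_Sigma_banach[symmetric]) (rule abs_summable_summable[OF shift_char_abs_summable(2)[OF u]])
  also have "\<dots> = infsum (\<lambda>k. ?A k * u ^ k) UNIV"
  proof (rule infsum_cong)
    fix k
    have "infsum (\<lambda>cs. ?g (k, cs)) (residue_lists p k) = (\<Sum>cs\<in>residue_lists p k. shift_char p d s (1 # cs)) * u ^ k"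
      by (simp add: sum_distrib_right)
    then show "infsum (\<lambda>cs. ?g (k, cs)) (residue_lists p k) = ?A k * u ^ k" unfolding sum_shift_char_monic .
  qed
  also have "\<dots> = infsum (\<lambda>k. ?A k * u ^ k) {..d}"
    by (rule infsum_cong_neutral) (auto simp: zero)
  also have "\<dots> = (\<Sum>k\<le>d. ?A k * u ^ k)" by simp
  also have "\<dots> = (1 - u) * (\<Sum>k<d. ?S k * u ^ k) + ?S d * u ^ d"
    by (rule tele)
  also have "?S d = 0" by (rule zero) simp
  finally show ?thesis by simp
qed

lemma L_function_shift_char:
  assumes d: "d > 0" "\<not> p dvd d"
  shows "L_function R (shift_char p d s) z =
    (1 - of_nat p powr - z) * (\<Sum>k<d. shift_sum d s k * (of_nat p powr - z) ^ k)"
proof -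
  define P :: "complex poly" where "P = [:1, -1:] * (\<Sum>k<d. Polynomial.monom (shift_sum d s k) k)"
  have P: "poly P u = (1 - u) * (\<Sum>k<d. shift_sum d s k * u ^ k)" for u
    by (simp add: P_def poly_sum poly_monom left_diff_distrib)
  have ord: "order R = p" by (simp add: order_def card_carrier)
  have L: "is_L_polynomial R (shift_char p d s) P"
    unfolding is_L_polynomial_def ord
  proof (intro exI[of _ 1] allI impI)
    fix z :: complex assume z: "Re z > 1"
    define u where "u = (of_nat p :: complex) powr - z"
    have p1: "real p > 1" using prime_gt_1_nat[OF p_prime] by simp
    have "cmod u = real p powr - Re z" unfolding u_def using p1 by (subst norm_powr_real_powr) auto
    moreover have "real p * real p powr - Re z = real p powr (1 - Re z)"
      using p1 by (simp add: powr_diff powr_minus field_simps)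
    moreover have "real p powr (1 - Re z) < 1" using p1 z by (intro powr_less_one) auto
    ultimately have u: "real p * cmod u < 1" by simp
    have pw: "of_nat (poly_abs R f) powr - z = u ^ (length f - 1)" for f
    proof -
      have "of_nat (poly_abs R f) = (of_nat p :: complex) ^ (length f - 1)" by (simp add: poly_abs_def ord)
      moreover have "((of_nat p :: complex) ^ m) powr - z = u ^ m" for m
      proof (induction m)
        case (Suc m)
        have "((of_nat p :: complex) ^ Suc m) powr - z = of_nat p powr - z * ((of_nat p) ^ m) powr - z"
          using powr_times_real[of "of_nat p :: complex" "of_nat p ^ m" "- z"] by simp
        then show ?case using Suc by (simp add: u_def)
      qed simp
      ultimately show ?thesis by simp
    qed
    let ?\<phi> = "\<lambda>f. shift_char p d s f * u ^ (length f - 1)"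
    have "tendsto (\<lambda>F. \<Prod>\<pi>\<in>F. inverse (1 - ?\<phi> \<pi>)) (infsum ?\<phi> (monic_polys R)) (finite_subsets_at_top (monic_irreducibles R))"
    proof (rule euler_product)
      fix f g assume "f \<in> monic_polys R" "g \<in> monic_polys R"
      then have fg: "f \<in> carrier PR" "g \<in> carrier PR" "f \<noteq> []" "g \<noteq> []" by (auto simp: monic_polys_def)
      show "?\<phi> (f \<otimes>\<^bsub>PR\<^esub> g) = ?\<phi> f * ?\<phi> g"
        unfolding degree_poly_ring_mult[OF fg] shift_char_mult[OF fg(1,2)] power_add by (simp only: mult_ac)
    next
      show "?\<phi> \<one>\<^bsub>PR\<^esub> = 1" unfolding shift_char_one by (simp add: univ_poly_one)
    qed (rule shift_char_abs_summable(1)[OF u])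
    then show "has_euler_product R (shift_char p d s) z (poly P (of_nat p powr - z))"
      unfolding has_euler_product_def pw P u_def[symmetric] infsum_shift_char[OF u d] .
  qed
  have "(THE P. is_L_polynomial R (shift_char p d s) P) = P"
  proof (rule the_equality)
    show "is_L_polynomial R (shift_char p d s) P" by (rule L)
    fix Q assume Q: "is_L_polynomial R (shift_char p d s) Q"
    show "Q = P" by (rule L_polynomial_unique[OF _ Q L]) (simp only: ord prime_gt_1_nat[OF p_prime])
  qed
  then show ?thesis unfolding L_function_def ord by (simp only: P)
qed

end

lemma ex_power_three_root:
  assumes p: "prime p" "p mod 3 = 2" "p > 3"
  shows "\<exists>s. [s ^ (3 ^ a) = n] (mod int p)"
proof -
  \<comment> \<open>So 3 ^ a has an inverse \<open>m\<close> modulo p - 1, and n ^ m is the required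
    root by Fermat's theorem.\<close>
  have "\<not> 3 dvd p - 1" using p by presburger
  then have "coprime (3 ^ a) (p - 1)" using prime_imp_coprime[of 3 "p - 1"] by simp
  then obtain m where m: "[3 ^ a * m = Suc 0] (mod (p - 1))" using cong_solve_coprime_nat by blast
  have "m \<noteq> 0"
  proof
    assume "m = 0"
    then have "[0 = Suc 0] (mod (p - 1))" using m by simp
    then show False using p(3) by (simp add: cong_def)
  qed
  then have ge: "Suc 0 \<le> 3 ^ a * m" by (simp add: Suc_leI)
  then have "p - 1 dvd 3 ^ a * m - Suc 0" using m mod_eq_dvd_iff_nat[OF ge, of "p - 1"] unfolding cong_def by blast
  then obtain j where "3 ^ a * m - Suc 0 = (p - 1) * j" by (rule dvdE)
  then have M: "3 ^ a * m = Suc ((p - 1) * j)" using ge by linarith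
  have "[n ^ (3 ^ a * m) = n] (mod int p)"
  proof (cases "int p dvd n")
    case True
    then have "int p dvd n ^ (3 ^ a * m)" unfolding M by simp
    then show ?thesis using True by (simp add: cong_def dvd_eq_mod_eq_0)
  next
    case False
    have "p - 1 = Suc (p - 2)" using p(3) by simp
    then have "n ^ (p - 1) = n * n ^ (p - 2)" by (simp only: power_Suc)
    then have "[n ^ (p - 1) = 1] (mod int p)" using int_inverse_mod_prime[OF p(1) False] by simp
    then have "[n * (n ^ (p - 1)) ^ j = n * 1 ^ j] (mod int p)" by (intro cong_mult cong_refl cong_pow)
    then show ?thesis unfolding M by (simp add: power_mult)
  qed
  then have "[(n ^ m) ^ (3 ^ a) = n] (mod int p)" by (simp only: power_mult[symmetric] mult.commute)
  then show ?thesis by blast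
qed

lemma isCont_trinomial_product: "isCont (trinomial_product a) \<theta>"
  unfolding trinomial_product_def cis_conv_exp by (intro continuous_intros)

context residues_prime
begin

lemma power_char_sum_three_power:
  assumes p9: "p mod 9 = 2 \<or> p mod 9 = 5" and pa: "p > 3 ^ a" "p > 3"
  shows "(\<Sum>k<3 ^ a. power_char_sum p (3 ^ a) k * u ^ k) = (\<Prod>i<a. 1 + (of_nat p * u\<^sup>2) ^ (3 ^ i))"
proof (rule power_char_sum_generating[OF p_prime pa])
  fix b k :: nat assume b: "1 \<le> b" "b \<le> a" and k: "k < 2 * 3 ^ (b - 1)"
  obtain E t t' where E: "E > 0" "\<And>d. 0 < d \<Longrightarrow> d \<le> k \<Longrightarrow> p ^ d - 1 dvd E"
    and t: "[3 ^ (b - 1) * t = 3 ^ b] (mod E)" "[t * t' = 1] (mod E)" "t > 0" "t' > 0"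
    using ex_exponent[OF p_prime p9 b(1) k] by metis
  have "(3::nat) ^ b = 3 * 3 ^ (b - 1)" using b(1) by (cases b) auto
  moreover have "(3::nat) ^ b \<le> 3 ^ a" using b(2) by (intro power_increasing) auto
  ultimately have kp: "k < p" using k pa(1) by linarith
  show "power_char_sum p (3 ^ b) k = power_char_sum p (3 ^ (b - 1)) k"
    by (rule power_char_sum_tower[OF p_prime kp power_sums_periodic[OF E(2,1)] t]) simp_all
qed

text \<open>At the central point p u^2 = 1, so with u replaced by z u each factor becomes 1 + z^(2 *
  3^i); the square explains the angle 4 * pi * n / p. The sign in the congruence for
  \<open>s\<close> cancels the one from the translation, so that z = e(n / p).\<close>

lemma L_function_central:
  assumes p9: "p mod 9 = 2 \<or> p mod 9 = 5" and pa: "p > 3 ^ a" "p > 3"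
    and s: "[s ^ (3 ^ a) = - n] (mod int p)"
  shows "L_function R (shift_char p (3 ^ a) s) (1 / 2) =
    of_real (1 - real p powr - (1 / 2)) * trinomial_product a (4 * pi * of_int n / real p)"
proof -
  define u where "u = (of_nat p :: complex) powr - (1 / 2)"
  define z where "z = add_char p n"
  have p0: "real p > 0" using pa by simp
  have ureal: "u = of_real (real p powr - (1 / 2))"
    unfolding u_def using powr_of_real[of "real p" "- (1 / 2)"] p0 by simp
  have pd: "\<not> p dvd 3 ^ a"
  proof
    assume "p dvd 3 ^ a"
    then have "p dvd 3" using p_prime prime_dvd_power by blast
    then show False using pa(2) by (auto dest: dvd_imp_le)
  qed
  have u2: "of_nat p * u\<^sup>2 = 1"
  proof -
    have "(real p powr - (1 / 2))\<^sup>2 = inverse (real p)"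
      unfolding power2_eq_square powr_add[symmetric] using p0 by (simp add: powr_minus)
    then have "real p * (real p powr - (1 / 2))\<^sup>2 = 1" using p0 by simp
    then show ?thesis unfolding ureal by (metis of_real_mult of_real_of_nat_eq of_real_power of_real_1)
  qed
  have zs: "add_char p (- (s ^ (3 ^ a))) = z"
    unfolding z_def
  proof (rule add_char_eqI)
    have "int p dvd s ^ (3 ^ a) - (- n)" using s by (simp only: cong_iff_dvd_diff)
    then have "int p dvd - (s ^ (3 ^ a) - (- n))" by (simp only: dvd_minus_iff)
    then show "int p dvd - (s ^ (3 ^ a)) - n" by simp
  qed
  have S: "shift_sum (3 ^ a) s k * u ^ k = power_char_sum p (3 ^ a) k * (z * u) ^ k" if "k < 3 ^ a" for k
  proof -
    have "shift_sum (3 ^ a) s k = z ^ k * power_char_sum p (3 ^ a) k"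
      unfolding shift_sum_def zs[symmetric] by (rule shifted_power_char_sum[OF p_prime]) (use that pa in auto)
    then show ?thesis by (simp add: power_mult_distrib)
  qed
  have "L_function R (shift_char p (3 ^ a) s) (1 / 2) = (1 - u) * (\<Sum>k<3 ^ a. shift_sum (3 ^ a) s k * u ^ k)"
    unfolding u_def by (rule L_function_shift_char) (use pd in simp_all)
  also have "(\<Sum>k<3 ^ a. shift_sum (3 ^ a) s k * u ^ k) = (\<Sum>k<3 ^ a. power_char_sum p (3 ^ a) k * (z * u) ^ k)"
    by (rule sum.cong[OF refl]) (simp add: S)
  also have "\<dots> = (\<Prod>i<a. 1 + (of_nat p * (z * u)\<^sup>2) ^ (3 ^ i))" by (rule power_char_sum_three_power[OF p9 pa])
  also have "of_nat p * (z * u)\<^sup>2 = z\<^sup>2"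
  proof -
    have "of_nat p * (z * u)\<^sup>2 = z\<^sup>2 * (of_nat p * u\<^sup>2)" by (simp only: power_mult_distrib mult_ac)
    then show ?thesis unfolding u2 by simp
  qed
  also have "(\<Prod>i<a. 1 + (z\<^sup>2) ^ (3 ^ i)) = trinomial_product a (4 * pi * of_int n / real p)"
  proof -
    have "z\<^sup>2 = cis (4 * pi * of_int n / real p)"
      by (simp add: z_def add_char_def power2_eq_square cis_mult field_simps)
    then have "(z\<^sup>2) ^ (3 ^ i) = cis (3 ^ i * (4 * pi * of_int n / real p))" for i
      by (simp only: Complex.DeMoivre of_nat_power of_nat_numeral)
    then show ?thesis unfolding trinomial_product_def by simp
  qed
  finally show ?thesis unfolding ureal by simp
qed

end

theorem theorem3:
  shows "closure {L_function (residue_ring (int p)) \<eta> (1 / 2) | (p :: nat) g \<eta>.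
            prime p \<and>
            dirichlet_character (residue_ring (int p)) g \<eta> \<and>
            nontrivial_character (residue_ring (int p)) g \<eta> \<and>
            primitive_character (residue_ring (int p)) g \<eta>} = (UNIV :: complex set)"
    (is "closure ?S = UNIV")
proof -
  have "\<exists>y\<in>?S. dist y v < e" if e: "e > 0" for v :: complex and e :: real
  proof -
    obtain a \<theta> where a: "cmod (trinomial_product a \<theta> - v) < e" using trinomial_product_dense[OF e] by blast
    \<comment> \<open>Chosen so that 4 * pi * n p / p tends to \<open>\<theta>\<close>, while
      \<open>a\<close> stays fixed and p grows.\<close>
    define n where "n p = \<lfloor>\<theta> * real p / (4 * pi)\<rfloor>" for p :: nat
    define G where "G p = of_real (1 - real p powr - (1 / 2)) * trinomial_product a (4 * pi * of_int (n p) / real p)" for p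
    have "(\<lambda>p :: nat. 1 - real p powr - (1 / 2)) \<longlonglongrightarrow> 1" by real_asymp
    then have lim1: "(\<lambda>p :: nat. complex_of_real (1 - real p powr - (1 / 2))) \<longlonglongrightarrow> of_real 1"
      by (rule tendsto_of_real)
    have "(\<lambda>p :: nat. 4 * pi * of_int (n p) / real p) \<longlonglongrightarrow> \<theta>"
    proof (rule tendsto_sandwich[OF _ _ _ tendsto_const])
      show "(\<lambda>p :: nat. \<theta> - 4 * pi / real p) \<longlonglongrightarrow> \<theta>" by real_asymp
      show "\<forall>\<^sub>F p :: nat in sequentially. 4 * pi * of_int (n p) / real p \<le> \<theta>"
        using eventually_gt_at_top[of 0]
      proof eventually_elim
        case (elim p)
        have "of_int (n p) \<le> \<theta> * real p / (4 * pi)" unfolding n_def by (rule of_int_floor_le)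
        then show ?case using elim by (simp add: field_simps)
      qed
      show "\<forall>\<^sub>F p :: nat in sequentially. \<theta> - 4 * pi / real p \<le> 4 * pi * of_int (n p) / real p"
        using eventually_gt_at_top[of 0]
      proof eventually_elim
        case (elim p)
        have "\<theta> * real p / (4 * pi) < of_int (n p) + 1" unfolding n_def by (rule floor_correct[THEN conjunct2, simplified])
        then have "\<theta> \<le> 4 * pi * (of_int (n p) + 1) / real p" using elim by (simp add: field_simps)
        then show ?case by (simp add: distrib_left add_divide_distrib)
      qed
    qed
    then have lim2: "(\<lambda>p :: nat. trinomial_product a (4 * pi * of_int (n p) / real p)) \<longlonglongrightarrow> trinomial_product a \<theta>"
      by (rule isCont_tendsto_compose[OF isCont_trinomial_product])
    have "G \<longlonglongrightarrow> of_real 1 * trinomial_product a \<theta>" unfolding G_def by (rule tendsto_mult[OF lim1 lim2])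
    then have "(\<lambda>p. cmod (G p - v)) \<longlonglongrightarrow> cmod (trinomial_product a \<theta> - v)"
      by (intro tendsto_norm tendsto_diff tendsto_const) simp
    then have "\<forall>\<^sub>F p in sequentially. cmod (G p - v) < e" using a by (rule order_tendstoD(2))
    then obtain N where N: "\<And>p. p \<ge> N \<Longrightarrow> cmod (G p - v) < e" unfolding eventually_sequentially by blast
    have "\<exists>p \<in> {p :: nat. prime p \<and> (p mod 9 = 2 \<or> p mod 9 = 5)}. p > N + 3 ^ a + 3"
      using infinite_primes_generating_mod_9 unfolding infinite_nat_iff_unbounded by blast
    then obtain p :: nat where p: "prime p" "p mod 9 = 2 \<or> p mod 9 = 5" "p > N + 3 ^ a + 3" by blast
    have pa: "p > 3 ^ a" "p > 3" using p(3) by simp_all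
    interpret residues_prime p "residue_ring (int p)" by unfold_locales (use p in simp_all)
    have p3: "p mod 3 = 2"
    proof -
      have "p mod 3 = p mod 9 mod 3" by (simp add: mod_mod_cancel)
      then show ?thesis using p(2) by auto
    qed
    obtain s where s: "[s ^ (3 ^ a) = - n p] (mod int p)" using ex_power_three_root[OF p(1) p3 pa(2)] by blast
    have pd: "\<not> p dvd 3 ^ a"
    proof
      assume "p dvd 3 ^ a"
      then have "p dvd 3" using p(1) prime_dvd_power by blast
      then show False using pa(2) by (auto dest: dvd_imp_le)
    qed
    have L: "L_function (residue_ring (int p)) (shift_char p (3 ^ a) s) (1 / 2) = G p"
      unfolding G_def by (rule L_function_central[OF p(2) pa s])
    have d: "(3::nat) ^ a > 0" by simp
    have "G p \<in> ?S"
      unfolding L[symmetric]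
      using p(1) dirichlet_shift_char nontrivial_shift_char[OF d pd] primitive_shift_char[OF d pd] by blast
    moreover have "dist (G p) v < e" using N[of p] p(3) by (simp add: dist_norm)
    ultimately show ?thesis by blast
  qed
  then have "v \<in> closure ?S" for v unfolding closure_approachable by blast
  then show ?thesis by blast
qed

end
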